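(* Consider the Fermi-Ulam model (a particle between a fixed wall and a slowly moving wall at distance $d(\varepsilon t)$) and, for a fixed natural number $r$, the variables $(\hat I,\hat\phi)$ and the truncated Hamiltonian $\mathcal H_{\Sigma,r}(\hat I,\tau,\varepsilon)$ described in the context. Let $k$ be any prefixed natural number. Then along a solution of the system with impacts (with $\varepsilon$-independent initial action $I(0)>0$), on a time interval of length $O(\varepsilon^{-k})$: (i) the value of $\hat I$ is preserved with accuracy $O(\varepsilon^r)$, i.e. $\hat I(t)-\hat I(0)=O(\varepsilon^r)$; (ii) the value of $\hat\phi$ is given, with accuracy $O(\varepsilon^{r-k})$, by the integrable Hamiltonian system with Hamiltonian $\mathcal H_{\Sigma,r}$, i.e. by the solution of $\dot{\hat\phi}=\frac{\partial\mathcal H_{\Sigma,r}}{\partial\hat I}(\hat I,\varepsilon t,\varepsilon)$, $\hat I=\mathrm{const}$, with the same initial values $\hat I(0),\hat\phi(0)$.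
   Context: Setting. A particle of mass $1$ with coordinate $x$ moves on $0\le x\le d(\varepsilon t)$; $\varepsilon>0$ is a small parameter, $\tau=\varepsilon t$, $d\in C^\infty$, $d\ge\mathrm{const}>0$, and (when slow-time intervals growing as $\varepsilon\to0$ are considered) $d$ and all its derivatives are bounded on the real axis. Between the walls the velocity $v$ is constant; at the left wall $v\mapsto-v$; at the right wall $v\mapsto2\dot d-v$. Action: $I=|v|d/\pi$. Angle: $\phi=\pi x/d\in(0,\pi)$ when moving right, $\phi=\pi(2-x/d)\in(\pi,2\pi)$ when moving left. Between impacts $(I,\phi)$ obey the Hamiltonian equations with $$H=\frac{\pi^2I^2}{2d^2}-\varepsilon\frac{I\,d'(\tau)}{d}f(\phi),\qquad f(\phi)=\phi\ (0<\phi<\pi),\quad f(\phi)=\phi-2\pi\ (\pi<\phi<2\pi);$$ at the left wall ($\phi=0$) $I$ is preserved, and at the right wall ($\phi=\pi$) $I$ jumps by $-2d\dot d/\pi$. New variables. For a natural number $r$, $(I,\phi)\mapsto(\hat I,\hat\phi)$ is the canonical change with generating function $W=\hat I\phi+\varepsilon S(\hat I,\phi,\tau,\varepsilon)$, $S=S_1+\varepsilon S_2+\dots+\varepsilon^{r-2}S_{r-1}$, that is, $I=\hat I+\varepsilon\,\partial S/\partial\phi$, $\hat\phi=\phi+\varepsilon\,\partial S/\partial\hat I$ (for $r=1$, $S=0$). Here $S_i=S_i(\hat I,\phi,\tau)$ are $C^\infty$ in $\hat I,\tau$, continuous and $2\pi$-periodic in $\phi$ with zero average over $\phi$, chosen so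 that the new Hamiltonian $\mathcal H=H+\varepsilon^2\,\partial S/\partial\tau$ has the form $$\mathcal H=\mathcal H_{\Sigma,r}(\hat I,\tau,\varepsilon)+\varepsilon^rH_r(\hat I,\phi,\tau,\varepsilon),\quad \mathcal H_{\Sigma,r}=\frac{\pi^2\hat I^2}{2d(\tau)^2}+\varepsilon\mathcal H_1(\hat I,\tau)+\dots+\varepsilon^{r-1}\mathcal H_{r-1}(\hat I,\tau),$$ with $\mathcal H_i$ of class $C^\infty$ and $H_r=O(1)$ (uniformly for $\hat I$ in compact subsets of $(0,\infty)$). The functions $S_i,\mathcal H_i$ are found recursively by equating terms of the same order in $\varepsilon$. Conventions. $O(\cdot)$ is as $\varepsilon\to0$ with constants independent of $\varepsilon$ and $t$; phases are compared as continuous (lifted, real-valued) variables. *)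

theory Defs
  imports "HOL-Analysis.Analysis"
begin

text \<open>
  \<open>d\<close> is a function of the slow time \<open>\<tau> = \<epsilon> t\<close>; hence the wall velocity is \<open>\<epsilon> * deriv d (\<epsilon> * t)\<close>.
\<close>

primrec Ck_on :: "nat \<Rightarrow> 'a::real_normed_vector set \<Rightarrow> ('a \<Rightarrow> 'b::real_normed_vector) \<Rightarrow> bool" where
  "Ck_on 0 U g \<longleftrightarrow> continuous_on U g"
| "Ck_on (Suc n) U g \<longleftrightarrow> (\<forall>p\<in>U. g differentiable (at p)) \<and>
     (\<forall>h. Ck_on n U (\<lambda>p. frechet_derivative g (at p) h))"

text \<open>Intended for open \<open>U\<close>.\<close>

definition C_infinity_on :: "'a::real_normed_vector set \<Rightarrow> ('a \<Rightarrow> 'b::real_normed_vector) \<Rightarrow> bool" where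
  "C_infinity_on U g \<longleftrightarrow> (\<forall>n. Ck_on n U g)"

definition impact_times :: "(real \<Rightarrow> real) \<Rightarrow> real \<Rightarrow> real \<Rightarrow> (real \<Rightarrow> real) \<Rightarrow> real set" where
  "impact_times d \<epsilon> T x = {t \<in> {0..T}. x t = 0 \<or> x t = d (\<epsilon> * t)}"

text \<open>
  A motion on \<open>{0..T}\<close>. The velocity is right-continuous: at an impact time, \<open>v t\<close> is the velocity after
  the impact and \<open>u\<close> below is the velocity before it. If the particle starts at a wall, \<open>v 0\<close>
  is the velocity with which it leaves it.
\<close>

definition fermi_ulam_motion ::
  "(real \<Rightarrow> real) \<Rightarrow> real \<Rightarrow> real \<Rightarrow> (real \<Rightarrow> real) \<Rightarrow> (real \<Rightarrow> real) \<Rightarrow> bool" where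
  "fermi_ulam_motion d \<epsilon> T x v \<longleftrightarrow>
     continuous_on {0..T} x \<and>
     (\<forall>t\<in>{0..T}. 0 \<le> x t \<and> x t \<le> d (\<epsilon> * t)) \<and>
     finite (impact_times d \<epsilon> T x) \<and>
     (\<forall>t\<in>{0..T} - impact_times d \<epsilon> T x.
        (x has_real_derivative v t) (at t within {0..T}) \<and>
        (v has_real_derivative 0) (at t within {0..T})) \<and>
     (\<forall>t\<in>impact_times d \<epsilon> T x. t < T \<longrightarrow> (v \<longlongrightarrow> v t) (at_right t)) \<and>
     (\<forall>t\<in>impact_times d \<epsilon> T x. 0 < t \<longrightarrow>
        (\<exists>u. (v \<longlongrightarrow> u) (at_left t) \<and>
             v t = (if x t = 0 then - u else 2 * (\<epsilon> * deriv d (\<epsilon> * t)) - u)))"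

definition action :: "(real \<Rightarrow> real) \<Rightarrow> real \<Rightarrow> (real \<Rightarrow> real) \<Rightarrow> real \<Rightarrow> real" where
  "action d \<epsilon> v t = \<bar>v t\<bar> * d (\<epsilon> * t) / pi"

definition angle_of :: "real \<Rightarrow> real \<Rightarrow> real \<Rightarrow> real" where
  "angle_of w x v = (if v > 0 then pi * x / w else pi * (2 - x / w))"

text \<open>A continuous real-valued lift of the angle along the motion.\<close>

definition lifted_angle ::
  "(real \<Rightarrow> real) \<Rightarrow> real \<Rightarrow> real \<Rightarrow> (real \<Rightarrow> real) \<Rightarrow> (real \<Rightarrow> real) \<Rightarrow> (real \<Rightarrow> real) \<Rightarrow> bool" where
  "lifted_angle d \<epsilon> T x v \<phi> \<longleftrightarrow>
     continuous_on {0..T} \<phi> \<and>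
     (\<forall>t\<in>{0..T}. \<exists>n::int. \<phi> t = angle_of (d (\<epsilon> * t)) (x t) (v t) + 2 * pi * of_int n)"

text \<open>Only the values for \<open>\<phi> \<in> {0<..<pi} \<union> {pi<..<2*pi}\<close> are used.\<close>

definition saw :: "real \<Rightarrow> real" where
  "saw \<phi> = (if \<phi> < pi then \<phi> else \<phi> - 2 * pi)"

definition Ham :: "(real \<Rightarrow> real) \<Rightarrow> real \<Rightarrow> real \<Rightarrow> real \<Rightarrow> real \<Rightarrow> real" where
  "Ham d I \<phi> \<tau> \<epsilon> = pi^2 * I^2 / (2 * (d \<tau>)^2) - \<epsilon> * (I * deriv d \<tau> / d \<tau>) * saw \<phi>"

text \<open>
  \<open>Ssum r S J \<phi> \<tau> \<epsilon>\<close> is \<open>S\<^sub>1 + \<epsilon> S\<^sub>2 + \<dots> + \<epsilon>\<^sup>r\<^sup>-\<^sup>2 S\<^sub>r\<^sub>-\<^sub>1\<close>, where \<open>J\<close> stands for the new action. For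
  \<open>r = 1\<close> the sum is empty.
\<close>

definition Ssum :: "nat \<Rightarrow> (nat \<Rightarrow> real \<Rightarrow> real \<Rightarrow> real \<Rightarrow> real) \<Rightarrow> real \<Rightarrow> real \<Rightarrow> real \<Rightarrow> real \<Rightarrow> real" where
  "Ssum r S J \<phi> \<tau> \<epsilon> = (\<Sum>i\<in>{1..<r}. \<epsilon> ^ (i - 1) * S i J \<phi> \<tau>)"

text \<open>
  \<open>S\<close> has a corner at \<open>\<phi> = pi\<close> (mod \<open>2*pi\<close>), the phase of an impact with the moving wall. There the right
  derivative is the one belonging to the action after the impact, in accordance with the
  right-continuity of \<open>v\<close>; elsewhere it is the ordinary derivative.
\<close>

definition dS_phi :: "nat \<Rightarrow> (nat \<Rightarrow> real \<Rightarrow> real \<Rightarrow> real \<Rightarrow> real) \<Rightarrow> real \<Rightarrow> real \<Rightarrow> real \<Rightarrow> real \<Rightarrow> real" where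
  "dS_phi r S J \<phi> \<tau> \<epsilon> = vector_derivative (\<lambda>\<psi>. Ssum r S J \<psi> \<tau> \<epsilon>) (at_right \<phi>)"

definition dS_action :: "nat \<Rightarrow> (nat \<Rightarrow> real \<Rightarrow> real \<Rightarrow> real \<Rightarrow> real) \<Rightarrow> real \<Rightarrow> real \<Rightarrow> real \<Rightarrow> real \<Rightarrow> real" where
  "dS_action r S J \<phi> \<tau> \<epsilon> = deriv (\<lambda>K. Ssum r S K \<phi> \<tau> \<epsilon>) J"

definition dS_tau :: "nat \<Rightarrow> (nat \<Rightarrow> real \<Rightarrow> real \<Rightarrow> real \<Rightarrow> real) \<Rightarrow> real \<Rightarrow> real \<Rightarrow> real \<Rightarrow> real \<Rightarrow> real" where
  "dS_tau r S J \<phi> \<tau> \<epsilon> = deriv (\<lambda>\<sigma>. Ssum r S J \<phi> \<sigma> \<epsilon>) \<tau>"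

definition new_Ham ::
  "(real \<Rightarrow> real) \<Rightarrow> nat \<Rightarrow> (nat \<Rightarrow> real \<Rightarrow> real \<Rightarrow> real \<Rightarrow> real) \<Rightarrow> real \<Rightarrow> real \<Rightarrow> real \<Rightarrow> real \<Rightarrow> real" where
  "new_Ham d r S J \<phi> \<tau> \<epsilon> =
     Ham d (J + \<epsilon> * dS_phi r S J \<phi> \<tau> \<epsilon>) \<phi> \<tau> \<epsilon> + \<epsilon>^2 * dS_tau r S J \<phi> \<tau> \<epsilon>"

definition Ham_Sigma ::
  "(real \<Rightarrow> real) \<Rightarrow> nat \<Rightarrow> (nat \<Rightarrow> real \<Rightarrow> real \<Rightarrow> real) \<Rightarrow> real \<Rightarrow> real \<Rightarrow> real \<Rightarrow> real" where
  "Ham_Sigma d r h J \<tau> \<epsilon> = pi^2 * J^2 / (2 * (d \<tau>)^2) + (\<Sum>i\<in>{1..<r}. \<epsilon> ^ i * h i J \<tau>)"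

text \<open>
  The \<open>S i\<close> and \<open>h i\<close> with \<open>1 \<le> i < r\<close> bring the Hamiltonian into the form \<open>Ham_Sigma\<close> plus a
  remainder \<open>\<epsilon> ^ r * R\<close>. The remainder is required to be \<open>O(1)\<close> only locally uniformly in the action and in
  the slow time. As \<open>new_Ham\<close> is polynomial in \<open>\<epsilon>\<close>, this already forces the terms of each order below
  \<open>r\<close> to agree and so determines the \<open>S i\<close> and \<open>h i\<close>.
\<close>

definition normalizing ::
  "(real \<Rightarrow> real) \<Rightarrow> nat \<Rightarrow> (nat \<Rightarrow> real \<Rightarrow> real \<Rightarrow> real \<Rightarrow> real) \<Rightarrow> (nat \<Rightarrow> real \<Rightarrow> real \<Rightarrow> real) \<Rightarrow> bool" where
  "normalizing d r S h \<longleftrightarrow>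
     (\<forall>i\<in>{1..<r}.
        (\<forall>\<phi>. C_infinity_on ({0<..} \<times> UNIV) (\<lambda>(J, \<tau>). S i J \<phi> \<tau>)) \<and>
        (\<forall>J>0. \<forall>\<tau>.
           continuous_on UNIV (\<lambda>\<phi>. S i J \<phi> \<tau>) \<and>
           (\<forall>\<phi>. S i J (\<phi> + 2 * pi) \<tau> = S i J \<phi> \<tau>) \<and>
           integral {0..2 * pi} (\<lambda>\<phi>. S i J \<phi> \<tau>) = 0 \<and>
           (\<forall>\<phi>\<in>{0<..<pi} \<union> {pi<..<2 * pi}. (\<lambda>\<psi>. S i J \<psi> \<tau>) differentiable (at \<phi>))) \<and>
        C_infinity_on ({0<..} \<times> UNIV) (\<lambda>(J, \<tau>). h i J \<tau>)) \<and>
     (\<exists>R.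
        (\<forall>\<epsilon>>0. \<forall>J>0. \<forall>\<tau>. \<forall>\<phi>\<in>{0<..<pi} \<union> {pi<..<2 * pi}.
           new_Ham d r S J \<phi> \<tau> \<epsilon> = Ham_Sigma d r h J \<tau> \<epsilon> + \<epsilon> ^ r * R J \<phi> \<tau> \<epsilon>) \<and>
        (\<forall>K M. compact K \<and> K \<subseteq> {0<..} \<and> compact M \<longrightarrow>
           (\<exists>C. \<exists>\<epsilon>\<^sub>1>0. \<forall>\<epsilon>\<in>{0<..<\<epsilon>\<^sub>1}. \<forall>J\<in>K. \<forall>\<tau>\<in>M. \<forall>\<phi>\<in>{0<..<pi} \<union> {pi<..<2 * pi}.
              \<bar>R J \<phi> \<tau> \<epsilon>\<bar> \<le> C)))"

text \<open>
  The \<open>S i\<close> may be singular at zero action, so for fixed \<open>\<epsilon>\<close> the equation \<open>I = J + \<epsilon> * dS_phi\<close> may have spurious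
  roots \<open>J\<close> tending to \<open>0\<close> with \<open>\<epsilon>\<close>. The change of variables is the near-identity branch, selected here
  by \<open>\<bar>J - I\<bar> \<le> I / 2\<close>; for \<open>I\<close> in a compact subset of the positive axis and small \<open>\<epsilon>\<close> the particular
  factor does not matter.
\<close>

definition is_new_action ::
  "nat \<Rightarrow> (nat \<Rightarrow> real \<Rightarrow> real \<Rightarrow> real \<Rightarrow> real) \<Rightarrow> real \<Rightarrow> real \<Rightarrow> real \<Rightarrow> real \<Rightarrow> real \<Rightarrow> bool" where
  "is_new_action r S \<epsilon> I \<phi> \<tau> J \<longleftrightarrow> \<bar>J - I\<bar> \<le> I / 2 \<and> I = J + \<epsilon> * dS_phi r S J \<phi> \<tau> \<epsilon>"

definition new_action ::
  "nat \<Rightarrow> (nat \<Rightarrow> real \<Rightarrow> real \<Rightarrow> real \<Rightarrow> real) \<Rightarrow> real \<Rightarrow> real \<Rightarrow> real \<Rightarrow> real \<Rightarrow> real" where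
  "new_action r S \<epsilon> I \<phi> \<tau> = (THE J. is_new_action r S \<epsilon> I \<phi> \<tau> J)"

definition new_angle ::
  "nat \<Rightarrow> (nat \<Rightarrow> real \<Rightarrow> real \<Rightarrow> real \<Rightarrow> real) \<Rightarrow> real \<Rightarrow> real \<Rightarrow> real \<Rightarrow> real \<Rightarrow> real" where
  "new_angle r S \<epsilon> I \<phi> \<tau> = \<phi> + \<epsilon> * dS_action r S (new_action r S \<epsilon> I \<phi> \<tau>) \<phi> \<tau> \<epsilon>"

end

theory Submission
  imports Defs
begin

text \<open>
  The normal form of order \<open>r\<close> alone bounds only the rate of change of the new action by
  \<open>O(\<epsilon>\<^sup>r)\<close>, and over a time \<open>O(\<epsilon>\<^sup>-\<^sup>k)\<close> this would give a drift \<open>O(\<epsilon>\<^sup>r\<^sup>-\<^sup>k)\<close>. The stronger claim holds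
  because the normalization can be continued to the order \<open>r + k\<close> without changing the terms already
  found: the action of order \<open>r + k\<close> drifts by \<open>O(\<epsilon>\<^sup>r)\<close> only, and at each instant the action of order
  \<open>r\<close> differs from it by \<open>O(\<epsilon>\<^sup>r)\<close>. With the action known to accuracy \<open>O(\<epsilon>\<^sup>r)\<close>, the rate of the new
  phase is known to the same accuracy, and integration over the time \<open>O(\<epsilon>\<^sup>-\<^sup>k)\<close> costs the factor \<open>\<epsilon>\<^sup>-\<^sup>k\<close>.

  The terms. The system is invariant under multiplication of \<open>\<epsilon>\<close> and of all velocities by the same
  factor. Hence \<open>S\<^sub>i = J\<^sup>1\<^sup>-\<^sup>i s\<^sub>i(\<phi>, \<tau>)\<close> and \<open>h\<^sub>i = J\<^sup>2\<^sup>-\<^sup>i \<eta>\<^sub>i(\<tau>)\<close>, and after division by \<open>J\<^sup>2\<close> the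
  Hamilton-Jacobi equation contains \<open>\<epsilon>\<close> and \<open>J\<close> only through \<open>\<delta> = \<epsilon> / J\<close>. On \<open>-\<pi> \<le> \<phi> \<le> \<pi>\<close> the \<open>s\<^sub>i\<close> are
  polynomials in \<open>\<phi>\<close> whose coefficients are built from the derivatives of \<open>d\<close> and from \<open>1 / d\<close>
  (\<open>formal_solution\<close>), so every remainder is bounded as soon as \<open>d\<close> and its derivatives are. The given
  \<open>S\<^sub>i\<close> and \<open>h\<^sub>i\<close> coincide with these (\<open>normal_form_unique\<close>).

  The action. The new action is defined implicitly and jumps at the impacts by small amounts. Both
  inconveniences disappear if one freezes a value \<open>j\<close> of it and follows the residual of the
  Hamilton-Jacobi equation for this \<open>j\<close> along the motion: an elastic impact preserves the Hamiltonian,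
  so the residual is continuous (\<open>residual_continuous\<close>), and its rate is bounded by a multiple of \<open>\<epsilon>\<close>
  times the residual itself, up to \<open>O(\<epsilon>\<^sup>n\<^sup>+\<^sup>1)\<close> (\<open>residual_deriv\<close>, \<open>defect_rate_factor\<close>), where \<open>n\<close> is the
  order of the normal form. Therefore it stays \<open>O(\<epsilon>\<^sup>n)\<close> during a
  time of order \<open>1 / \<epsilon>\<close>. Choosing \<open>j\<close> anew after each such window changes it by \<open>O(\<epsilon>\<^sup>n)\<close>, and there are
  \<open>O(\<epsilon>\<^sup>1\<^sup>-\<^sup>k)\<close> windows (\<open>action_drift\<close>).

  The phase. With the action frozen at its initial value the new phase is continuous through the
  impacts as well, because the \<open>S\<^sub>i\<close> are continuous and periodic. An algebraic consequence of the
  Hamilton-Jacobi equation (\<open>HJ_eps\<close>) says that its rate is the frequency of the truncated Hamiltonian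
  up to \<open>O(\<epsilon>\<^sup>r)\<close> (\<open>phase_drift\<close>).
\<close>


section \<open>Polynomials in the phase with slowly varying coefficients\<close>

text \<open>
  The smallest family that contains the data of the wall and is closed under all operations of the
  normalization. It is closed under differentiation, so that boundedness of \<open>d\<close> and its derivatives
  on a set of slow times gives boundedness of every function that occurs later.
\<close>
inductive_set coeff_alg :: "(real \<Rightarrow> real) \<Rightarrow> (real \<Rightarrow> real) set" for d where
  const: "(\<lambda>\<tau>. c) \<in> coeff_alg d"
| deriv: "(deriv ^^ n) d \<in> coeff_alg d"
| inv: "(\<lambda>\<tau>. inverse (d \<tau>)) \<in> coeff_alg d"
| add: "a \<in> coeff_alg d \<Longrightarrow> b \<in> coeff_alg d \<Longrightarrow> (\<lambda>\<tau>. a \<tau> + b \<tau>) \<in> coeff_alg d"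
| mult: "a \<in> coeff_alg d \<Longrightarrow> b \<in> coeff_alg d \<Longrightarrow> (\<lambda>\<tau>. a \<tau> * b \<tau>) \<in> coeff_alg d"

text \<open>
  The first argument stands for \<open>\<delta> = \<epsilon> / J\<close>, the second for the phase on the period \<open>[-\<pi>, \<pi>]\<close>, the third
  for the slow time. On this period the saw-tooth function in the Hamiltonian is the identity, so no
  case distinctions are needed. The second rule only adds monomials: in this form antiderivatives in
  the phase are found termwise, and closure under products becomes a lemma.
\<close>
inductive_set phase_poly :: "(real \<Rightarrow> real) \<Rightarrow> (real \<Rightarrow> real \<Rightarrow> real \<Rightarrow> real) set" for d where
  monom: "a \<in> coeff_alg d \<Longrightarrow> (\<lambda>\<delta> \<theta> \<tau>. a \<tau> * \<theta> ^ n * \<delta> ^ m) \<in> phase_poly d"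
| add: "f \<in> phase_poly d \<Longrightarrow> g \<in> phase_poly d \<Longrightarrow>
    (\<lambda>\<delta> \<theta> \<tau>. f \<delta> \<theta> \<tau> + g \<delta> \<theta> \<tau>) \<in> phase_poly d"

definition D_eps :: "(real \<Rightarrow> real \<Rightarrow> real \<Rightarrow> real) \<Rightarrow> real \<Rightarrow> real \<Rightarrow> real \<Rightarrow> real" where
  "D_eps f \<delta> \<theta> \<tau> = deriv (\<lambda>x. f x \<theta> \<tau>) \<delta>"

definition D_ang :: "(real \<Rightarrow> real \<Rightarrow> real \<Rightarrow> real) \<Rightarrow> real \<Rightarrow> real \<Rightarrow> real \<Rightarrow> real" where
  "D_ang f \<delta> \<theta> \<tau> = deriv (\<lambda>x. f \<delta> x \<tau>) \<theta>"

definition D_slow :: "(real \<Rightarrow> real \<Rightarrow> real \<Rightarrow> real) \<Rightarrow> real \<Rightarrow> real \<Rightarrow> real \<Rightarrow> real" where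
  "D_slow f \<delta> \<theta> \<tau> = deriv (\<lambda>x. f \<delta> \<theta> x) \<tau>"

locale moving_wall =
  fixes d :: "real \<Rightarrow> real" and c\<^sub>0 :: real
  assumes smooth: "\<And>n \<tau>. (deriv ^^ n) d differentiable (at \<tau>)"
    and c\<^sub>0_pos: "c\<^sub>0 > 0" and d_ge: "\<And>\<tau>. c\<^sub>0 \<le> d \<tau>"
begin

lemma d_pos: "d \<tau> > 0"
  using c\<^sub>0_pos d_ge[of \<tau>] by linarith

lemma d_deriv: "((deriv ^^ n) d has_real_derivative (deriv ^^ Suc n) d \<tau>) (at \<tau>)"
  using smooth[of n \<tau>] by (simp add: DERIV_deriv_iff_real_differentiable)

lemma d_deriv0: "(d has_real_derivative deriv d \<tau>) (at \<tau>)"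
  using d_deriv[of 0] by simp

lemma coeff_alg_deriv:
  assumes "a \<in> coeff_alg d"
  shows "\<exists>a'\<in>coeff_alg d. \<forall>\<tau>. (a has_real_derivative a' \<tau>) (at \<tau>)"
  using assms
proof induction
  case (const c)
  show ?case by (rule bexI[of _ "\<lambda>_. 0"]) (auto intro: coeff_alg.const)
next
  case (deriv n)
  show ?case using d_deriv coeff_alg.deriv[of "Suc n" d] by blast
next
  case inv
  have *: "((\<lambda>\<tau>. inverse (d \<tau>)) has_real_derivative
      (\<lambda>\<tau>. -1 * ((deriv ^^ 1) d \<tau> * (inverse (d \<tau>) * inverse (d \<tau>)))) \<tau>) (at \<tau>)" for \<tau>
    using d_pos[of \<tau>] by (auto intro!: derivative_eq_intros d_deriv0 simp: field_simps)
  have "(\<lambda>\<tau>. -1 * ((deriv ^^ 1) d \<tau> * (inverse (d \<tau>) * inverse (d \<tau>)))) \<in> coeff_alg d"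
    by (rule coeff_alg.mult[OF coeff_alg.const coeff_alg.mult[OF coeff_alg.deriv
          coeff_alg.mult[OF coeff_alg.inv coeff_alg.inv]]])
  then show ?case by (rule bexI[rotated]) (rule allI, rule *)
next
  case (add a b)
  then obtain a' b' where *: "a' \<in> coeff_alg d" "b' \<in> coeff_alg d"
    "\<And>\<tau>. (a has_real_derivative a' \<tau>) (at \<tau>)" "\<And>\<tau>. (b has_real_derivative b' \<tau>) (at \<tau>)" by blast
  show ?case
    by (rule bexI[OF _ coeff_alg.add[OF *(1,2)]]) (auto intro!: derivative_eq_intros *)
next
  case (mult a b)
  then obtain a' b' where *: "a' \<in> coeff_alg d" "b' \<in> coeff_alg d"
    "\<And>\<tau>. (a has_real_derivative a' \<tau>) (at \<tau>)" "\<And>\<tau>. (b has_real_derivative b' \<tau>) (at \<tau>)" by blast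
  show ?case
    by (rule bexI[OF _ coeff_alg.add[OF coeff_alg.mult[OF *(1) mult(2)] coeff_alg.mult[OF mult(1) *(2)]]])
      (auto intro!: derivative_eq_intros *)
qed

lemma phase_poly_coeff: "a \<in> coeff_alg d \<Longrightarrow> (\<lambda>\<delta> \<theta> \<tau>. a \<tau>) \<in> phase_poly d"
  using phase_poly.monom[of a d 0 0] by simp

lemma phase_poly_const: "(\<lambda>\<delta> \<theta> \<tau>. c) \<in> phase_poly d"
  by (rule phase_poly_coeff[OF coeff_alg.const])

lemma phase_poly_eps: "(\<lambda>\<delta> \<theta> \<tau>. \<delta>) \<in> phase_poly d"
  using phase_poly.monom[OF coeff_alg.const[of 1 d], of 0 1] by simp

lemma phase_poly_ang: "(\<lambda>\<delta> \<theta> \<tau>. \<theta>) \<in> phase_poly d"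
  using phase_poly.monom[OF coeff_alg.const[of 1 d], of 1 0] by simp

lemma phase_poly_mult:
  assumes "f \<in> phase_poly d" "g \<in> phase_poly d"
  shows "(\<lambda>\<delta> \<theta> \<tau>. f \<delta> \<theta> \<tau> * g \<delta> \<theta> \<tau>) \<in> phase_poly d"
  using assms(1)
proof induction
  case (monom a n m)
  note a = this
  show ?case using assms(2)
  proof induction
    case (monom b k l)
    have "(\<lambda>\<delta> \<theta> \<tau>. (a \<tau> * b \<tau>) * \<theta> ^ (n + k) * \<delta> ^ (m + l)) \<in> phase_poly d"
      by (rule phase_poly.monom[OF coeff_alg.mult[OF a monom]])
    then show ?case by (simp add: power_add mult_ac)
  next
    case (add f g)
    then show ?case using phase_poly.add[OF add(3,4)] by (simp add: distrib_left)
  qed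
next
  case (add f g)
  then show ?case using phase_poly.add[OF add(3,4)] by (simp add: distrib_right)
qed

lemma phase_poly_uminus: "f \<in> phase_poly d \<Longrightarrow> (\<lambda>\<delta> \<theta> \<tau>. - f \<delta> \<theta> \<tau>) \<in> phase_poly d"
  using phase_poly_mult[OF phase_poly_const[of "-1"]] by simp

lemma phase_poly_diff:
  "f \<in> phase_poly d \<Longrightarrow> g \<in> phase_poly d \<Longrightarrow> (\<lambda>\<delta> \<theta> \<tau>. f \<delta> \<theta> \<tau> - g \<delta> \<theta> \<tau>) \<in> phase_poly d"
  using phase_poly.add[OF _ phase_poly_uminus] by simp

lemma phase_poly_power: "f \<in> phase_poly d \<Longrightarrow> (\<lambda>\<delta> \<theta> \<tau>. f \<delta> \<theta> \<tau> ^ n) \<in> phase_poly d"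
  by (induction n) (auto intro: phase_poly_const phase_poly_mult)

lemma phase_poly_sum:
  "(\<And>i. i \<in> X \<Longrightarrow> f i \<in> phase_poly d) \<Longrightarrow> (\<lambda>\<delta> \<theta> \<tau>. \<Sum>i\<in>X. f i \<delta> \<theta> \<tau>) \<in> phase_poly d"
  by (induction X rule: infinite_finite_induct) (auto intro: phase_poly_const phase_poly.add)

lemmas phase_poly_intros =
  phase_poly_const phase_poly_eps phase_poly_ang phase_poly.add phase_poly_mult
  phase_poly_uminus phase_poly_diff phase_poly_power phase_poly_sum

lemma phase_poly_at_eps:
  assumes "f \<in> phase_poly d"
  shows "(\<lambda>\<delta> \<theta> \<tau>. f c \<theta> \<tau>) \<in> phase_poly d"
  using assms
proof induction
  case (monom a n m)
  show ?case
    using phase_poly.monom[OF coeff_alg.mult[OF monom coeff_alg.const[of "c ^ m"]], of n 0]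
    by (simp add: mult_ac)
qed (rule phase_poly.add)

lemma phase_poly_at_ang:
  assumes "f \<in> phase_poly d"
  shows "(\<lambda>\<delta> \<theta> \<tau>. f \<delta> c \<tau>) \<in> phase_poly d"
  using assms
proof induction
  case (monom a n m)
  show ?case
    using phase_poly.monom[OF coeff_alg.mult[OF monom coeff_alg.const[of "c ^ n"]], of 0 m]
    by (simp add: mult_ac)
qed (rule phase_poly.add)

lemma ex_D_eps:
  assumes "f \<in> phase_poly d"
  shows "\<exists>g\<in>phase_poly d. \<forall>\<delta> \<theta> \<tau>. ((\<lambda>x. f x \<theta> \<tau>) has_real_derivative g \<delta> \<theta> \<tau>) (at \<delta>)"
  using assms
proof induction
  case (monom a n m)
  show ?case
    by (rule bexI[of _ "\<lambda>\<delta> \<theta> \<tau>. a \<tau> * \<theta> ^ n * (real m * \<delta> ^ (m - 1))"])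
      (auto intro!: derivative_eq_intros phase_poly_intros phase_poly_coeff monom)
next
  case (add f g)
  then obtain f' g' where *: "f' \<in> phase_poly d" "g' \<in> phase_poly d"
    "\<And>\<delta> \<theta> \<tau>. ((\<lambda>x. f x \<theta> \<tau>) has_real_derivative f' \<delta> \<theta> \<tau>) (at \<delta>)"
    "\<And>\<delta> \<theta> \<tau>. ((\<lambda>x. g x \<theta> \<tau>) has_real_derivative g' \<delta> \<theta> \<tau>) (at \<delta>)" by blast
  show ?case by (rule bexI[OF _ phase_poly.add[OF *(1,2)]]) (auto intro!: derivative_eq_intros *)
qed

lemma ex_D_ang:
  assumes "f \<in> phase_poly d"
  shows "\<exists>g\<in>phase_poly d. \<forall>\<delta> \<theta> \<tau>. ((\<lambda>x. f \<delta> x \<tau>) has_real_derivative g \<delta> \<theta> \<tau>) (at \<theta>)"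
  using assms
proof induction
  case (monom a n m)
  show ?case
    by (rule bexI[of _ "\<lambda>\<delta> \<theta> \<tau>. a \<tau> * (real n * \<theta> ^ (n - 1)) * \<delta> ^ m"])
      (auto intro!: derivative_eq_intros phase_poly_intros phase_poly_coeff monom)
next
  case (add f g)
  then obtain f' g' where *: "f' \<in> phase_poly d" "g' \<in> phase_poly d"
    "\<And>\<delta> \<theta> \<tau>. ((\<lambda>x. f \<delta> x \<tau>) has_real_derivative f' \<delta> \<theta> \<tau>) (at \<theta>)"
    "\<And>\<delta> \<theta> \<tau>. ((\<lambda>x. g \<delta> x \<tau>) has_real_derivative g' \<delta> \<theta> \<tau>) (at \<theta>)" by blast
  show ?case by (rule bexI[OF _ phase_poly.add[OF *(1,2)]]) (auto intro!: derivative_eq_intros *)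
qed

lemma ex_D_slow:
  assumes "f \<in> phase_poly d"
  shows "\<exists>g\<in>phase_poly d. \<forall>\<delta> \<theta> \<tau>. (f \<delta> \<theta> has_real_derivative g \<delta> \<theta> \<tau>) (at \<tau>)"
  using assms
proof induction
  case (monom a n m)
  then obtain a' where a': "a' \<in> coeff_alg d" "\<And>\<tau>. (a has_real_derivative a' \<tau>) (at \<tau>)"
    using coeff_alg_deriv by blast
  show ?case
    by (rule bexI[OF _ phase_poly.monom[OF a'(1), of n m]])
      (auto intro!: derivative_eq_intros a')
next
  case (add f g)
  then obtain f' g' where *: "f' \<in> phase_poly d" "g' \<in> phase_poly d"
    "\<And>\<delta> \<theta> \<tau>. (f \<delta> \<theta> has_real_derivative f' \<delta> \<theta> \<tau>) (at \<tau>)"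
    "\<And>\<delta> \<theta> \<tau>. (g \<delta> \<theta> has_real_derivative g' \<delta> \<theta> \<tau>) (at \<tau>)" by blast
  show ?case by (rule bexI[OF _ phase_poly.add[OF *(1,2)]]) (auto intro!: derivative_eq_intros *)
qed

lemma
  assumes "f \<in> phase_poly d"
  shows D_eps_in: "D_eps f \<in> phase_poly d"
    and D_eps: "((\<lambda>x. f x \<theta> \<tau>) has_real_derivative D_eps f \<delta> \<theta> \<tau>) (at \<delta>)"
proof -
  obtain g where g: "g \<in> phase_poly d"
    "\<And>\<delta> \<theta> \<tau>. ((\<lambda>x. f x \<theta> \<tau>) has_real_derivative g \<delta> \<theta> \<tau>) (at \<delta>)"
    using ex_D_eps[OF assms] by blast
  have "D_eps f = g" by (intro ext) (simp add: D_eps_def DERIV_imp_deriv[OF g(2)])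
  then show "D_eps f \<in> phase_poly d" "((\<lambda>x. f x \<theta> \<tau>) has_real_derivative D_eps f \<delta> \<theta> \<tau>) (at \<delta>)"
    using g by auto
qed

lemma
  assumes "f \<in> phase_poly d"
  shows D_ang_in: "D_ang f \<in> phase_poly d"
    and D_ang: "((\<lambda>x. f \<delta> x \<tau>) has_real_derivative D_ang f \<delta> \<theta> \<tau>) (at \<theta>)"
proof -
  obtain g where g: "g \<in> phase_poly d"
    "\<And>\<delta> \<theta> \<tau>. ((\<lambda>x. f \<delta> x \<tau>) has_real_derivative g \<delta> \<theta> \<tau>) (at \<theta>)"
    using ex_D_ang[OF assms] by blast
  have "D_ang f = g" by (intro ext) (simp add: D_ang_def DERIV_imp_deriv[OF g(2)])
  then show "D_ang f \<in> phase_poly d" "((\<lambda>x. f \<delta> x \<tau>) has_real_derivative D_ang f \<delta> \<theta> \<tau>) (at \<theta>)"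
    using g by auto
qed

lemma
  assumes "f \<in> phase_poly d"
  shows D_slow_in: "D_slow f \<in> phase_poly d"
    and D_slow: "(f \<delta> \<theta> has_real_derivative D_slow f \<delta> \<theta> \<tau>) (at \<tau>)"
proof -
  obtain g where g: "g \<in> phase_poly d"
    "\<And>\<delta> \<theta> \<tau>. (f \<delta> \<theta> has_real_derivative g \<delta> \<theta> \<tau>) (at \<tau>)"
    using ex_D_slow[OF assms] by blast
  have "D_slow f = g" by (intro ext) (simp add: D_slow_def DERIV_imp_deriv[OF g(2)])
  then show "D_slow f \<in> phase_poly d" "(f \<delta> \<theta> has_real_derivative D_slow f \<delta> \<theta> \<tau>) (at \<tau>)"
    using g by auto
qed

lemma
  shows D_eps_eqI: "(\<And>\<delta> \<theta> \<tau>. ((\<lambda>x. f x \<theta> \<tau>) has_real_derivative g \<delta> \<theta> \<tau>) (at \<delta>)) \<Longrightarrow> D_eps f = g"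
    and D_ang_eqI: "(\<And>\<delta> \<theta> \<tau>. ((\<lambda>x. f \<delta> x \<tau>) has_real_derivative g \<delta> \<theta> \<tau>) (at \<theta>)) \<Longrightarrow> D_ang f = g"
    and D_slow_eqI: "(\<And>\<delta> \<theta> \<tau>. (f \<delta> \<theta> has_real_derivative g \<delta> \<theta> \<tau>) (at \<tau>)) \<Longrightarrow> D_slow f = g"
  by (auto intro!: ext DERIV_imp_deriv simp: D_eps_def D_ang_def D_slow_def)

lemma phase_poly_chain:
  assumes "f \<in> phase_poly d"
    and "(\<theta> has_real_derivative \<theta>') (at t)" "(s has_real_derivative s') (at t)"
  shows "((\<lambda>t. f \<delta> (\<theta> t) (s t)) has_real_derivative
           D_ang f \<delta> (\<theta> t) (s t) * \<theta>' + D_slow f \<delta> (\<theta> t) (s t) * s') (at t)"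
  using assms(1)
proof induction
  case (monom a n m)
  then obtain a' where a': "a' \<in> coeff_alg d" "\<And>\<tau>. (a has_real_derivative a' \<tau>) (at \<tau>)"
    using coeff_alg_deriv by blast
  have 1: "D_ang (\<lambda>\<delta> \<theta> \<tau>. a \<tau> * \<theta> ^ n * \<delta> ^ m) = (\<lambda>\<delta> \<theta> \<tau>. a \<tau> * (real n * \<theta> ^ (n - 1)) * \<delta> ^ m)"
    by (rule D_ang_eqI) (auto intro!: derivative_eq_intros)
  have 2: "D_slow (\<lambda>\<delta> \<theta> \<tau>. a \<tau> * \<theta> ^ n * \<delta> ^ m) = (\<lambda>\<delta> \<theta> \<tau>. a' \<tau> * \<theta> ^ n * \<delta> ^ m)"
    by (rule D_slow_eqI) (auto intro!: derivative_eq_intros a')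
  have 3: "((\<lambda>t. a (s t)) has_real_derivative a' (s t) * s') (at t)"
    by (rule DERIV_chain2[OF a'(2) assms(3)])
  show ?case unfolding 1 2
    by (auto intro!: derivative_eq_intros 3 assms simp: algebra_simps)
next
  case (add f g)
  have 1: "D_ang (\<lambda>\<delta> \<theta> \<tau>. f \<delta> \<theta> \<tau> + g \<delta> \<theta> \<tau>) = (\<lambda>\<delta> \<theta> \<tau>. D_ang f \<delta> \<theta> \<tau> + D_ang g \<delta> \<theta> \<tau>)"
    by (rule D_ang_eqI) (auto intro!: derivative_eq_intros D_ang add)
  have 2: "D_slow (\<lambda>\<delta> \<theta> \<tau>. f \<delta> \<theta> \<tau> + g \<delta> \<theta> \<tau>) = (\<lambda>\<delta> \<theta> \<tau>. D_slow f \<delta> \<theta> \<tau> + D_slow g \<delta> \<theta> \<tau>)"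
    by (rule D_slow_eqI) (auto intro!: derivative_eq_intros D_slow add)
  show ?case unfolding 1 2
    using DERIV_add[OF add(3,4)] by (simp add: algebra_simps)
qed

lemma D_add:
  assumes "f \<in> phase_poly d" "g \<in> phase_poly d"
  shows D_eps_add: "D_eps (\<lambda>\<delta> \<theta> \<tau>. f \<delta> \<theta> \<tau> + g \<delta> \<theta> \<tau>) = (\<lambda>\<delta> \<theta> \<tau>. D_eps f \<delta> \<theta> \<tau> + D_eps g \<delta> \<theta> \<tau>)"
    and D_ang_add: "D_ang (\<lambda>\<delta> \<theta> \<tau>. f \<delta> \<theta> \<tau> + g \<delta> \<theta> \<tau>) = (\<lambda>\<delta> \<theta> \<tau>. D_ang f \<delta> \<theta> \<tau> + D_ang g \<delta> \<theta> \<tau>)"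
    and D_slow_add: "D_slow (\<lambda>\<delta> \<theta> \<tau>. f \<delta> \<theta> \<tau> + g \<delta> \<theta> \<tau>) = (\<lambda>\<delta> \<theta> \<tau>. D_slow f \<delta> \<theta> \<tau> + D_slow g \<delta> \<theta> \<tau>)"
  by (rule D_eps_eqI D_ang_eqI D_slow_eqI,
      auto intro!: derivative_eq_intros D_eps D_ang D_slow assms)+

lemma
  assumes "f \<in> phase_poly d"
  shows D_slow_ang: "D_slow (D_ang f) = D_ang (D_slow f)"
    and D_eps_ang: "D_eps (D_ang f) = D_ang (D_eps f)"
    and D_eps_slow: "D_eps (D_slow f) = D_slow (D_eps f)"
proof -
  have "D_slow (D_ang f) = D_ang (D_slow f) \<and> D_eps (D_ang f) = D_ang (D_eps f)
      \<and> D_eps (D_slow f) = D_slow (D_eps f)"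
    using assms
  proof induction
    case (monom a n m)
    then obtain a' where a': "a' \<in> coeff_alg d" "\<And>\<tau>. (a has_real_derivative a' \<tau>) (at \<tau>)"
      using coeff_alg_deriv by blast
    have 1: "D_ang (\<lambda>\<delta> \<theta> \<tau>. a \<tau> * \<theta> ^ n * \<delta> ^ m) = (\<lambda>\<delta> \<theta> \<tau>. a \<tau> * (real n * \<theta> ^ (n - 1)) * \<delta> ^ m)"
      by (rule D_ang_eqI) (auto intro!: derivative_eq_intros)
    have 2: "D_slow (\<lambda>\<delta> \<theta> \<tau>. a \<tau> * \<theta> ^ n * \<delta> ^ m) = (\<lambda>\<delta> \<theta> \<tau>. a' \<tau> * \<theta> ^ n * \<delta> ^ m)"
      by (rule D_slow_eqI) (auto intro!: derivative_eq_intros a')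
    have 3: "D_eps (\<lambda>\<delta> \<theta> \<tau>. a \<tau> * \<theta> ^ n * \<delta> ^ m) = (\<lambda>\<delta> \<theta> \<tau>. a \<tau> * \<theta> ^ n * (real m * \<delta> ^ (m - 1)))"
      by (rule D_eps_eqI) (auto intro!: derivative_eq_intros)
    have "D_slow (\<lambda>\<delta> \<theta> \<tau>. a \<tau> * (real n * \<theta> ^ (n - 1)) * \<delta> ^ m)
        = (\<lambda>\<delta> \<theta> \<tau>. a' \<tau> * (real n * \<theta> ^ (n - 1)) * \<delta> ^ m)"
      "D_ang (\<lambda>\<delta> \<theta> \<tau>. a' \<tau> * \<theta> ^ n * \<delta> ^ m) = (\<lambda>\<delta> \<theta> \<tau>. a' \<tau> * (real n * \<theta> ^ (n - 1)) * \<delta> ^ m)"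
      "D_eps (\<lambda>\<delta> \<theta> \<tau>. a \<tau> * (real n * \<theta> ^ (n - 1)) * \<delta> ^ m)
        = (\<lambda>\<delta> \<theta> \<tau>. a \<tau> * (real n * \<theta> ^ (n - 1)) * (real m * \<delta> ^ (m - 1)))"
      "D_ang (\<lambda>\<delta> \<theta> \<tau>. a \<tau> * \<theta> ^ n * (real m * \<delta> ^ (m - 1)))
        = (\<lambda>\<delta> \<theta> \<tau>. a \<tau> * (real n * \<theta> ^ (n - 1)) * (real m * \<delta> ^ (m - 1)))"
      "D_eps (\<lambda>\<delta> \<theta> \<tau>. a' \<tau> * \<theta> ^ n * \<delta> ^ m) = (\<lambda>\<delta> \<theta> \<tau>. a' \<tau> * \<theta> ^ n * (real m * \<delta> ^ (m - 1)))"
      "D_slow (\<lambda>\<delta> \<theta> \<tau>. a \<tau> * \<theta> ^ n * (real m * \<delta> ^ (m - 1)))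
        = (\<lambda>\<delta> \<theta> \<tau>. a' \<tau> * \<theta> ^ n * (real m * \<delta> ^ (m - 1)))"
      by (rule D_eps_eqI D_ang_eqI D_slow_eqI, auto intro!: derivative_eq_intros a')+
    then show ?case by (simp only: 1 2 3 simp_thms)
  next
    case (add f g)
    then show ?case by (simp add: D_add D_eps_in D_ang_in D_slow_in)
  qed
  then show "D_slow (D_ang f) = D_ang (D_slow f)" "D_eps (D_ang f) = D_ang (D_eps f)"
    "D_eps (D_slow f) = D_slow (D_eps f)" by blast+
qed

lemma phase_poly_antideriv:
  assumes "f \<in> phase_poly d"
  shows "\<exists>g\<in>phase_poly d. D_ang g = f"
  using assms
proof induction
  case (monom a n m)
  have "(\<lambda>\<tau>. a \<tau> * (1 / real (Suc n))) \<in> coeff_alg d"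
    by (rule coeff_alg.mult[OF monom coeff_alg.const])
  from phase_poly.monom[OF this, of "Suc n" m]
  have 1: "(\<lambda>\<delta> \<theta> \<tau>. a \<tau> * (1 / real (Suc n)) * \<theta> ^ Suc n * \<delta> ^ m) \<in> phase_poly d" .
  have 2: "D_ang (\<lambda>\<delta> \<theta> \<tau>. a \<tau> * (1 / real (Suc n)) * \<theta> ^ Suc n * \<delta> ^ m)
      = (\<lambda>\<delta> \<theta> \<tau>. a \<tau> * \<theta> ^ n * \<delta> ^ m)"
  proof (rule D_ang_eqI)
    fix \<delta> \<theta> \<tau>
    have *: "((\<lambda>x. x ^ Suc n) has_real_derivative real (Suc n) * \<theta> ^ n) (at \<theta>)"
      using DERIV_pow[of "Suc n" \<theta>] by (simp del: of_nat_Suc power_Suc)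
    show "((\<lambda>x. a \<tau> * (1 / real (Suc n)) * x ^ Suc n * \<delta> ^ m) has_real_derivative
        a \<tau> * \<theta> ^ n * \<delta> ^ m) (at \<theta>)"
      using DERIV_cmult_right[OF DERIV_cmult[OF *, of "a \<tau> * (1 / real (Suc n))"], of "\<delta> ^ m"]
      by (simp del: of_nat_Suc power_Suc)
  qed
  show ?case
    by (rule bexI[of _ "\<lambda>\<delta> \<theta> \<tau>. a \<tau> * (1 / real (Suc n)) * \<theta> ^ Suc n * \<delta> ^ m"]) (rule 2, rule 1)
next
  case (add f g)
  then obtain f' g' where *: "f' \<in> phase_poly d" "g' \<in> phase_poly d" "D_ang f' = f" "D_ang g' = g"
    by blast
  show ?case
    by (rule bexI[OF _ phase_poly.add[OF *(1,2)]]) (simp add: D_ang_add *)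
qed

text \<open>
  Taylor's formula of order one in \<open>\<delta>\<close>, with a remainder of the same kind. It isolates the term of
  lowest order at each step of the normalization.
\<close>
lemma phase_poly_split:
  assumes "f \<in> phase_poly d"
  shows "\<exists>g\<in>phase_poly d. \<forall>\<delta> \<theta> \<tau>. f \<delta> \<theta> \<tau> = f 0 \<theta> \<tau> + \<delta> * g \<delta> \<theta> \<tau>"
  using assms
proof induction
  case (monom a n m)
  show ?case
  proof (cases m)
    case 0
    then show ?thesis by (intro bexI[of _ "\<lambda>\<delta> \<theta> \<tau>. 0"]) (auto intro: phase_poly_intros)
  next
    case (Suc k)
    then show ?thesis
      by (intro bexI[OF _ phase_poly.monom[OF monom, of n k]]) auto
  qed
next
  case (add f g)
  then obtain f' g' where *: "f' \<in> phase_poly d" "g' \<in> phase_poly d"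
    "\<And>\<delta> \<theta> \<tau>. f \<delta> \<theta> \<tau> = f 0 \<theta> \<tau> + \<delta> * f' \<delta> \<theta> \<tau>"
    "\<And>\<delta> \<theta> \<tau>. g \<delta> \<theta> \<tau> = g 0 \<theta> \<tau> + \<delta> * g' \<delta> \<theta> \<tau>" by blast
  show ?case
  proof (rule bexI[OF _ phase_poly.add[OF *(1,2)]], intro allI)
    fix \<delta> \<theta> \<tau>
    show "f \<delta> \<theta> \<tau> + g \<delta> \<theta> \<tau> = f 0 \<theta> \<tau> + g 0 \<theta> \<tau> + \<delta> * (f' \<delta> \<theta> \<tau> + g' \<delta> \<theta> \<tau>)"
      using *(3)[of \<delta> \<theta> \<tau>] *(4)[of \<delta> \<theta> \<tau>] by (simp add: algebra_simps)
  qed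
qed

end

section \<open>Formal solution of the Hamilton-Jacobi equation\<close>

text \<open>
  \<open>J\<close> times this function at \<open>\<delta> = \<epsilon> / J\<close> is \<open>\<epsilon>\<close> times the generating function.
\<close>
definition generating :: "(nat \<Rightarrow> real \<Rightarrow> real \<Rightarrow> real) \<Rightarrow> nat \<Rightarrow> real \<Rightarrow> real \<Rightarrow> real \<Rightarrow> real" where
  "generating s n \<delta> \<theta> \<tau> = (\<Sum>i\<in>{1..<n}. \<delta> ^ i * s i \<theta> \<tau>)"

definition energy_terms :: "(nat \<Rightarrow> real \<Rightarrow> real) \<Rightarrow> nat \<Rightarrow> real \<Rightarrow> real \<Rightarrow> real \<Rightarrow> real" where
  "energy_terms \<eta> n \<delta> \<theta> \<tau> = (\<Sum>i\<in>{1..<n}. \<delta> ^ i * \<eta> i \<tau>)"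

text \<open>
  The factor of \<open>I\<^sup>2 / 2\<close> in the Hamiltonian, which is the frequency divided by the action.
\<close>
definition stiffness :: "(real \<Rightarrow> real) \<Rightarrow> real \<Rightarrow> real" where
  "stiffness d \<tau> = pi^2 / (d \<tau>)^2"

definition strain :: "(real \<Rightarrow> real) \<Rightarrow> real \<Rightarrow> real" where
  "strain d \<tau> = deriv d \<tau> / d \<tau>"

text \<open>
  The Hamilton-Jacobi equation for \<open>\<epsilon> S = J \<sigma>(\<epsilon> / J, \<phi>, \<tau>)\<close> and the new Hamiltonian
  \<open>J\<^sup>2 (A / 2 + e)\<close>, divided by \<open>J\<^sup>2\<close>; here \<open>A\<close> is the stiffness.
\<close>
definition solves_HJ :: "(real \<Rightarrow> real) \<Rightarrow> (real \<Rightarrow> real \<Rightarrow> real \<Rightarrow> real) \<Rightarrow> (real \<Rightarrow> real \<Rightarrow> real \<Rightarrow> real) \<Rightarrow>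
    nat \<Rightarrow> (real \<Rightarrow> real \<Rightarrow> real \<Rightarrow> real) \<Rightarrow> bool" where
  "solves_HJ d \<sigma> e n R \<longleftrightarrow> (\<forall>\<delta> \<theta> \<tau>.
     stiffness d \<tau> / 2 * (1 + D_ang \<sigma> \<delta> \<theta> \<tau>)^2 - \<delta> * strain d \<tau> * \<theta> * (1 + D_ang \<sigma> \<delta> \<theta> \<tau>)
       + \<delta> * D_slow \<sigma> \<delta> \<theta> \<tau>
     = stiffness d \<tau> / 2 + e \<delta> \<theta> \<tau> + \<delta> ^ n * R \<delta> \<theta> \<tau>)"

text \<open>
  The antiderivative expresses the zero mean over a period in a form that needs no integrability.
\<close>
definition zero_mean_periodic :: "(real \<Rightarrow> real \<Rightarrow> real) \<Rightarrow> bool" where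
  "zero_mean_periodic g \<longleftrightarrow> (\<forall>\<tau>. g pi \<tau> = g (- pi) \<tau> \<and>
     (\<exists>G. G pi = G (- pi) \<and> (\<forall>\<theta>. (G has_real_derivative g \<theta> \<tau>) (at \<theta>))))"

context moving_wall
begin

lemma stiffness_coeff: "stiffness d \<in> coeff_alg d"
proof -
  have "(\<lambda>\<tau>. pi^2 * (inverse (d \<tau>) * inverse (d \<tau>))) \<in> coeff_alg d"
    by (intro coeff_alg.mult coeff_alg.const coeff_alg.inv)
  moreover have "stiffness d = (\<lambda>\<tau>. pi^2 * (inverse (d \<tau>) * inverse (d \<tau>)))"
    by (intro ext) (simp add: stiffness_def power2_eq_square field_simps)
  ultimately show ?thesis by simp
qed

lemma inverse_stiffness_coeff: "(\<lambda>\<tau>. 1 / stiffness d \<tau>) \<in> coeff_alg d"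
proof -
  have "(\<lambda>\<tau>. (1 / pi^2) * ((deriv ^^ 0) d \<tau> * (deriv ^^ 0) d \<tau>)) \<in> coeff_alg d"
    by (intro coeff_alg.mult coeff_alg.const coeff_alg.deriv)
  moreover have "(\<lambda>\<tau>. 1 / stiffness d \<tau>) = (\<lambda>\<tau>. (1 / pi^2) * ((deriv ^^ 0) d \<tau> * (deriv ^^ 0) d \<tau>))"
    by (intro ext) (simp add: stiffness_def power2_eq_square field_simps)
  ultimately show ?thesis by simp
qed

lemma strain_coeff: "strain d \<in> coeff_alg d"
proof -
  have "(\<lambda>\<tau>. (deriv ^^ 1) d \<tau> * inverse (d \<tau>)) \<in> coeff_alg d"
    by (intro coeff_alg.mult coeff_alg.deriv coeff_alg.inv)
  moreover have "strain d = (\<lambda>\<tau>. (deriv ^^ 1) d \<tau> * inverse (d \<tau>))"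
    by (intro ext) (simp add: strain_def field_simps)
  ultimately show ?thesis by simp
qed

lemma stiffness_pos: "stiffness d \<tau> > 0"
  using d_pos[of \<tau>] by (simp add: stiffness_def)

lemmas stiffness_in = phase_poly_coeff[OF stiffness_coeff]
  and inverse_stiffness_in = phase_poly_coeff[OF inverse_stiffness_coeff]
  and strain_in = phase_poly_coeff[OF strain_coeff]

lemma generating_in:
  "(\<And>i. i \<in> {1..<n} \<Longrightarrow> (\<lambda>_. s i) \<in> phase_poly d) \<Longrightarrow> generating s n \<in> phase_poly d"
  unfolding generating_def[abs_def] by (intro phase_poly_intros)

lemma energy_terms_in:
  "(\<And>i. i \<in> {1..<n} \<Longrightarrow> (\<lambda>_ _. \<eta> i) \<in> phase_poly d) \<Longrightarrow> energy_terms \<eta> n \<in> phase_poly d"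
  unfolding energy_terms_def[abs_def] by (intro phase_poly_intros)

lemma generating_D_ang:
  assumes "\<And>i. i \<in> {1..<n} \<Longrightarrow> (\<lambda>_. s i) \<in> phase_poly d"
  shows "D_ang (generating s n) = (\<lambda>\<delta> \<theta> \<tau>. \<Sum>i\<in>{1..<n}. \<delta> ^ i * D_ang (\<lambda>_. s i) \<delta> \<theta> \<tau>)"
proof (rule D_ang_eqI)
  have *: "(\<lambda>_. s i) \<in> phase_poly d" if "i \<in> {1..<n}" for i using assms that by blast
  show "((\<lambda>x. generating s n \<delta> x \<tau>) has_real_derivative
      (\<Sum>i\<in>{1..<n}. \<delta> ^ i * D_ang (\<lambda>_. s i) \<delta> \<theta> \<tau>)) (at \<theta>)" for \<delta> \<theta> \<tau>
    unfolding generating_def[abs_def] by (intro DERIV_sum DERIV_cmult D_ang[OF *])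
qed

lemma generating_D_slow:
  assumes "\<And>i. i \<in> {1..<n} \<Longrightarrow> (\<lambda>_. s i) \<in> phase_poly d"
  shows "D_slow (generating s n) = (\<lambda>\<delta> \<theta> \<tau>. \<Sum>i\<in>{1..<n}. \<delta> ^ i * D_slow (\<lambda>_. s i) \<delta> \<theta> \<tau>)"
proof (rule D_slow_eqI)
  have *: "(\<lambda>_. s i) \<in> phase_poly d" if "i \<in> {1..<n}" for i using assms that by blast
  show "(generating s n \<delta> \<theta> has_real_derivative
      (\<Sum>i\<in>{1..<n}. \<delta> ^ i * D_slow (\<lambda>_. s i) \<delta> \<theta> \<tau>)) (at \<tau>)" for \<delta> \<theta> \<tau>
    unfolding generating_def[abs_def] by (intro DERIV_sum DERIV_cmult D_slow[OF *])
qed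

text \<open>
  The equation for the term of one order. The slowly varying mean has to be split off since only then
  the antiderivative in the phase is periodic; the free constant of integration is spent on making
  the solution itself of zero mean.
\<close>
lemma homological_equation:
  assumes g: "(\<lambda>_. g) \<in> phase_poly d"
  shows "\<exists>u m. (\<lambda>_. u) \<in> phase_poly d \<and> (\<lambda>_ _. m) \<in> phase_poly d \<and> zero_mean_periodic u \<and>
     (\<forall>\<delta> \<theta> \<tau>. stiffness d \<tau> * D_ang (\<lambda>_. u) \<delta> \<theta> \<tau> = m \<tau> - g \<theta> \<tau>)"
proof -
  have anti: "\<exists>G. (\<lambda>_. G) \<in> phase_poly d \<and> (\<forall>\<theta> \<tau>. ((\<lambda>x. G x \<tau>) has_real_derivative f \<theta> \<tau>) (at \<theta>))"
    if "(\<lambda>_. f) \<in> phase_poly d" for f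
  proof -
    obtain G where G: "G \<in> phase_poly d" "D_ang G = (\<lambda>_. f)"
      using phase_poly_antideriv[OF \<open>(\<lambda>_. f) \<in> phase_poly d\<close>] by blast
    show ?thesis
    proof (intro exI conjI allI)
      show "(\<lambda>_. G 0) \<in> phase_poly d" by (rule phase_poly_at_eps[OF G(1)])
      show "((\<lambda>x. G 0 x \<tau>) has_real_derivative f \<theta> \<tau>) (at \<theta>)" for \<theta> \<tau>
        using D_ang[OF G(1), of 0] G(2) by simp
    qed
  qed
  obtain G where G: "(\<lambda>_. G) \<in> phase_poly d"
    "\<And>\<theta> \<tau>. ((\<lambda>x. G x \<tau>) has_real_derivative g \<theta> \<tau>) (at \<theta>)" using anti[OF g] by blast
  define m where "m = (\<lambda>\<tau>. (G pi \<tau> - G (- pi) \<tau>) * (1 / (2 * pi)))"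
  have m: "(\<lambda>_ _. m) \<in> phase_poly d" unfolding m_def
    by (intro phase_poly_intros phase_poly_at_ang[OF G(1)])
  define U where "U = (\<lambda>\<theta> \<tau>. (m \<tau> * \<theta> - G \<theta> \<tau>) * (1 / stiffness d \<tau>))"
  have U: "(\<lambda>_. U) \<in> phase_poly d" unfolding U_def
    by (intro phase_poly_intros m G inverse_stiffness_in)
  have U': "((\<lambda>x. U x \<tau>) has_real_derivative (m \<tau> - g \<theta> \<tau>) * (1 / stiffness d \<tau>)) (at \<theta>)" for \<theta> \<tau>
    unfolding U_def by (intro DERIV_cmult_right DERIV_diff DERIV_cmult_Id G)
  have Uper: "U pi \<tau> = U (- pi) \<tau>" for \<tau>
    by (simp add: U_def m_def field_simps)
  obtain K where K: "(\<lambda>_. K) \<in> phase_poly d"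
    "\<And>\<theta> \<tau>. ((\<lambda>x. K x \<tau>) has_real_derivative U \<theta> \<tau>) (at \<theta>)" using anti[OF U] by blast
  define c where "c = (\<lambda>\<tau>. (K pi \<tau> - K (- pi) \<tau>) * (1 / (2 * pi)))"
  have c: "(\<lambda>_ _. c) \<in> phase_poly d" unfolding c_def
    by (intro phase_poly_intros phase_poly_at_ang[OF K(1)])
  define u where "u = (\<lambda>\<theta> \<tau>. U \<theta> \<tau> - c \<tau>)"
  have u: "(\<lambda>_. u) \<in> phase_poly d" unfolding u_def by (intro phase_poly_intros U c)
  have "((\<lambda>x. u x \<tau>) has_real_derivative (m \<tau> - g \<theta> \<tau>) * (1 / stiffness d \<tau>)) (at \<theta>)" for \<theta> \<tau>
    unfolding u_def by (auto intro!: derivative_eq_intros U')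
  then have *: "D_ang (\<lambda>_. u) = (\<lambda>\<delta> \<theta> \<tau>. (m \<tau> - g \<theta> \<tau>) * (1 / stiffness d \<tau>))"
    by (intro D_ang_eqI)
  have "stiffness d \<tau> * D_ang (\<lambda>_. u) \<delta> \<theta> \<tau> = m \<tau> - g \<theta> \<tau>"
    for \<delta> \<theta> \<tau>
  proof -
    have "stiffness d \<tau> \<noteq> 0" using stiffness_pos[of \<tau>] by linarith
    then show ?thesis by (simp add: *)
  qed
  moreover have "zero_mean_periodic u"
    unfolding zero_mean_periodic_def
  proof (intro allI conjI exI)
    fix \<tau>
    show "u pi \<tau> = u (- pi) \<tau>" by (simp add: u_def Uper)
    show "K pi \<tau> - c \<tau> * pi = K (- pi) \<tau> - c \<tau> * (- pi)" by (simp add: c_def field_simps)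
    show "((\<lambda>\<theta>. K \<theta> \<tau> - c \<tau> * \<theta>) has_real_derivative u \<theta> \<tau>) (at \<theta>)" for \<theta>
      unfolding u_def by (auto intro!: derivative_eq_intros K)
  qed
  ultimately show ?thesis using u m by blast
qed

lemma D_ang_zero: "D_ang (\<lambda>_ _ _. 0) = (\<lambda>_ _ _. 0)" by (rule D_ang_eqI) simp
lemma D_slow_zero: "D_slow (\<lambda>_ _ _. 0) = (\<lambda>_ _ _. 0)" by (rule D_slow_eqI) simp

lemma generating_Suc:
  "1 \<le> n \<Longrightarrow> generating s (Suc n) = (\<lambda>\<delta> \<theta> \<tau>. generating s n \<delta> \<theta> \<tau> + \<delta> ^ n * s n \<theta> \<tau>)"
  by (simp add: generating_def fun_eq_iff)

lemma energy_terms_Suc: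
  "1 \<le> n \<Longrightarrow> energy_terms \<eta> (Suc n) = (\<lambda>\<delta> \<theta> \<tau>. energy_terms \<eta> n \<delta> \<theta> \<tau> + \<delta> ^ n * \<eta> n \<tau>)"
  by (simp add: energy_terms_def fun_eq_iff)

lemma generating_cong: "(\<And>i. 1 \<le> i \<Longrightarrow> i < n \<Longrightarrow> s i = s' i) \<Longrightarrow> generating s n = generating s' n"
  by (auto simp: generating_def fun_eq_iff intro!: sum.cong)

lemma energy_terms_cong: "(\<And>i. 1 \<le> i \<Longrightarrow> i < n \<Longrightarrow> s i = s' i) \<Longrightarrow> energy_terms s n = energy_terms s' n"
  by (auto simp: energy_terms_def fun_eq_iff intro!: sum.cong)

lemma generating_zero_eps: "generating s n 0 \<theta> \<tau> = 0"
  by (auto simp: generating_def intro!: sum.neutral)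

text \<open>
  The lowest coefficient of the remainder is the right-hand side of the homological equation for the
  next term. All other new contributions carry an additional factor \<open>\<delta>\<close>, because the phase derivative
  of the sum found so far vanishes at \<open>\<delta> = 0\<close>.
\<close>
lemma formal_solution_step:
  assumes n: "1 \<le> n" and s: "\<And>i. i \<in> {1..<n} \<Longrightarrow> (\<lambda>_. s i) \<in> phase_poly d"
    and R: "R \<in> phase_poly d" "solves_HJ d (generating s n) (energy_terms \<eta> n) n R"
  shows "\<exists>u m. (\<lambda>_. u) \<in> phase_poly d \<and> (\<lambda>_ _. m) \<in> phase_poly d \<and> zero_mean_periodic u \<and>
    (\<exists>R'\<in>phase_poly d. solves_HJ d (generating (s(n := u)) (Suc n)) (energy_terms (\<eta>(n := m)) (Suc n)) (Suc n) R')"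
proof -
  obtain u m where u: "(\<lambda>_. u) \<in> phase_poly d" and m: "(\<lambda>_ _. m) \<in> phase_poly d"
    and zm: "zero_mean_periodic u"
    and hom: "\<And>\<delta> \<theta> \<tau>. stiffness d \<tau> * D_ang (\<lambda>_. u) \<delta> \<theta> \<tau> = m \<tau> - R 0 \<theta> \<tau>"
    using homological_equation[OF phase_poly_at_eps[OF R(1), of 0]] by blast
  define \<sigma> where "\<sigma> = generating s n"
  have \<sigma>: "\<sigma> \<in> phase_poly d" unfolding \<sigma>_def by (rule generating_in[OF s])
  obtain P where P: "P \<in> phase_poly d" "\<And>\<delta> \<theta> \<tau>. D_ang \<sigma> \<delta> \<theta> \<tau> = \<delta> * P \<delta> \<theta> \<tau>"
  proof -
    have "D_ang \<sigma> 0 \<theta> \<tau> = 0" for \<theta> \<tau>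
      unfolding \<sigma>_def using generating_D_ang[of n s, OF s] by (simp add: sum.neutral)
    then show ?thesis using phase_poly_split[OF D_ang_in[OF \<sigma>]] that by auto
  qed
  obtain Q where Q: "Q \<in> phase_poly d" "\<And>\<delta> \<theta> \<tau>. R \<delta> \<theta> \<tau> = R 0 \<theta> \<tau> + \<delta> * Q \<delta> \<theta> \<tau>"
    using phase_poly_split[OF R(1)] by blast
  have pw: "(\<lambda>\<delta> \<theta> \<tau>. \<delta> ^ n) \<in> phase_poly d" "(\<lambda>\<delta> \<theta> \<tau>. \<delta> ^ n * u \<theta> \<tau>) \<in> phase_poly d"
    by (intro phase_poly_intros u)+
  have gen: "generating (s(n := u)) (Suc n) = (\<lambda>\<delta> \<theta> \<tau>. \<sigma> \<delta> \<theta> \<tau> + \<delta> ^ n * u \<theta> \<tau>)"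
    using n generating_cong[of n "s(n := u)" s] by (simp add: generating_Suc \<sigma>_def)
  have en: "energy_terms (\<eta>(n := m)) (Suc n) = (\<lambda>\<delta> \<theta> \<tau>. energy_terms \<eta> n \<delta> \<theta> \<tau> + \<delta> ^ n * m \<tau>)"
    using n energy_terms_cong[of n "\<eta>(n := m)" \<eta>] by (simp add: energy_terms_Suc)
  have "D_ang (\<lambda>\<delta> \<theta> \<tau>. \<delta> ^ n * u \<theta> \<tau>) = (\<lambda>\<delta> \<theta> \<tau>. \<delta> ^ n * D_ang (\<lambda>_. u) \<delta> \<theta> \<tau>)"
    by (intro D_ang_eqI DERIV_cmult D_ang[OF u])
  then have ang: "D_ang (generating (s(n := u)) (Suc n)) =
      (\<lambda>\<delta> \<theta> \<tau>. D_ang \<sigma> \<delta> \<theta> \<tau> + \<delta> ^ n * D_ang (\<lambda>_. u) \<delta> \<theta> \<tau>)"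
    unfolding gen D_ang_add[OF \<sigma> pw(2)] by simp
  have "D_slow (\<lambda>\<delta> \<theta> \<tau>. \<delta> ^ n * u \<theta> \<tau>) = (\<lambda>\<delta> \<theta> \<tau>. \<delta> ^ n * D_slow (\<lambda>_. u) \<delta> \<theta> \<tau>)"
    by (intro D_slow_eqI DERIV_cmult D_slow[OF u])
  then have slow: "D_slow (generating (s(n := u)) (Suc n)) =
      (\<lambda>\<delta> \<theta> \<tau>. D_slow \<sigma> \<delta> \<theta> \<tau> + \<delta> ^ n * D_slow (\<lambda>_. u) \<delta> \<theta> \<tau>)"
    unfolding gen D_slow_add[OF \<sigma> pw(2)] by simp
  define R' where "R' = (\<lambda>\<delta> \<theta> \<tau>. Q \<delta> \<theta> \<tau>
      + stiffness d \<tau> * (P \<delta> \<theta> \<tau> * D_ang (\<lambda>_. u) \<delta> \<theta> \<tau>)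
      + stiffness d \<tau> * (1 / 2 * (\<delta> ^ (n - 1) * (D_ang (\<lambda>_. u) \<delta> \<theta> \<tau>)^2))
      - strain d \<tau> * (\<theta> * D_ang (\<lambda>_. u) \<delta> \<theta> \<tau>) + D_slow (\<lambda>_. u) \<delta> \<theta> \<tau>)"
  have R': "R' \<in> phase_poly d" unfolding R'_def
    by (intro phase_poly_intros Q P stiffness_in strain_in D_ang_in[OF u] D_slow_in[OF u])
  have "solves_HJ d (generating (s(n := u)) (Suc n)) (energy_terms (\<eta>(n := m)) (Suc n)) (Suc n) R'"
    unfolding solves_HJ_def ang slow en
  proof (intro allI)
    fix \<delta> \<theta> \<tau>
    define A b p q v vt e where "A = stiffness d \<tau>" and "b = strain d \<tau>" and "p = P \<delta> \<theta> \<tau>"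
      and "q = D_slow \<sigma> \<delta> \<theta> \<tau>" and "v = D_ang (\<lambda>_. u) \<delta> \<theta> \<tau>" and "vt = D_slow (\<lambda>_. u) \<delta> \<theta> \<tau>"
      and "e = energy_terms \<eta> n \<delta> \<theta> \<tau>"
    have old: "A / 2 * (1 + \<delta> * p)^2 - \<delta> * b * \<theta> * (1 + \<delta> * p) + \<delta> * q
        = A / 2 + e + \<delta> ^ n * (R 0 \<theta> \<tau> + \<delta> * Q \<delta> \<theta> \<tau>)"
      using R(2) unfolding solves_HJ_def \<sigma>_def[symmetric] P(2) Q(2)[of \<delta> \<theta> \<tau>, symmetric]
      by (simp add: A_def b_def p_def q_def e_def)
    have R0: "R 0 \<theta> \<tau> = m \<tau> - A * v"
      using hom[of \<tau> \<delta> \<theta>] by (simp add: A_def v_def)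
    have nn: "\<delta> ^ n = \<delta> * \<delta> ^ (n - 1)" using n by (cases n) auto
    define D where "D = \<delta> ^ (n - 1)"
    have "A / 2 * (1 + (\<delta> * p + \<delta> * D * v))^2 - \<delta> * b * \<theta> * (1 + (\<delta> * p + \<delta> * D * v))
        + \<delta> * (q + \<delta> * D * vt)
      = (A / 2 * (1 + \<delta> * p)^2 - \<delta> * b * \<theta> * (1 + \<delta> * p) + \<delta> * q)
        + \<delta> * D * (A * (1 + \<delta> * p) * v + A / 2 * \<delta> * D * v^2 - \<delta> * b * \<theta> * v + \<delta> * vt)"
      by (simp add: power2_eq_square algebra_simps)
    also have "\<dots> = A / 2 + (e + \<delta> * D * m \<tau>) + \<delta> * (\<delta> * D) *
        (Q \<delta> \<theta> \<tau> + A * (p * v) + A * (1 / 2 * (D * v^2)) - b * (\<theta> * v) + vt)"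
      unfolding old R0 nn D_def[symmetric] by (simp add: power2_eq_square algebra_simps)
    finally show "stiffness d \<tau> / 2 * (1 + (D_ang \<sigma> \<delta> \<theta> \<tau> + \<delta> ^ n * D_ang (\<lambda>_. u) \<delta> \<theta> \<tau>))\<^sup>2 -
       \<delta> * strain d \<tau> * \<theta> * (1 + (D_ang \<sigma> \<delta> \<theta> \<tau> + \<delta> ^ n * D_ang (\<lambda>_. u) \<delta> \<theta> \<tau>)) +
       \<delta> * (D_slow \<sigma> \<delta> \<theta> \<tau> + \<delta> ^ n * D_slow (\<lambda>_. u) \<delta> \<theta> \<tau>) =
       stiffness d \<tau> / 2 + (energy_terms \<eta> n \<delta> \<theta> \<tau> + \<delta> ^ n * m \<tau>) + \<delta> ^ Suc n * R' \<delta> \<theta> \<tau>"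
      unfolding R'_def P(2) power_Suc nn D_def[symmetric] A_def b_def p_def q_def v_def vt_def e_def .
  qed
  then show ?thesis using u m zm R' by blast
qed

text \<open>
  One pair of sequences serves all orders up to \<open>N\<close>: this is what makes the normal forms of two
  different orders comparable.
\<close>
theorem formal_solution:
  "\<exists>s \<eta>. \<forall>n\<in>{1..N}. (\<forall>i\<in>{1..<n}. (\<lambda>_. s i) \<in> phase_poly d \<and> (\<lambda>_ _. \<eta> i) \<in> phase_poly d \<and>
       zero_mean_periodic (s i)) \<and>
     (\<exists>R\<in>phase_poly d. solves_HJ d (generating s n) (energy_terms \<eta> n) n R)"
proof (induction N)
  case 0
  show ?case by simp
next
  case (Suc N)
  then obtain s \<eta> where IH: "\<And>n. n \<in> {1..N} \<Longrightarrow> (\<forall>i\<in>{1..<n}. (\<lambda>_. s i) \<in> phase_poly d \<and>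
      (\<lambda>_ _. \<eta> i) \<in> phase_poly d \<and> zero_mean_periodic (s i)) \<and>
     (\<exists>R\<in>phase_poly d. solves_HJ d (generating s n) (energy_terms \<eta> n) n R)" by blast
  show ?case
  proof (cases "N = 0")
    case True
    have 1: "generating s (Suc 0) = (\<lambda>_ _ _. 0)" "energy_terms \<eta> (Suc 0) = (\<lambda>_ _ _. 0)"
      by (auto simp: generating_def energy_terms_def fun_eq_iff)
    have "solves_HJ d (\<lambda>_ _ _. 0) (\<lambda>_ _ _. 0) (Suc 0) (\<lambda>\<delta> \<theta> \<tau>. - (strain d \<tau> * \<theta>))"
      by (simp add: solves_HJ_def D_ang_zero D_slow_zero)
    moreover have "(\<lambda>\<delta> \<theta> \<tau>. - (strain d \<tau> * \<theta>)) \<in> phase_poly d"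
      by (intro phase_poly_intros strain_in)
    ultimately have "\<exists>R\<in>phase_poly d. solves_HJ d (generating s (Suc 0)) (energy_terms \<eta> (Suc 0)) (Suc 0) R"
      unfolding 1 by blast
    then show ?thesis using True by (intro exI[of _ s] exI[of _ \<eta>]) simp
  next
    case False
    then have N: "N \<in> {1..N}" "1 \<le> N" by auto
    obtain R where R: "R \<in> phase_poly d" "solves_HJ d (generating s N) (energy_terms \<eta> N) N R"
      using IH[OF N(1)] by blast
    obtain u m R' where u: "(\<lambda>_. u) \<in> phase_poly d" "(\<lambda>_ _. m) \<in> phase_poly d" "zero_mean_periodic u"
      and R': "R' \<in> phase_poly d"
        "solves_HJ d (generating (s(N := u)) (Suc N)) (energy_terms (\<eta>(N := m)) (Suc N)) (Suc N) R'"
      using formal_solution_step[OF N(2) _ R] IH[OF N(1)] by blast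
    have "(\<forall>i\<in>{1..<n}. (\<lambda>_. (s(N := u)) i) \<in> phase_poly d \<and> (\<lambda>_ _. (\<eta>(N := m)) i) \<in> phase_poly d \<and>
         zero_mean_periodic ((s(N := u)) i)) \<and>
       (\<exists>R\<in>phase_poly d. solves_HJ d (generating (s(N := u)) n) (energy_terms (\<eta>(N := m)) n) n R)"
      if n: "n \<in> {1..Suc N}" for n
    proof (cases "n = Suc N")
      case True
      have "(\<lambda>_. (s(N := u)) i) \<in> phase_poly d \<and> (\<lambda>_ _. (\<eta>(N := m)) i) \<in> phase_poly d \<and>
         zero_mean_periodic ((s(N := u)) i)" if "i \<in> {1..<n}" for i
        using that True u IH[OF N(1)] by (cases "i = N") auto
      then show ?thesis using R' True by blast
    next
      case False
      then have n': "n \<in> {1..N}" using n by auto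
      have "generating (s(N := u)) n = generating s n" "energy_terms (\<eta>(N := m)) n = energy_terms \<eta> n"
        using n' by (auto intro!: generating_cong energy_terms_cong)
      then show ?thesis using IH[OF n'] n' by auto
    qed
    then show ?thesis by (intro exI ballI)
  qed
qed

end

section \<open>Uniqueness of the normal form\<close>

text \<open>
  The representative of the phase in \<open>[-\<pi>, \<pi>)\<close>. The value \<open>-\<pi>\<close> at a hit of the moving wall is the
  phase after the impact.
\<close>
definition wrap :: "real \<Rightarrow> real" where
  "wrap \<phi> = \<phi> - 2 * pi * of_int \<lfloor>(\<phi> + pi) / (2 * pi)\<rfloor>"

lemma wrap_ge: "- pi \<le> wrap \<phi>" and wrap_less: "wrap \<phi> < pi"
proof -
  define n where "n = \<lfloor>(\<phi> + pi) / (2 * pi)\<rfloor>"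
  have "of_int n \<le> (\<phi> + pi) / (2 * pi)" "(\<phi> + pi) / (2 * pi) < of_int n + 1"
    unfolding n_def by linarith+
  then have "of_int n * (2 * pi) \<le> \<phi> + pi" "\<phi> + pi < (of_int n + 1) * (2 * pi)"
    by (simp_all add: pos_le_divide_eq pos_divide_less_eq)
  then show "- pi \<le> wrap \<phi>" "wrap \<phi> < pi"
    unfolding wrap_def n_def[symmetric] by (auto simp: algebra_simps)
qed

lemma wrap_unique:
  assumes "- pi \<le> \<theta>" "\<theta> < pi" "\<phi> = \<theta> + 2 * pi * of_int n"
  shows "wrap \<phi> = \<theta>"
proof -
  have "of_int n \<le> (\<phi> + pi) / (2 * pi)" "(\<phi> + pi) / (2 * pi) < of_int n + 1"
    using assms by (simp_all add: pos_le_divide_eq pos_divide_less_eq algebra_simps)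
  then have "\<lfloor>(\<phi> + pi) / (2 * pi)\<rfloor> = n" by linarith
  then show ?thesis using assms(3) by (simp add: wrap_def)
qed

lemma wrap_eq: obtains n :: int where "\<phi> = wrap \<phi> + 2 * pi * of_int n"
  using that[of "\<lfloor>(\<phi> + pi) / (2 * pi)\<rfloor>"] by (simp add: wrap_def)

lemma wrap_saw: "\<phi> \<in> {0<..<pi} \<union> {pi<..<2 * pi} \<Longrightarrow> wrap \<phi> = saw \<phi>"
  using wrap_unique[of \<phi> \<phi> 0] wrap_unique[of "\<phi> - 2 * pi" \<phi> 1] by (auto simp: saw_def)

lemma wrap_shift: "wrap (\<phi> + 2 * pi) = wrap \<phi>"
proof -
  obtain n where n: "\<phi> = wrap \<phi> + 2 * pi * of_int n" by (rule wrap_eq)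
  have "2 * pi * of_int (n + 1) = 2 * pi * of_int n + 2 * pi" by (simp add: algebra_simps)
  then have "\<phi> + 2 * pi = wrap \<phi> + 2 * pi * of_int (n + 1)" using n by linarith
  then show ?thesis by (rule wrap_unique[OF wrap_ge wrap_less])
qed

lemma wrap_locally:
  assumes "- pi \<le> wrap \<phi> + u" "wrap \<phi> + u < pi"
  shows "wrap (\<phi> + u) = wrap \<phi> + u"
proof -
  obtain n where n: "\<phi> = wrap \<phi> + 2 * pi * of_int n" by (rule wrap_eq)
  have "\<phi> + u = wrap \<phi> + u + 2 * pi * of_int n" using n by linarith
  then show ?thesis by (rule wrap_unique[OF assms])
qed

lemma periodic_of_int:
  fixes f :: "real \<Rightarrow> 'a"
  assumes "\<And>x. f (x + 2 * pi) = f x"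
  shows "f (x + 2 * pi * of_int n) = f x"
proof (induction n rule: int_induct[of _ 0])
  case (step1 i)
  then show ?case using assms[of "x + 2 * pi * of_int i"] by (simp add: algebra_simps)
next
  case (step2 i)
  then show ?case using assms[of "x + 2 * pi * of_int (i - 1)"] by (simp add: algebra_simps)
qed simp

text \<open>
  At the jump of \<open>wrap\<close> only the derivative from the right exists; this is the reason for the one-sided
  derivative in \<open>dS_phi\<close>.
\<close>
lemma wrap_has_derivative_right:
  "(wrap has_real_derivative 1) (at \<phi> within {\<phi><..})"
proof -
  have "(wrap has_real_derivative 1) (at \<phi> within {\<phi>..})"
  proof (rule has_field_derivative_transform_within)
    show "((\<lambda>\<psi>. wrap \<phi> + (\<psi> - \<phi>)) has_real_derivative 1) (at \<phi> within {\<phi>..})"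
      by (auto intro!: derivative_eq_intros)
    show "0 < pi - wrap \<phi>" using wrap_less[of \<phi>] by simp
    show "\<phi> \<in> {\<phi>..}" by simp
    show "wrap \<phi> + (\<psi> - \<phi>) = wrap \<psi>" if "\<psi> \<in> {\<phi>..}" "dist \<psi> \<phi> < pi - wrap \<phi>" for \<psi>
    proof -
      have "- pi \<le> wrap \<phi> + (\<psi> - \<phi>)" "wrap \<phi> + (\<psi> - \<phi>) < pi"
        using wrap_ge[of \<phi>] that by (auto simp: dist_real_def)
      from wrap_locally[OF this] show ?thesis by simp
    qed
  qed
  then show ?thesis by (rule DERIV_subset) auto
qed

lemma wrap_has_derivative:
  assumes "wrap \<phi> \<noteq> - pi"
  shows "(wrap has_real_derivative 1) (at \<phi>)"
proof (rule has_field_derivative_transform_within)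
  show "((\<lambda>\<psi>. wrap \<phi> + (\<psi> - \<phi>)) has_real_derivative 1) (at \<phi>)"
    by (auto intro!: derivative_eq_intros)
  show "0 < min (pi - wrap \<phi>) (wrap \<phi> + pi)"
    using wrap_less[of \<phi>] wrap_ge[of \<phi>] assms by simp
  show "wrap \<phi> + (\<psi> - \<phi>) = wrap \<psi>" if "dist \<psi> \<phi> < min (pi - wrap \<phi>) (wrap \<phi> + pi)" for \<psi>
  proof -
    have "- pi \<le> wrap \<phi> + (\<psi> - \<phi>)" "wrap \<phi> + (\<psi> - \<phi>) < pi"
      using that by (auto simp: dist_real_def)
    from wrap_locally[OF this] show ?thesis by simp
  qed
qed auto

lemma leading_coefficient_limit:
  fixes a :: "nat \<Rightarrow> real"
  assumes "\<And>i. 1 \<le> i \<Longrightarrow> i < m \<Longrightarrow> a i = 0" "1 \<le> m" "m < r"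
  shows "((\<lambda>\<epsilon>. (\<Sum>i\<in>{1..<r}. \<epsilon> ^ i * a i) / \<epsilon> ^ m) \<longlongrightarrow> a m) (at_right 0)"
proof -
  have eq: "(\<Sum>i\<in>{m..<r}. \<epsilon> ^ (i - m) * a i) = (\<Sum>i\<in>{1..<r}. \<epsilon> ^ i * a i) / \<epsilon> ^ m" if "\<epsilon> > 0" for \<epsilon> :: real
  proof -
    have "(\<Sum>i\<in>{1..<r}. \<epsilon> ^ i * a i) = (\<Sum>i\<in>{m..<r}. \<epsilon> ^ i * a i)"
      using assms by (intro sum.mono_neutral_right) auto
    also have "\<dots> = (\<Sum>i\<in>{m..<r}. \<epsilon> ^ m * (\<epsilon> ^ (i - m) * a i))"
      by (intro sum.cong) (auto simp: power_add[symmetric] mult.assoc[symmetric])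
    finally show ?thesis using that by (simp add: sum_distrib_left[symmetric])
  qed
  have "((\<lambda>\<epsilon>::real. \<Sum>i\<in>{m..<r}. \<epsilon> ^ (i - m) * a i) \<longlongrightarrow> (\<Sum>i\<in>{m..<r}. 0 ^ (i - m) * a i)) (at_right 0)"
    by (intro tendsto_intros)
  also have "(\<Sum>i\<in>{m..<r}. 0 ^ (i - m) * a i) = (\<Sum>i\<in>{m..<r}. if i = m then a m else 0)"
    by (intro sum.cong) (auto simp: power_0_left)
  also have "\<dots> = a m" using assms by simp
  finally show ?thesis
    by (rule Lim_transform_eventually) (rule eventually_mono[OF eventually_at_right_less eq])
qed

text \<open>
  A difference of two solutions of the homological equation is of this kind, with a slope that comes
  from the difference of the two means. Periodicity kills the slope and the zero mean the constant.
\<close>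
lemma constant_slope_periodic_zero_mean:
  fixes f :: "real \<Rightarrow> real"
  assumes cont: "continuous_on {0..2 * pi} f"
    and deriv: "\<And>x. x \<in> {0<..<pi} \<union> {pi<..<2 * pi} \<Longrightarrow> (f has_real_derivative \<kappa>) (at x)"
    and per: "f (2 * pi) = f 0"
    and mean: "(f has_integral 0) {0..2 * pi}"
  shows "\<kappa> = 0" and "x \<in> {0..2 * pi} \<Longrightarrow> f x = 0"
proof -
  have step: "f b - f a = \<kappa> * (b - a)"
    if "a < b" "{a<..<b} \<subseteq> {0<..<pi} \<union> {pi<..<2 * pi}" "0 \<le> a" "b \<le> 2 * pi" for a b
  proof -
    have "continuous_on {a..b} f" using cont by (rule continuous_on_subset) (use that in auto)
    moreover have "f differentiable (at x)" if "a < x" "x < b" for x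
    proof -
      have "x \<in> {0<..<pi} \<union> {pi<..<2 * pi}" using that by (intro subsetD[OF \<open>{a<..<b} \<subseteq> _\<close>]) simp
      then show ?thesis using deriv real_differentiable_def by blast
    qed
    ultimately obtain l z where z: "a < z" "z < b" "(f has_real_derivative l) (at z)" "f b - f a = (b - a) * l"
      using MVT[OF \<open>a < b\<close>, of f] by blast
    have "l = \<kappa>" using DERIV_unique[OF z(3) deriv] z that by auto
    then show ?thesis using z by simp
  qed
  have h1: "f pi - f 0 = \<kappa> * pi" using step[of 0 pi] by auto
  have h2: "f (2 * pi) - f pi = \<kappa> * pi" using step[of pi "2 * pi"] by auto
  have "\<kappa> * pi = 0" using h1 h2 per by linarith
  then show \<kappa>: "\<kappa> = 0" by simp
  have const: "f x = f 0" if "x \<in> {0..2 * pi}" for x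
  proof (cases "x \<le> pi")
    case True
    then have "{0<..<x} \<subseteq> {0<..<pi} \<union> {pi<..<2 * pi}" by auto
    then show ?thesis using step[of 0 x] that \<kappa> by (cases "x = 0") auto
  next
    case False
    then have "{pi<..<x} \<subseteq> {0<..<pi} \<union> {pi<..<2 * pi}" using that by auto
    then show ?thesis using step[of pi x] that \<kappa> h1 False by auto
  qed
  have "((\<lambda>_. f 0) has_integral 2 * pi * f 0) {0..2 * pi}"
    using has_integral_const_real[of "f 0" 0 "2 * pi"] by simp
  then have "(f has_integral 2 * pi * f 0) {0..2 * pi}"
    by (rule has_integral_eq[rotated]) (rule const[symmetric])
  then have "2 * pi * f 0 = 0" using has_integral_unique mean by blast
  then show "f x = 0" if "x \<in> {0..2 * pi}" unfolding const[OF that] by simp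
qed

lemma zero_mean_periodic_wrap:
  assumes "zero_mean_periodic g" and diff: "\<And>\<theta>. (\<lambda>x. g x \<tau>) differentiable (at \<theta>)"
  shows "continuous_on {0..2 * pi} (\<lambda>\<phi>. g (wrap \<phi>) \<tau>)"
    and "((\<lambda>\<phi>. g (wrap \<phi>) \<tau>) has_integral 0) {0..2 * pi}"
proof -
  obtain G where per: "g pi \<tau> = g (- pi) \<tau>" and G: "G pi = G (- pi)"
    "\<And>\<theta>. (G has_real_derivative g \<theta> \<tau>) (at \<theta>)"
    using assms unfolding zero_mean_periodic_def by blast
  have w1: "g (wrap \<phi>) \<tau> = g \<phi> \<tau>" if "\<phi> \<in> {0..pi}" for \<phi>
  proof (cases "\<phi> = pi")
    case True
    have "wrap pi = - pi" using wrap_unique[of "- pi" pi 1] by simp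
    then show ?thesis using True per by simp
  next
    case False
    then have "wrap \<phi> = \<phi>" using that wrap_unique[of \<phi> \<phi> 0] pi_gt_zero by simp
    then show ?thesis by simp
  qed
  have w2: "g (wrap \<phi>) \<tau> = g (\<phi> - 2 * pi) \<tau>" if "\<phi> \<in> {pi..2 * pi}" for \<phi>
  proof -
    have "\<phi> < 3 * pi" using that pi_gt_zero unfolding atLeastAtMost_iff by linarith
    then have "wrap \<phi> = \<phi> - 2 * pi" using that wrap_unique[of "\<phi> - 2 * pi" \<phi> 1] by simp
    then show ?thesis by simp
  qed
  have cg: "continuous_on X (\<lambda>x. g x \<tau>)" for X
    by (intro continuous_at_imp_continuous_on ballI differentiable_imp_continuous_within diff)
  have c1: "continuous_on {0..pi} (\<lambda>\<phi>. g (wrap \<phi>) \<tau>)"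
    by (rule continuous_on_eq[OF cg]) (rule w1[symmetric])
  have c2: "continuous_on {pi..2 * pi} (\<lambda>\<phi>. g (wrap \<phi>) \<tau>)"
  proof -
    have "continuous_on {pi..2 * pi} (\<lambda>\<phi>. g (\<phi> - 2 * pi) \<tau>)"
      by (rule continuous_on_compose2[OF cg[of UNIV]]) (auto intro!: continuous_intros)
    then show ?thesis by (rule continuous_on_eq) (rule w2[symmetric])
  qed
  have U: "{0..2 * pi} = {0..pi} \<union> {pi..2 * pi}" by auto
  show "continuous_on {0..2 * pi} (\<lambda>\<phi>. g (wrap \<phi>) \<tau>)"
    unfolding U by (rule continuous_on_closed_Un) (auto intro: c1 c2)
  have "((\<lambda>\<phi>. g \<phi> \<tau>) has_integral (G pi - G 0)) {0..pi}"
    by (intro fundamental_theorem_of_calculus)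
      (auto intro: has_field_derivative_at_within G simp flip: has_real_derivative_iff_has_vector_derivative)
  then have i1: "((\<lambda>\<phi>. g (wrap \<phi>) \<tau>) has_integral (G pi - G 0)) {0..pi}"
    by (rule has_integral_eq[rotated]) (simp add: w1)
  have "((\<lambda>x. G (x - 2 * pi)) has_real_derivative g (x - 2 * pi) \<tau>) (at x)" for x
  proof -
    have "((\<lambda>x. x - 2 * pi) has_real_derivative 1) (at x)" by (auto intro!: derivative_eq_intros)
    from DERIV_chain2[OF G(2) this] show ?thesis by simp
  qed
  then have "((\<lambda>x. G (x - 2 * pi)) has_vector_derivative g (x - 2 * pi) \<tau>) (at x within X)" for x X
    unfolding has_real_derivative_iff_has_vector_derivative[symmetric]
    by (rule has_field_derivative_at_within)
  from fundamental_theorem_of_calculus[OF _ this, of pi "2 * pi"]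
  have "((\<lambda>\<phi>. g (\<phi> - 2 * pi) \<tau>) has_integral (G (2 * pi - 2 * pi) - G (pi - 2 * pi))) {pi..2 * pi}"
    by simp
  then have i2: "((\<lambda>\<phi>. g (wrap \<phi>) \<tau>) has_integral (G 0 - G (- pi))) {pi..2 * pi}"
    by (intro has_integral_eq[of "{pi..2*pi}" "\<lambda>\<phi>. g (\<phi> - 2 * pi) \<tau>", OF w2[symmetric]]) simp_all
  show "((\<lambda>\<phi>. g (wrap \<phi>) \<tau>) has_integral 0) {0..2 * pi}"
    using has_integral_combine[OF _ _ i1 i2] G(1) by simp
qed

context moving_wall
begin

lemma D_indep:
  "D_ang (\<lambda>_. g) \<delta> \<theta> \<tau> = D_ang (\<lambda>_. g) 0 \<theta> \<tau>"
  "D_slow (\<lambda>_. g) \<delta> \<theta> \<tau> = D_slow (\<lambda>_. g) 0 \<theta> \<tau>"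
  by (simp_all add: D_ang_def D_slow_def)

lemma D_ang_indep: "(\<lambda>_. g) \<in> phase_poly d \<Longrightarrow> ((\<lambda>x. g x \<tau>) has_real_derivative D_ang (\<lambda>_. g) 0 \<theta> \<tau>) (at \<theta>)"
  using D_ang[of "\<lambda>_. g" 0 \<tau> \<theta>] by simp

lemma D_slow_indep: "(\<lambda>_. g) \<in> phase_poly d \<Longrightarrow> (g \<theta> has_real_derivative D_slow (\<lambda>_. g) 0 \<theta> \<tau>) (at \<tau>)"
  using D_slow[of "\<lambda>_. g" 0 \<theta> \<tau>] by simp

lemma wrapped_derivative:
  assumes "(\<lambda>_. g) \<in> phase_poly d" "wrap \<phi> \<noteq> - pi"
  shows "((\<lambda>\<psi>. g (wrap \<psi>) \<tau>) has_real_derivative D_ang (\<lambda>_. g) 0 (wrap \<phi>) \<tau>) (at \<phi>)"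
  using DERIV_chain2[OF D_ang_indep[OF assms(1)] wrap_has_derivative[OF assms(2)]] by simp

lemma phase_poly_tendsto_eps:
  assumes "f \<in> phase_poly d"
  shows "((\<lambda>\<epsilon>. f (\<epsilon> / J) \<theta> \<tau>) \<longlongrightarrow> f 0 \<theta> \<tau>) (at_right 0)"
proof -
  have "isCont (\<lambda>x. f x \<theta> \<tau>) 0" using D_eps[OF assms, of \<theta> \<tau> 0] DERIV_isCont by blast
  moreover have "((\<lambda>\<epsilon>. \<epsilon> / J) \<longlongrightarrow> 0) (at_right 0)"
    unfolding divide_inverse by (intro tendsto_mult_left_zero tendsto_ident_at)
  ultimately show ?thesis by (rule isCont_tendsto_compose[where g = "\<lambda>x. f x \<theta> \<tau>"])
qed

text \<open>
  By induction on the order \<open>m\<close>. The Hamilton-Jacobi equations of the given and of the constructed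
  family are subtracted and divided by \<open>\<epsilon>\<^sup>m\<close>; as the terms of lower order agree, in the limit \<open>\<epsilon> \<rightarrow> 0\<close>
  only \<open>A J \<partial>(S\<^sub>m - S'\<^sub>m)/\<partial>\<phi> = h\<^sub>m - h'\<^sub>m\<close> remains. The right-hand side does not depend on the phase.
\<close>
theorem normal_form_unique:
  assumes nf: "normalizing d r S h"
    and s: "\<And>i. i \<in> {1..<r} \<Longrightarrow> (\<lambda>_. s i) \<in> phase_poly d \<and> (\<lambda>_ _. \<eta> i) \<in> phase_poly d \<and> zero_mean_periodic (s i)"
    and R: "R \<in> phase_poly d" and HJ: "solves_HJ d (generating s r) (energy_terms \<eta> r) r R"
    and m: "1 \<le> m" "m < r" and J: "J > 0"
  shows "S m J \<phi> \<tau> = J * s m (wrap \<phi>) \<tau> / J ^ m" and "h m J \<tau> = J\<^sup>2 * \<eta> m \<tau> / J ^ m"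
proof -
  let ?D = "{0<..<pi} \<union> {pi<..<2 * pi}"
  note nf1 = conjunct1[OF nf[unfolded normalizing_def]] and nf2 = conjunct2[OF nf[unfolded normalizing_def]]
  from nf2 obtain Rg where Rg0: "\<forall>\<epsilon>>0. \<forall>J>0. \<forall>\<tau>. \<forall>\<phi>\<in>?D.
      new_Ham d r S J \<phi> \<tau> \<epsilon> = Ham_Sigma d r h J \<tau> \<epsilon> + \<epsilon> ^ r * Rg J \<phi> \<tau> \<epsilon>"
    and Rgb0: "\<forall>K M. compact K \<and> K \<subseteq> {0<..} \<and> compact M \<longrightarrow>
           (\<exists>C. \<exists>\<epsilon>\<^sub>1>0. \<forall>\<epsilon>\<in>{0<..<\<epsilon>\<^sub>1}. \<forall>J\<in>K. \<forall>\<tau>\<in>M. \<forall>\<phi>\<in>?D. \<bar>Rg J \<phi> \<tau> \<epsilon>\<bar> \<le> C)"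
    by (elim exE conjE)
  have Rg: "new_Ham d r S J \<phi> \<tau> \<epsilon> = Ham_Sigma d r h J \<tau> \<epsilon> + \<epsilon> ^ r * Rg J \<phi> \<tau> \<epsilon>"
    if "\<epsilon> > 0" "J > 0" "\<phi> \<in> ?D" for \<epsilon> J \<tau> \<phi>
    using Rg0[rule_format, OF that] .
  have Rgb: "\<exists>C. \<exists>\<epsilon>\<^sub>1>0. \<forall>\<epsilon>\<in>{0<..<\<epsilon>\<^sub>1}. \<forall>J\<in>K. \<forall>\<tau>\<in>M. \<forall>\<phi>\<in>?D. \<bar>Rg J \<phi> \<tau> \<epsilon>\<bar> \<le> C"
    if "compact K" "K \<subseteq> {0<..}" "compact M" for K M
    using Rgb0 that by blast
  have S: "C_infinity_on ({0<..} \<times> UNIV) (\<lambda>(J, \<tau>). S i J \<phi> \<tau>)"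
    "\<And>J \<tau>. J > 0 \<Longrightarrow> continuous_on UNIV (\<lambda>\<phi>. S i J \<phi> \<tau>)"
    "\<And>J \<tau> \<phi>. J > 0 \<Longrightarrow> S i J (\<phi> + 2 * pi) \<tau> = S i J \<phi> \<tau>"
    "\<And>J \<tau>. J > 0 \<Longrightarrow> integral {0..2 * pi} (\<lambda>\<phi>. S i J \<phi> \<tau>) = 0"
    "\<And>J \<tau> \<phi>. J > 0 \<Longrightarrow> \<phi> \<in> ?D \<Longrightarrow> (\<lambda>\<psi>. S i J \<psi> \<tau>) differentiable (at \<phi>)"
    if "i \<in> {1..<r}" for i \<phi>
    using bspec[OF nf1 that] by blast+
  have S\<tau>: "(S i J \<phi> has_real_derivative deriv (S i J \<phi>) \<tau>) (at \<tau>)"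
    if "i \<in> {1..<r}" "J > 0" for i J \<phi> \<tau>
  proof -
    have "Ck_on (Suc 0) ({0<..} \<times> UNIV) (\<lambda>(J, \<tau>). S i J \<phi> \<tau>)"
      using S(1)[OF that(1)] unfolding C_infinity_on_def by blast
    then have "(\<lambda>(J, \<tau>). S i J \<phi> \<tau>) differentiable (at (J, \<tau>))" using that(2) by simp
    moreover have "(\<lambda>\<sigma>. (J, \<sigma>)) differentiable (at \<tau>)"
      by (rule differentiableI[of _ "\<lambda>x. (0, x)"]) (auto intro!: derivative_eq_intros)
    ultimately have "((\<lambda>(J, \<tau>). S i J \<phi> \<tau>) \<circ> (\<lambda>\<sigma>. (J, \<sigma>))) differentiable (at \<tau>)"
      by (intro differentiable_chain_at) auto
    then show ?thesis by (simp add: o_def DERIV_deriv_iff_real_differentiable)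
  qed
  have "\<forall>J \<tau> \<phi>. 1 \<le> m \<longrightarrow> m < r \<longrightarrow> J > 0 \<longrightarrow>
      S m J \<phi> \<tau> = J * s m (wrap \<phi>) \<tau> / J ^ m \<and> h m J \<tau> = J\<^sup>2 * \<eta> m \<tau> / J ^ m"
  proof (induction m rule: less_induct)
    case (less m)
    show ?case
    proof (intro allI impI)
      fix J \<tau> \<phi> :: real
      assume m: "1 \<le> m" "m < r" and J: "J > 0"
      then have mr: "m \<in> {1..<r}" by auto
      have IH: "S i J \<phi> \<tau> = J * s i (wrap \<phi>) \<tau> / J ^ i" "h i J \<tau> = J\<^sup>2 * \<eta> i \<tau> / J ^ i"
        if "1 \<le> i" "i < m" for i \<phi> \<tau>
        using less that m J by auto
      define A b where "A = stiffness d \<tau>" and "b = strain d \<tau>"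
      define f where "f = (\<lambda>\<phi>. S m J \<phi> \<tau> - J * s m (wrap \<phi>) \<tau> / J ^ m)"
      define c where "c = (\<lambda>i. h i J \<tau> - J\<^sup>2 * \<eta> i \<tau> / J ^ i)"
      have A: "A > 0" unfolding A_def by (rule stiffness_pos)
      (* The limit of the difference of the two equations, at one phase. *)
      have slope: "(f has_real_derivative c m / (A * J)) (at \<phi>)" if \<phi>: "\<phi> \<in> ?D" for \<phi>
      proof -
        define \<theta> where "\<theta> = wrap \<phi>"
        have \<theta>: "\<theta> = saw \<phi>" "wrap \<phi> \<noteq> - pi"
          using wrap_saw[OF \<phi>] \<phi> by (auto simp: \<theta>_def saw_def)
        define F where "F = (\<lambda>i. deriv (\<lambda>\<psi>. S i J \<psi> \<tau>) \<phi>)"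
        define a where "a = (\<lambda>i. F i - J * D_ang (\<lambda>_. s i) 0 \<theta> \<tau> / J ^ i)"
        define B where "B = (\<lambda>i. deriv (S i J \<phi>) \<tau> - J * D_slow (\<lambda>_. s i) 0 \<theta> \<tau> / J ^ i)"
        have SF: "((\<lambda>\<psi>. S i J \<psi> \<tau>) has_real_derivative F i) (at \<phi>)" if "i \<in> {1..<r}" for i
          unfolding F_def using S(5)[OF that J \<phi>] by (simp add: DERIV_deriv_iff_real_differentiable)
        have sF: "((\<lambda>\<psi>. J * s i (wrap \<psi>) \<tau> / J ^ i) has_real_derivative
            J * D_ang (\<lambda>_. s i) 0 \<theta> \<tau> / J ^ i) (at \<phi>)" if "i \<in> {1..<r}" for i
        proof -
          have "(\<lambda>_. s i) \<in> phase_poly d" using s[OF that] by blast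
          then show ?thesis unfolding \<theta>_def
            by (intro DERIV_cdivide DERIV_cmult wrapped_derivative \<theta>(2))
        qed
        have a0: "a i = 0" if "1 \<le> i" "i < m" for i
        proof -
          have eq: "(\<lambda>\<psi>. S i J \<psi> \<tau>) = (\<lambda>\<psi>. J * s i (wrap \<psi>) \<tau> / J ^ i)" using IH(1)[OF that] by blast
          have ir: "i \<in> {1..<r}" using that m by auto
          show ?thesis using DERIV_unique[OF SF[OF ir, unfolded eq] sF[OF ir]]
            by (simp add: a_def)
        qed
        have B0: "B i = 0" if "1 \<le> i" "i < m" for i
        proof -
          have ir: "i \<in> {1..<r}" using that m by auto
          then have si: "(\<lambda>_. s i) \<in> phase_poly d" using s by blast
          have "S i J \<phi> = (\<lambda>\<tau>. J * s i \<theta> \<tau> / J ^ i)" using IH(1)[OF that] by (auto simp: \<theta>_def)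
          moreover have "((\<lambda>\<tau>. J * s i \<theta> \<tau> / J ^ i) has_real_derivative
             J * D_slow (\<lambda>_. s i) 0 \<theta> \<tau> / J ^ i) (at \<tau>)"
            by (intro DERIV_cdivide DERIV_cmult D_slow_indep si)
          ultimately show ?thesis unfolding B_def by (simp add: DERIV_imp_deriv)
        qed
        have c0: "c i = 0" if "1 \<le> i" "i < m" for i using IH(2)[OF that] by (simp add: c_def)
        define X where "X = (\<lambda>\<epsilon>. \<Sum>i\<in>{1..<r}. \<epsilon> ^ i * F i)"
        define X0 where "X0 = (\<lambda>\<epsilon>. \<Sum>i\<in>{1..<r}. \<epsilon> ^ i * (J * D_ang (\<lambda>_. s i) 0 \<theta> \<tau> / J ^ i))"
        have sip: "\<And>i. i \<in> {1..<r} \<Longrightarrow> (\<lambda>_. s i) \<in> phase_poly d" using s by blast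
        have main: "(\<Sum>i\<in>{1..<r}. \<epsilon> ^ i * a i) * (A / 2 * (2 * J + X \<epsilon> + X0 \<epsilon>) - \<epsilon> * b * \<theta>)
            + \<epsilon> * (\<Sum>i\<in>{1..<r}. \<epsilon> ^ i * B i)
            = (\<Sum>i\<in>{1..<r}. \<epsilon> ^ i * c i) + \<epsilon> ^ r * (Rg J \<phi> \<tau> \<epsilon> - J\<^sup>2 / J ^ r * R (\<epsilon> / J) \<theta> \<tau>)"
          if \<epsilon>: "\<epsilon> > 0" for \<epsilon>
        proof -
          have pw: "\<epsilon> * (\<epsilon> ^ (i - Suc 0) * x) = \<epsilon> ^ i * x" "\<epsilon> * \<epsilon> ^ (i - Suc 0) = \<epsilon> ^ i"
            if "Suc 0 \<le> i" for i x
            using that by (cases i; simp)+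
          have "((\<lambda>\<psi>. Ssum r S J \<psi> \<tau> \<epsilon>) has_real_derivative (\<Sum>i\<in>{1..<r}. \<epsilon> ^ (i - 1) * F i)) (at \<phi>)"
            unfolding Ssum_def by (intro DERIV_sum DERIV_cmult SF)
          then have "((\<lambda>\<psi>. Ssum r S J \<psi> \<tau> \<epsilon>) has_vector_derivative (\<Sum>i\<in>{1..<r}. \<epsilon> ^ (i - 1) * F i)) (at_right \<phi>)"
            by (simp add: has_field_derivative_at_within flip: has_real_derivative_iff_has_vector_derivative)
          then have dphi: "\<epsilon> * dS_phi r S J \<phi> \<tau> \<epsilon> = X \<epsilon>"
            unfolding dS_phi_def by (subst vector_derivative_within)
              (auto simp: X_def sum_distrib_left pw intro!: sum.cong)
          have "((\<lambda>\<sigma>. Ssum r S J \<phi> \<sigma> \<epsilon>) has_real_derivative (\<Sum>i\<in>{1..<r}. \<epsilon> ^ (i - 1) * deriv (S i J \<phi>) \<tau>)) (at \<tau>)"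
            unfolding Ssum_def by (intro DERIV_sum DERIV_cmult S\<tau> J)
          then have dtau: "\<epsilon> ^ 2 * dS_tau r S J \<phi> \<tau> \<epsilon> = \<epsilon> * (\<Sum>i\<in>{1..<r}. \<epsilon> ^ i * deriv (S i J \<phi>) \<tau>)"
            unfolding dS_tau_def
            by (subst DERIV_imp_deriv)
              (auto simp: sum_distrib_left power2_eq_square mult.assoc pw intro!: sum.cong)
          have 1: "A / 2 * (J + X \<epsilon>)^2 - \<epsilon> * b * (J + X \<epsilon>) * \<theta> + \<epsilon> * (\<Sum>i\<in>{1..<r}. \<epsilon> ^ i * deriv (S i J \<phi>) \<tau>)
              = A / 2 * J^2 + (\<Sum>i\<in>{1..<r}. \<epsilon> ^ i * h i J \<tau>) + \<epsilon> ^ r * Rg J \<phi> \<tau> \<epsilon>"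
            using Rg[OF \<epsilon> J \<phi>, of \<tau>] unfolding new_Ham_def Ham_def dphi dtau Ham_Sigma_def \<theta>(1)
            by (simp add: A_def b_def stiffness_def strain_def mult_ac)
          define \<delta> where "\<delta> = \<epsilon> / J"
          have gx: "J * D_ang (generating s r) \<delta> \<theta> \<tau> = X0 \<epsilon>"
            unfolding generating_D_ang[of r s, OF sip, simplified] X0_def \<delta>_def sum_distrib_left
            by (intro sum.cong) (auto simp: D_indep(1)[of _ "\<epsilon> / J"] power_divide field_simps)
          have gt: "J * D_slow (generating s r) \<delta> \<theta> \<tau> = (\<Sum>i\<in>{1..<r}. \<epsilon> ^ i * (J * D_slow (\<lambda>_. s i) 0 \<theta> \<tau> / J ^ i))"
            unfolding generating_D_slow[of r s, OF sip, simplified] X0_def \<delta>_def sum_distrib_left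
            by (intro sum.cong) (auto simp: D_indep(2)[of _ "\<epsilon> / J"] power_divide field_simps)
          have ge: "J^2 * energy_terms \<eta> r \<delta> \<theta> \<tau> = (\<Sum>i\<in>{1..<r}. \<epsilon> ^ i * (J\<^sup>2 * \<eta> i \<tau> / J ^ i))"
            unfolding energy_terms_def \<delta>_def sum_distrib_left
            by (intro sum.cong) (auto simp: power_divide field_simps)
          have J\<delta>: "J * \<delta> = \<epsilon>" using J by (simp add: \<delta>_def)
          have "J^2 * (A / 2 * (1 + D_ang (generating s r) \<delta> \<theta> \<tau>)^2
               - \<delta> * b * \<theta> * (1 + D_ang (generating s r) \<delta> \<theta> \<tau>) + \<delta> * D_slow (generating s r) \<delta> \<theta> \<tau>)
             = J^2 * (A / 2 + energy_terms \<eta> r \<delta> \<theta> \<tau> + \<delta> ^ r * R \<delta> \<theta> \<tau>)"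
            using HJ unfolding solves_HJ_def A_def b_def by simp
          then have "A / 2 * (J + J * D_ang (generating s r) \<delta> \<theta> \<tau>)^2
               - (J * \<delta>) * b * (J + J * D_ang (generating s r) \<delta> \<theta> \<tau>) * \<theta> + (J * \<delta>) * (J * D_slow (generating s r) \<delta> \<theta> \<tau>)
             = A / 2 * J^2 + J^2 * energy_terms \<eta> r \<delta> \<theta> \<tau> + J^2 * (\<delta> ^ r * R \<delta> \<theta> \<tau>)"
            by (simp add: power2_eq_square algebra_simps)
          then have 2: "A / 2 * (J + X0 \<epsilon>)^2 - \<epsilon> * b * (J + X0 \<epsilon>) * \<theta>
              + \<epsilon> * (\<Sum>i\<in>{1..<r}. \<epsilon> ^ i * (J * D_slow (\<lambda>_. s i) 0 \<theta> \<tau> / J ^ i))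
              = A / 2 * J^2 + (\<Sum>i\<in>{1..<r}. \<epsilon> ^ i * (J\<^sup>2 * \<eta> i \<tau> / J ^ i)) + J^2 * (\<delta> ^ r * R \<delta> \<theta> \<tau>)"
            unfolding gx gt ge J\<delta> .
          have rr: "J^2 * (\<delta> ^ r * R \<delta> \<theta> \<tau>) = \<epsilon> ^ r * (J\<^sup>2 / J ^ r * R (\<epsilon> / J) \<theta> \<tau>)"
            by (simp add: \<delta>_def power_divide field_simps)
          have sa: "(\<Sum>i\<in>{1..<r}. \<epsilon> ^ i * a i) = X \<epsilon> - X0 \<epsilon>"
            by (simp add: a_def X_def X0_def right_diff_distrib sum_subtractf)
          have sB: "(\<Sum>i\<in>{1..<r}. \<epsilon> ^ i * B i) = (\<Sum>i\<in>{1..<r}. \<epsilon> ^ i * deriv (S i J \<phi>) \<tau>)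
              - (\<Sum>i\<in>{1..<r}. \<epsilon> ^ i * (J * D_slow (\<lambda>_. s i) 0 \<theta> \<tau> / J ^ i))"
            by (simp add: B_def right_diff_distrib sum_subtractf)
          have sc: "(\<Sum>i\<in>{1..<r}. \<epsilon> ^ i * c i) = (\<Sum>i\<in>{1..<r}. \<epsilon> ^ i * h i J \<tau>)
              - (\<Sum>i\<in>{1..<r}. \<epsilon> ^ i * (J\<^sup>2 * \<eta> i \<tau> / J ^ i))"
            by (simp add: c_def right_diff_distrib sum_subtractf)
          have sq: "(X \<epsilon> - X0 \<epsilon>) * (A / 2 * (2 * J + X \<epsilon> + X0 \<epsilon>) - \<epsilon> * b * \<theta>)
            = (A / 2 * (J + X \<epsilon>)^2 - \<epsilon> * b * (J + X \<epsilon>) * \<theta>) - (A / 2 * (J + X0 \<epsilon>)^2 - \<epsilon> * b * (J + X0 \<epsilon>) * \<theta>)"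
            by (simp add: power2_eq_square field_simps)
          show ?thesis unfolding sa sq sB sc using 1 2[unfolded rr] by (simp add: right_diff_distrib)
        qed
        have lim: "((\<lambda>\<epsilon>. \<Sum>i\<in>{1..<r}. \<epsilon> ^ i * g i) \<longlongrightarrow> 0) (at_right 0)" for g :: "nat \<Rightarrow> real"
          by (rule tendsto_eq_intros) (auto intro!: tendsto_eq_intros sum.neutral)
        have id0: "((\<lambda>\<epsilon>::real. \<epsilon>) \<longlongrightarrow> 0) (at_right 0)" by (rule tendsto_ident_at)
        have bounded_rest: "((\<lambda>\<epsilon>. \<epsilon> ^ (r - m) * (Rg J \<phi> \<tau> \<epsilon> - J\<^sup>2 / J ^ r * R (\<epsilon> / J) \<theta> \<tau>)) \<longlongrightarrow> 0) (at_right 0)"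
        proof -
          obtain C \<epsilon>\<^sub>1 where C: "\<epsilon>\<^sub>1 > 0" "\<And>\<epsilon>. \<epsilon> \<in> {0<..<\<epsilon>\<^sub>1} \<Longrightarrow> \<bar>Rg J \<phi> \<tau> \<epsilon>\<bar> \<le> C"
          proof -
            have "\<exists>C. \<exists>\<epsilon>\<^sub>1>0. \<forall>\<epsilon>\<in>{0<..<\<epsilon>\<^sub>1}. \<forall>J'\<in>{J}. \<forall>\<tau>'\<in>{\<tau>}. \<forall>\<phi>\<in>?D. \<bar>Rg J' \<phi> \<tau>' \<epsilon>\<bar> \<le> C"
              by (rule Rgb) (use J in auto)
            then show ?thesis using \<phi> that by (metis singletonI)
          qed
          have z: "((\<lambda>\<epsilon>::real. \<epsilon> ^ (r - m)) \<longlongrightarrow> 0) (at_right 0)"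
            using m by (intro tendsto_eq_intros) (auto intro: id0)
          have "((\<lambda>\<epsilon>. \<epsilon> ^ (r - m) * Rg J \<phi> \<tau> \<epsilon>) \<longlongrightarrow> 0) (at_right 0)"
          proof (rule Lim_null_comparison)
            show "((\<lambda>\<epsilon>::real. \<epsilon> ^ (r - m) * C) \<longlongrightarrow> 0) (at_right 0)"
              using tendsto_mult[OF z tendsto_const, of C] by simp
            show "\<forall>\<^sub>F \<epsilon> in at_right 0. norm (\<epsilon> ^ (r - m) * Rg J \<phi> \<tau> \<epsilon>) \<le> \<epsilon> ^ (r - m) * C"
              using eventually_at_right_real[OF C(1)]
              by eventually_elim (use C(2) in \<open>auto simp: abs_mult intro!: mult_left_mono\<close>)
          qed
          moreover have "((\<lambda>\<epsilon>. \<epsilon> ^ (r - m) * (J\<^sup>2 / J ^ r * R (\<epsilon> / J) \<theta> \<tau>)) \<longlongrightarrow> 0 * (J\<^sup>2 / J ^ r * R 0 \<theta> \<tau>)) (at_right 0)"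
            by (intro tendsto_mult z tendsto_const phase_poly_tendsto_eps R)
          ultimately show ?thesis using tendsto_diff by (fastforce simp: right_diff_distrib)
        qed
        have L: "((\<lambda>\<epsilon>. (\<Sum>i\<in>{1..<r}. \<epsilon> ^ i * a i) / \<epsilon> ^ m * (A / 2 * (2 * J + X \<epsilon> + X0 \<epsilon>) - \<epsilon> * b * \<theta>)
            + \<epsilon> * ((\<Sum>i\<in>{1..<r}. \<epsilon> ^ i * B i) / \<epsilon> ^ m))
            \<longlongrightarrow> a m * (A / 2 * (2 * J + 0 + 0) - 0 * b * \<theta>) + 0 * B m) (at_right 0)"
          unfolding X_def X0_def
          by (intro tendsto_add tendsto_mult tendsto_diff tendsto_const id0 lim leading_coefficient_limit a0 B0 m)
        have R': "((\<lambda>\<epsilon>. (\<Sum>i\<in>{1..<r}. \<epsilon> ^ i * c i) / \<epsilon> ^ m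
            + \<epsilon> ^ (r - m) * (Rg J \<phi> \<tau> \<epsilon> - J\<^sup>2 / J ^ r * R (\<epsilon> / J) \<theta> \<tau>)) \<longlongrightarrow> c m + 0) (at_right 0)"
          by (intro tendsto_add bounded_rest leading_coefficient_limit c0 m)
        have "\<forall>\<^sub>F \<epsilon> in at_right 0. (\<Sum>i\<in>{1..<r}. \<epsilon> ^ i * c i) / \<epsilon> ^ m
            + \<epsilon> ^ (r - m) * (Rg J \<phi> \<tau> \<epsilon> - J\<^sup>2 / J ^ r * R (\<epsilon> / J) \<theta> \<tau>)
          = (\<Sum>i\<in>{1..<r}. \<epsilon> ^ i * a i) / \<epsilon> ^ m * (A / 2 * (2 * J + X \<epsilon> + X0 \<epsilon>) - \<epsilon> * b * \<theta>)
            + \<epsilon> * ((\<Sum>i\<in>{1..<r}. \<epsilon> ^ i * B i) / \<epsilon> ^ m)"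
        proof (rule eventually_mono[OF eventually_at_right_less])
          fix \<epsilon> :: real assume \<epsilon>: "0 < \<epsilon>"
          define sa sB sc Z Y where "sa = (\<Sum>i\<in>{1..<r}. \<epsilon> ^ i * a i)" and "sB = (\<Sum>i\<in>{1..<r}. \<epsilon> ^ i * B i)"
            and "sc = (\<Sum>i\<in>{1..<r}. \<epsilon> ^ i * c i)"
            and "Z = Rg J \<phi> \<tau> \<epsilon> - J\<^sup>2 / J ^ r * R (\<epsilon> / J) \<theta> \<tau>" and "Y = A / 2 * (2 * J + X \<epsilon> + X0 \<epsilon>) - \<epsilon> * b * \<theta>"
          have "sa * Y + \<epsilon> * sB = sc + \<epsilon> ^ r * Z"
            using main[OF \<epsilon>] by (simp only: sa_def sB_def sc_def Z_def Y_def)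
          moreover have "\<epsilon> ^ r = \<epsilon> ^ m * \<epsilon> ^ (r - m)" using m by (simp add: power_add[symmetric])
          ultimately have "sa * Y + \<epsilon> * sB = sc + \<epsilon> ^ m * (\<epsilon> ^ (r - m) * Z)" by simp
          then have "(sa * Y + \<epsilon> * sB) / \<epsilon> ^ m = (sc + \<epsilon> ^ m * (\<epsilon> ^ (r - m) * Z)) / \<epsilon> ^ m" by simp
          then show "sc / \<epsilon> ^ m + \<epsilon> ^ (r - m) * Z = sa / \<epsilon> ^ m * Y + \<epsilon> * (sB / \<epsilon> ^ m)"
            using \<epsilon> by (simp add: add_divide_distrib)
        qed
        from Lim_transform_eventually[OF R' this]
        have "c m + 0 = a m * (A / 2 * (2 * J + 0 + 0) - 0 * b * \<theta>) + 0 * B m"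
          using tendsto_unique[OF _ _ L] trivial_limit_at_right_real by blast
        then have "a m = c m / (A * J)" using A J by (simp add: field_simps)
        moreover have "(f has_real_derivative a m) (at \<phi>)"
          unfolding f_def a_def by (intro DERIV_diff SF sF mr)
        ultimately show ?thesis by simp
      qed
      have sm: "(\<lambda>_. s m) \<in> phase_poly d" "zero_mean_periodic (s m)" using s[OF mr] by auto
      have diff: "(\<lambda>x. s m x \<tau>) differentiable (at \<theta>)" for \<theta>
        using D_ang_indep[OF sm(1)] real_differentiable_def by blast
      note wr = zero_mean_periodic_wrap[OF sm(2) diff]
      have cont: "continuous_on {0..2 * pi} f"
        unfolding f_def
        by (intro continuous_intros wr(1) continuous_on_subset[OF S(2)[OF mr J]]) (use J in auto)
      have iS: "((\<lambda>\<phi>. S m J \<phi> \<tau>) has_integral 0) {0..2 * pi}"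
      proof -
        have "(\<lambda>\<phi>. S m J \<phi> \<tau>) integrable_on {0..2 * pi}"
          by (intro integrable_continuous_real continuous_on_subset[OF S(2)[OF mr J]]) auto
        then show ?thesis using S(4)[OF mr J, of \<tau>] by (simp add: has_integral_integral)
      qed
      have mean: "(f has_integral 0) {0..2 * pi}"
        using has_integral_diff[OF iS has_integral_mult_right[OF wr(2), of "J / J ^ m"]]
        by (simp add: f_def)
      have per: "f (\<phi> + 2 * pi) = f \<phi>" for \<phi>
        using S(3)[OF mr J] by (simp add: f_def wrap_shift)
      have per0: "f (2 * pi) = f 0" using per[of 0] by simp
      note zero = constant_slope_periodic_zero_mean[OF cont slope per0 mean]
      obtain n where n: "\<phi> = wrap \<phi> + 2 * pi * of_int n" by (rule wrap_eq)
      have "f \<phi> = f (wrap \<phi> + 2 * pi)"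
        using periodic_of_int[of f "wrap \<phi>" n, OF per] n per by metis
      moreover have "f (wrap \<phi>) = 0 \<or> f (wrap \<phi> + 2 * pi) = 0"
        using zero(2)[of "wrap \<phi>"] zero(2)[of "wrap \<phi> + 2 * pi"] wrap_ge[of \<phi>] wrap_less[of \<phi>] pi_gt_zero
        by force
      ultimately have "f \<phi> = 0" using per by auto
      moreover have "c m = 0" using zero(1) A J by simp
      ultimately show "S m J \<phi> \<tau> = J * s m (wrap \<phi>) \<tau> / J ^ m \<and> h m J \<tau> = J\<^sup>2 * \<eta> m \<tau> / J ^ m"
        by (simp add: f_def c_def)
    qed
  qed
  then show "S m J \<phi> \<tau> = J * s m (wrap \<phi>) \<tau> / J ^ m" "h m J \<tau> = J\<^sup>2 * \<eta> m \<tau> / J ^ m"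
    using m J by blast+
qed

end

section \<open>Uniform bounds and the near-identity change of action\<close>

locale bounded_wall = moving_wall +
  fixes M :: "real set"
  assumes bounded: "\<And>n. bounded ((deriv ^^ n) d ` M)"
begin

lemma coeff_alg_bounded:
  assumes "a \<in> coeff_alg d"
  shows "\<exists>C. \<forall>\<tau>\<in>M. \<bar>a \<tau>\<bar> \<le> C"
  using assms
proof induction
  case (const c)
  then show ?case by blast
next
  case (deriv n)
  show ?case using bounded[of n] unfolding bounded_iff by auto
next
  case inv
  have "\<bar>inverse (d \<tau>)\<bar> \<le> inverse c\<^sub>0" for \<tau>
    using le_imp_inverse_le[OF d_ge c\<^sub>0_pos, of \<tau>] d_pos[of \<tau>] by simp
  then show ?case by blast
next
  case (add a b)
  then obtain C D where *: "\<And>\<tau>. \<tau> \<in> M \<Longrightarrow> \<bar>a \<tau>\<bar> \<le> C" "\<And>\<tau>. \<tau> \<in> M \<Longrightarrow> \<bar>b \<tau>\<bar> \<le> D" by blast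
  have "\<bar>a \<tau> + b \<tau>\<bar> \<le> C + D" if "\<tau> \<in> M" for \<tau>
    using *[OF that] by linarith
  then show ?case by blast
next
  case (mult a b)
  then obtain C D where *: "\<And>\<tau>. \<tau> \<in> M \<Longrightarrow> \<bar>a \<tau>\<bar> \<le> C" "\<And>\<tau>. \<tau> \<in> M \<Longrightarrow> \<bar>b \<tau>\<bar> \<le> D" by blast
  have "\<bar>a \<tau> * b \<tau>\<bar> \<le> C * D" if "\<tau> \<in> M" for \<tau>
    unfolding abs_mult by (rule mult_mono'[OF *[OF that]]) auto
  then show ?case by blast
qed

lemma coeff_alg_bound:
  assumes "a \<in> coeff_alg d"
  obtains C where "C > 0" "\<And>\<tau>. \<tau> \<in> M \<Longrightarrow> \<bar>a \<tau>\<bar> \<le> C"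
proof -
  obtain C where "\<forall>\<tau>\<in>M. \<bar>a \<tau>\<bar> \<le> C" using coeff_alg_bounded[OF assms] by blast
  then show ?thesis by (intro that[of "max C 1"]) (auto simp: le_max_iff_disj)
qed

lemma phase_poly_bounded:
  assumes "f \<in> phase_poly d"
  obtains C where "C > 0"
    "\<And>\<delta> \<theta> \<tau>. 0 \<le> \<delta> \<Longrightarrow> \<delta> \<le> 1 \<Longrightarrow> \<bar>\<theta>\<bar> \<le> pi \<Longrightarrow> \<tau> \<in> M \<Longrightarrow> \<bar>f \<delta> \<theta> \<tau>\<bar> \<le> C"
proof -
  have "\<exists>C. \<forall>(\<delta>::real) (\<theta>::real) (\<tau>::real). 0 \<le> \<delta> \<and> \<delta> \<le> 1 \<and> \<bar>\<theta>\<bar> \<le> pi \<and> \<tau> \<in> M \<longrightarrow> \<bar>f \<delta> \<theta> \<tau>\<bar> \<le> C"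
    using assms
  proof induction
    case (monom a n m)
    then obtain C where C: "\<And>\<tau>. \<tau> \<in> M \<Longrightarrow> \<bar>a \<tau>\<bar> \<le> C" using coeff_alg_bounded by blast
    have "\<bar>a \<tau> * \<theta> ^ n * \<delta> ^ m\<bar> \<le> C * pi ^ n * 1"
      if "0 \<le> \<delta>" "\<delta> \<le> 1" "\<bar>\<theta>\<bar> \<le> pi" "\<tau> \<in> M" for \<delta> \<theta> \<tau> :: real
      unfolding abs_mult power_abs
      by (intro mult_mono' C power_mono that) (use that in \<open>auto simp: power_le_one\<close>)
    then show ?case by blast
  next
    case (add f g)
    then obtain C D where C: "\<forall>(\<delta>::real) (\<theta>::real) (\<tau>::real). 0 \<le> \<delta> \<and> \<delta> \<le> 1 \<and> \<bar>\<theta>\<bar> \<le> pi \<and> \<tau> \<in> M \<longrightarrow> \<bar>f \<delta> \<theta> \<tau>\<bar> \<le> C"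
      and D: "\<forall>(\<delta>::real) (\<theta>::real) (\<tau>::real). 0 \<le> \<delta> \<and> \<delta> \<le> 1 \<and> \<bar>\<theta>\<bar> \<le> pi \<and> \<tau> \<in> M \<longrightarrow> \<bar>g \<delta> \<theta> \<tau>\<bar> \<le> D" by blast
    have "\<bar>f \<delta> \<theta> \<tau> + g \<delta> \<theta> \<tau>\<bar> \<le> C + D" if "0 \<le> \<delta> \<and> \<delta> \<le> 1 \<and> \<bar>\<theta>\<bar> \<le> pi \<and> \<tau> \<in> M" for \<delta> \<theta> \<tau> :: real
      using C[rule_format, OF that] D[rule_format, OF that] by linarith
    then show ?case by blast
  qed
  then obtain C where "\<forall>(\<delta>::real) (\<theta>::real) (\<tau>::real). 0 \<le> \<delta> \<and> \<delta> \<le> 1 \<and> \<bar>\<theta>\<bar> \<le> pi \<and> \<tau> \<in> M \<longrightarrow> \<bar>f \<delta> \<theta> \<tau>\<bar> \<le> C" by blast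
  then show ?thesis by (intro that[of "max C 1"]) (auto simp: le_max_iff_disj)
qed

lemma phase_poly_bounded_indep:
  assumes "(\<lambda>_. g) \<in> phase_poly d"
  obtains C where "C > 0" "\<And>\<theta> \<tau>. \<bar>\<theta>\<bar> \<le> pi \<Longrightarrow> \<tau> \<in> M \<Longrightarrow> \<bar>g \<theta> \<tau>\<bar> \<le> C"
proof (rule phase_poly_bounded[OF assms])
  fix C assume C: "0 < C"
    "\<And>(\<delta>::real) \<theta> \<tau>. \<lbrakk>0 \<le> \<delta>; \<delta> \<le> 1; \<bar>\<theta>\<bar> \<le> pi; \<tau> \<in> M\<rbrakk> \<Longrightarrow> \<bar>g \<theta> \<tau>\<bar> \<le> C"
  show thesis by (rule that[OF C(1) C(2)[of 0]]) auto
qed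

lemma phase_poly_lipschitz:
  assumes f: "f \<in> phase_poly d"
  obtains C where "C > 0"
    "\<And>\<delta> \<delta>' \<theta> \<tau>. 0 \<le> \<delta> \<Longrightarrow> \<delta> \<le> 1 \<Longrightarrow> 0 \<le> \<delta>' \<Longrightarrow> \<delta>' \<le> 1 \<Longrightarrow> \<bar>\<theta>\<bar> \<le> pi \<Longrightarrow> \<tau> \<in> M \<Longrightarrow>
       \<bar>f \<delta> \<theta> \<tau> - f \<delta>' \<theta> \<tau>\<bar> \<le> C * \<bar>\<delta> - \<delta>'\<bar>"
proof -
  obtain C where C: "C > 0"
    "\<And>\<delta> \<theta> \<tau>. 0 \<le> \<delta> \<Longrightarrow> \<delta> \<le> 1 \<Longrightarrow> \<bar>\<theta>\<bar> \<le> pi \<Longrightarrow> \<tau> \<in> M \<Longrightarrow> \<bar>D_eps f \<delta> \<theta> \<tau>\<bar> \<le> C"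
    using phase_poly_bounded[OF D_eps_in[OF f]] by blast
  show ?thesis
  proof (rule that[OF C(1)])
    fix \<delta> \<delta>' \<theta> \<tau> :: real assume *: "0 \<le> \<delta>" "\<delta> \<le> 1" "0 \<le> \<delta>'" "\<delta>' \<le> 1" "\<bar>\<theta>\<bar> \<le> pi" "\<tau> \<in> M"
    have "norm (f \<delta> \<theta> \<tau> - f \<delta>' \<theta> \<tau>) \<le> C * norm (\<delta> - \<delta>')"
    proof (rule field_differentiable_bound[of "{0..1}"])
      show "((\<lambda>x. f x \<theta> \<tau>) has_field_derivative D_eps f z \<theta> \<tau>) (at z within {0..1})" if "z \<in> {0..1}" for z
        by (rule has_field_derivative_at_within[OF D_eps[OF f]])
      show "norm (D_eps f z \<theta> \<tau>) \<le> C" if "z \<in> {0..1}" for z using C(2)[of z \<theta> \<tau>] that * by simp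
    qed (use * in auto)
    then show "\<bar>f \<delta> \<theta> \<tau> - f \<delta>' \<theta> \<tau>\<bar> \<le> C * \<bar>\<delta> - \<delta>'\<bar>" by simp
  qed
qed

lemma stiffness_lower: obtains A\<^sub>0 where "A\<^sub>0 > 0" "\<And>\<tau>. \<tau> \<in> M \<Longrightarrow> A\<^sub>0 \<le> stiffness d \<tau>"
proof -
  obtain C where C: "C > 0" "\<And>\<tau>. \<tau> \<in> M \<Longrightarrow> \<bar>1 / stiffness d \<tau>\<bar> \<le> C"
    using that by (rule coeff_alg_bound[OF inverse_stiffness_coeff])
  show ?thesis
  proof (rule that[of "1 / C"])
    show "1 / C > 0" using C by simp
    show "1 / C \<le> stiffness d \<tau>" if "\<tau> \<in> M" for \<tau>
      using C(2)[OF that] C(1) stiffness_pos[of \<tau>] by (simp add: field_simps)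
  qed
qed

text \<open>
  Since \<open>p\<close> contains a factor \<open>\<delta> = \<epsilon> / j\<close>, the map differs from the identity by \<open>\<epsilon>\<close> times a smooth function
  of \<open>\<epsilon> / j\<close>, and this difference varies with \<open>j\<close> only at the rate \<open>O(\<epsilon>\<^sup>2)\<close>.
\<close>
lemma near_identity:
  assumes p: "p \<in> phase_poly d" and p0: "\<And>\<theta> \<tau>. p 0 \<theta> \<tau> = 0"
  obtains \<delta>\<^sub>1 K where "0 < \<delta>\<^sub>1" "\<delta>\<^sub>1 \<le> 1" "K > 0"
    "\<And>\<epsilon> a j j' \<theta> \<tau>. 0 < a \<Longrightarrow> 0 < \<epsilon> \<Longrightarrow> \<epsilon> \<le> \<delta>\<^sub>1 * a \<Longrightarrow> a \<le> j \<Longrightarrow> a \<le> j' \<Longrightarrow> \<bar>\<theta>\<bar> \<le> pi \<Longrightarrow> \<tau> \<in> M \<Longrightarrow>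
       \<bar>j * (1 + p (\<epsilon> / j) \<theta> \<tau>) - j' * (1 + p (\<epsilon> / j') \<theta> \<tau>) - (j - j')\<bar> \<le> \<bar>j - j'\<bar> / 2"
    "\<And>\<epsilon> a j \<theta> \<tau>. 0 < a \<Longrightarrow> 0 < \<epsilon> \<Longrightarrow> \<epsilon> \<le> \<delta>\<^sub>1 * a \<Longrightarrow> a \<le> j \<Longrightarrow> \<bar>\<theta>\<bar> \<le> pi \<Longrightarrow> \<tau> \<in> M \<Longrightarrow>
       \<bar>j * (1 + p (\<epsilon> / j) \<theta> \<tau>) - j\<bar> \<le> K * \<epsilon>"
proof -
  obtain P where P: "P \<in> phase_poly d" "\<And>\<delta> \<theta> \<tau>. p \<delta> \<theta> \<tau> = \<delta> * P \<delta> \<theta> \<tau>"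
    using phase_poly_split[OF p] p0 by auto
  obtain K where K: "K > 0"
    "\<And>\<delta> \<theta> \<tau>. 0 \<le> \<delta> \<Longrightarrow> \<delta> \<le> 1 \<Longrightarrow> \<bar>\<theta>\<bar> \<le> pi \<Longrightarrow> \<tau> \<in> M \<Longrightarrow> \<bar>P \<delta> \<theta> \<tau>\<bar> \<le> K"
    using phase_poly_bounded[OF P(1)] by blast
  obtain L where L: "L > 0"
    "\<And>\<delta> \<delta>' \<theta> \<tau>. 0 \<le> \<delta> \<Longrightarrow> \<delta> \<le> 1 \<Longrightarrow> 0 \<le> \<delta>' \<Longrightarrow> \<delta>' \<le> 1 \<Longrightarrow> \<bar>\<theta>\<bar> \<le> pi \<Longrightarrow> \<tau> \<in> M \<Longrightarrow>
       \<bar>P \<delta> \<theta> \<tau> - P \<delta>' \<theta> \<tau>\<bar> \<le> L * \<bar>\<delta> - \<delta>'\<bar>"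
    using phase_poly_lipschitz[OF P(1)] by blast
  define \<delta>\<^sub>1 where "\<delta>\<^sub>1 = 1 / (1 + 2 * L)"
  have \<delta>\<^sub>1: "0 < \<delta>\<^sub>1" "\<delta>\<^sub>1 \<le> 1" using L by (simp_all add: \<delta>\<^sub>1_def)
  have L\<delta>: "L * \<delta>\<^sub>1 \<le> 1 / 2" using L by (simp add: \<delta>\<^sub>1_def field_simps)
  have small: "0 \<le> \<epsilon> / j" "\<epsilon> / j \<le> \<delta>\<^sub>1" "\<epsilon> / j \<le> 1" if "0 < a" "0 < \<epsilon>" "\<epsilon> \<le> \<delta>\<^sub>1 * a" "a \<le> j" for \<epsilon> a j
  proof -
    have "\<delta>\<^sub>1 * a \<le> \<delta>\<^sub>1 * j" using \<delta>\<^sub>1 that by simp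
    then show "0 \<le> \<epsilon> / j" "\<epsilon> / j \<le> \<delta>\<^sub>1" using that by (simp_all add: field_simps)
    then show "\<epsilon> / j \<le> 1" using \<delta>\<^sub>1 by linarith
  qed
  have eq: "j * (1 + p (\<epsilon> / j) \<theta> \<tau>) = j + \<epsilon> * P (\<epsilon> / j) \<theta> \<tau>" if "0 < j" for \<epsilon> j \<theta> \<tau>
    using that by (simp add: P(2) field_simps)
  show ?thesis
  proof (rule that[OF \<delta>\<^sub>1 K(1)])
    fix \<epsilon> a j j' \<theta> \<tau> :: real assume *: "0 < a" "0 < \<epsilon>" "\<epsilon> \<le> \<delta>\<^sub>1 * a" "a \<le> j" "a \<le> j'" "\<bar>\<theta>\<bar> \<le> pi" "\<tau> \<in> M"
    have "\<bar>P (\<epsilon> / j) \<theta> \<tau> - P (\<epsilon> / j') \<theta> \<tau>\<bar> \<le> L * \<bar>\<epsilon> / j - \<epsilon> / j'\<bar>"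
      by (intro L(2) small[of a] *)
    also have "\<epsilon> / j - \<epsilon> / j' = (\<epsilon> / j) * (j' - j) / j'" using * by (simp add: field_simps)
    also have "\<bar>(\<epsilon> / j) * (j' - j) / j'\<bar> = (\<epsilon> / j) * \<bar>j - j'\<bar> / j'"
      using * by (simp add: abs_mult abs_minus_commute)
    finally have "\<epsilon> * \<bar>P (\<epsilon> / j) \<theta> \<tau> - P (\<epsilon> / j') \<theta> \<tau>\<bar> \<le> \<epsilon> * (L * ((\<epsilon> / j) * \<bar>j - j'\<bar> / j'))"
      by (rule mult_left_mono) (use * in simp)
    also have "\<dots> = (\<epsilon> / j') * (L * (\<epsilon> / j)) * \<bar>j - j'\<bar>" by (simp add: mult_ac)
    also have "\<dots> \<le> 1 * (1 / 2) * \<bar>j - j'\<bar>"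
    proof (intro mult_right_mono mult_mono)
      show "\<epsilon> / j' \<le> 1" using small(3)[OF *(1-3) *(5)] .
      have "L * (\<epsilon> / j) \<le> L * \<delta>\<^sub>1" using small(2)[OF *(1-4)] L by (intro mult_left_mono) auto
      then show "L * (\<epsilon> / j) \<le> 1 / 2" using L\<delta> by linarith
      show "0 \<le> L * (\<epsilon> / j)" using small(1)[OF *(1-4)] L by (intro mult_nonneg_nonneg) auto
    qed auto
    finally have "\<bar>\<epsilon> * P (\<epsilon> / j) \<theta> \<tau> - \<epsilon> * P (\<epsilon> / j') \<theta> \<tau>\<bar> \<le> \<bar>j - j'\<bar> / 2"
      using * by (simp add: abs_mult right_diff_distrib[symmetric])
    then show "\<bar>j * (1 + p (\<epsilon> / j) \<theta> \<tau>) - j' * (1 + p (\<epsilon> / j') \<theta> \<tau>) - (j - j')\<bar> \<le> \<bar>j - j'\<bar> / 2"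
      using * by (simp add: eq)
  next
    fix \<epsilon> a j \<theta> \<tau> :: real assume *: "0 < a" "0 < \<epsilon>" "\<epsilon> \<le> \<delta>\<^sub>1 * a" "a \<le> j" "\<bar>\<theta>\<bar> \<le> pi" "\<tau> \<in> M"
    have "\<bar>P (\<epsilon> / j) \<theta> \<tau>\<bar> \<le> K" by (intro K small[of a] *)
    then show "\<bar>j * (1 + p (\<epsilon> / j) \<theta> \<tau>) - j\<bar> \<le> K * \<epsilon>"
      using * by (simp add: eq abs_mult mult.commute mult_left_mono)
  qed
qed

lemma near_identity_inverse:
  assumes p: "p \<in> phase_poly d" and p0: "\<And>\<theta> \<tau>. p 0 \<theta> \<tau> = 0"
  obtains \<kappa> where "0 < \<kappa>"
    "\<And>\<epsilon> a I \<theta> \<tau>. 0 < a \<Longrightarrow> 0 < \<epsilon> \<Longrightarrow> \<epsilon> \<le> \<kappa> * a \<Longrightarrow> a \<le> I \<Longrightarrow> \<bar>\<theta>\<bar> \<le> pi \<Longrightarrow> \<tau> \<in> M \<Longrightarrow>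
       \<exists>!J. \<bar>J - I\<bar> \<le> I / 2 \<and> I = J * (1 + p (\<epsilon> / J) \<theta> \<tau>)"
proof -
  obtain \<delta>\<^sub>1 K where \<delta>\<^sub>1: "0 < \<delta>\<^sub>1" "\<delta>\<^sub>1 \<le> 1" "K > 0"
    and ni: "\<And>\<epsilon> a j j' \<theta> \<tau>. 0 < a \<Longrightarrow> 0 < \<epsilon> \<Longrightarrow> \<epsilon> \<le> \<delta>\<^sub>1 * a \<Longrightarrow> a \<le> j \<Longrightarrow> a \<le> j' \<Longrightarrow> \<bar>\<theta>\<bar> \<le> pi \<Longrightarrow> \<tau> \<in> M \<Longrightarrow>
       \<bar>j * (1 + p (\<epsilon> / j) \<theta> \<tau>) - j' * (1 + p (\<epsilon> / j') \<theta> \<tau>) - (j - j')\<bar> \<le> \<bar>j - j'\<bar> / 2"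
    "\<And>\<epsilon> a j \<theta> \<tau>. 0 < a \<Longrightarrow> 0 < \<epsilon> \<Longrightarrow> \<epsilon> \<le> \<delta>\<^sub>1 * a \<Longrightarrow> a \<le> j \<Longrightarrow> \<bar>\<theta>\<bar> \<le> pi \<Longrightarrow> \<tau> \<in> M \<Longrightarrow>
       \<bar>j * (1 + p (\<epsilon> / j) \<theta> \<tau>) - j\<bar> \<le> K * \<epsilon>"
    using near_identity[OF p p0] by blast
  define \<kappa> where "\<kappa> = min (\<delta>\<^sub>1 / 2) (1 / (2 * K))"
  have \<kappa>: "0 < \<kappa>" "\<kappa> \<le> \<delta>\<^sub>1 / 2" "K * \<kappa> \<le> 1 / 2"
  proof -
    show "0 < \<kappa>" "\<kappa> \<le> \<delta>\<^sub>1 / 2" using \<delta>\<^sub>1 by (auto simp: \<kappa>_def)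
    have "K * \<kappa> \<le> K * (1 / (2 * K))" using \<delta>\<^sub>1 by (intro mult_left_mono) (auto simp: \<kappa>_def)
    then show "K * \<kappa> \<le> 1 / 2" using \<delta>\<^sub>1 by simp
  qed
  show ?thesis
  proof (rule that[OF \<kappa>(1)])
    fix \<epsilon> a I \<theta> \<tau> :: real assume *: "0 < a" "0 < \<epsilon>" "\<epsilon> \<le> \<kappa> * a" "a \<le> I" "\<bar>\<theta>\<bar> \<le> pi" "\<tau> \<in> M"
    define G where "G = (\<lambda>j. j * (1 + p (\<epsilon> / j) \<theta> \<tau>))"
    have \<epsilon>I: "\<epsilon> \<le> \<kappa> * I" using * \<kappa> by (meson mult_left_mono less_imp_le order_trans)
    have I: "0 < I / 2" using * by simp
    have "\<kappa> * I \<le> \<delta>\<^sub>1 / 2 * I" using \<kappa> I by (intro mult_right_mono) auto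
    then have \<epsilon>I': "\<epsilon> \<le> \<delta>\<^sub>1 * (I / 2)" using \<epsilon>I by simp
    have lip: "\<bar>G j - G j' - (j - j')\<bar> \<le> \<bar>j - j'\<bar> / 2" if "I / 2 \<le> j" "I / 2 \<le> j'" for j j'
      unfolding G_def by (rule ni(1)[OF I *(2) \<epsilon>I' that *(5,6)])
    have "K * \<epsilon> \<le> K * (\<kappa> * I)" using \<epsilon>I \<delta>\<^sub>1 by (intro mult_left_mono) auto
    also have "\<dots> = (K * \<kappa>) * I" by simp
    also have "\<dots> \<le> 1 / 2 * I" using \<kappa> I by (intro mult_right_mono) auto
    finally have K\<epsilon>: "K * \<epsilon> \<le> I / 2" by simp
    have near: "\<bar>G j - j\<bar> \<le> I / 2" if "I / 2 \<le> j" for j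
      using ni(2)[OF I *(2) \<epsilon>I' that *(5,6)] K\<epsilon> unfolding G_def by linarith
    have "continuous_on {I / 2..3 * I / 2} G"
    proof (rule lipschitz_on_continuous_on[of 2], rule lipschitz_onI)
      show "dist (G j) (G j') \<le> 2 * dist j j'" if "j \<in> {I / 2..3 * I / 2}" "j' \<in> {I / 2..3 * I / 2}" for j j'
      proof -
        have *: "\<bar>G j - G j' - (j - j')\<bar> \<le> \<bar>j - j'\<bar> / 2" using lip[of j j'] that by simp
        have "\<bar>G j - G j'\<bar> \<le> \<bar>G j - G j' - (j - j')\<bar> + \<bar>j - j'\<bar>"
          using abs_triangle_ineq[of "G j - G j' - (j - j')" "j - j'"] by simp
        also have "\<dots> \<le> \<bar>j - j'\<bar> / 2 + \<bar>j - j'\<bar>" using * by (rule add_right_mono)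
        also have "\<dots> \<le> 2 * \<bar>j - j'\<bar>" by simp
        finally show ?thesis unfolding dist_real_def .
      qed
    qed simp
    then obtain J where J: "I / 2 \<le> J" "J \<le> 3 * I / 2" "G J = I"
      using IVT'[of G "I / 2" I "3 * I / 2"] near[of "I / 2"] near[of "3 * I / 2"] I by force
    show "\<exists>!J. \<bar>J - I\<bar> \<le> I / 2 \<and> I = J * (1 + p (\<epsilon> / J) \<theta> \<tau>)"
    proof (rule ex1I[of _ J])
      show "\<bar>J - I\<bar> \<le> I / 2 \<and> I = J * (1 + p (\<epsilon> / J) \<theta> \<tau>)"
      proof
        show "\<bar>J - I\<bar> \<le> I / 2" using J(1,2) by (intro abs_leI) linarith+
        show "I = J * (1 + p (\<epsilon> / J) \<theta> \<tau>)" using J(3) unfolding G_def by (rule sym)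
      qed
      fix J' :: real assume J': "\<bar>J' - I\<bar> \<le> I / 2 \<and> I = J' * (1 + p (\<epsilon> / J') \<theta> \<tau>)"
      then have "I / 2 \<le> J'" by linarith
      moreover have "G J' = I" using conjunct2[OF J'] unfolding G_def by (rule sym)
      ultimately have "\<bar>J' - J\<bar> \<le> \<bar>J' - J\<bar> / 2" using lip[of J' J] J by (simp add: abs_minus_commute)
      then have "\<bar>J' - J\<bar> \<le> 0" by argo
      then show "J' = J" by simp
    qed
  qed
qed

end

section \<open>The defect of the Hamilton-Jacobi equation\<close>

text \<open>
  What the later estimates use of a normal form of order \<open>n\<close>.
\<close>
locale normal_form = bounded_wall +
  fixes \<sigma> e R :: "real \<Rightarrow> real \<Rightarrow> real \<Rightarrow> real" and n :: nat
  assumes \<sigma>: "\<sigma> \<in> phase_poly d" and e: "e \<in> phase_poly d" and R: "R \<in> phase_poly d"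
    and HJ: "solves_HJ d \<sigma> e n R"
    and \<sigma>0: "\<And>\<theta> \<tau>. \<sigma> 0 \<theta> \<tau> = 0"
    and \<sigma>per: "\<And>\<delta> \<tau>. \<sigma> \<delta> pi \<tau> = \<sigma> \<delta> (- pi) \<tau>"
    and e_ang: "\<And>\<delta> \<theta> \<tau>. e \<delta> \<theta> \<tau> = e \<delta> 0 \<tau>"
begin

text \<open>
  The old action divided by the new one, as prescribed by the generating function.
\<close>
definition ratio :: "real \<Rightarrow> real \<Rightarrow> real \<Rightarrow> real" where
  "ratio \<delta> \<theta> \<tau> = 1 + D_ang \<sigma> \<delta> \<theta> \<tau>"

text \<open>
  The difference of the two sides of the Hamilton-Jacobi equation without remainder, evaluated at an
  arbitrary ratio \<open>y\<close> of the actions. It measures by how much the frozen action differs from the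
  actual new action.
\<close>
definition defect :: "real \<Rightarrow> real \<Rightarrow> real \<Rightarrow> real \<Rightarrow> real" where
  "defect y \<delta> \<theta> \<tau> = stiffness d \<tau> / 2 * y^2 - \<delta> * strain d \<tau> * \<theta> * y + \<delta> * D_slow \<sigma> \<delta> \<theta> \<tau>
     - stiffness d \<tau> / 2 - e \<delta> \<theta> \<tau>"

text \<open>
  The derivative of the defect with respect to the slow time along the free motion, in which the ratio
  \<open>y\<close> and the phase vary too. The terms without a derivative in the slow time cancel: they form the
  Poisson bracket of the Hamiltonian with itself.
\<close>
definition defect_rate :: "real \<Rightarrow> real \<Rightarrow> real \<Rightarrow> real \<Rightarrow> real" where
  "defect_rate y \<delta> \<theta> \<tau> = deriv (stiffness d) \<tau> / 2 * (y^2 - 1) - \<delta> * deriv (strain d) \<tau> * \<theta> * y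
     + \<delta> * D_slow (D_slow \<sigma>) \<delta> \<theta> \<tau> - D_slow e \<delta> \<theta> \<tau>
     + D_ang (D_slow \<sigma>) \<delta> \<theta> \<tau> * (stiffness d \<tau> * y - \<delta> * strain d \<tau> * \<theta>)"

lemma coeff_deriv_in:
  assumes "a \<in> coeff_alg d"
  shows "deriv a \<in> coeff_alg d" and "(a has_real_derivative deriv a \<tau>) (at \<tau>)"
proof -
  obtain a' where a': "a' \<in> coeff_alg d" "\<And>\<tau>. (a has_real_derivative a' \<tau>) (at \<tau>)"
    using coeff_alg_deriv[OF assms] by blast
  then have "deriv a = a'" by (intro ext DERIV_imp_deriv)
  then show "deriv a \<in> coeff_alg d" "(a has_real_derivative deriv a \<tau>) (at \<tau>)" using a' by auto
qed

lemma HJ_eq: "stiffness d \<tau> / 2 * (ratio \<delta> \<theta> \<tau>)^2 - \<delta> * strain d \<tau> * \<theta> * ratio \<delta> \<theta> \<tau>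
    + \<delta> * D_slow \<sigma> \<delta> \<theta> \<tau> = stiffness d \<tau> / 2 + e \<delta> \<theta> \<tau> + \<delta> ^ n * R \<delta> \<theta> \<tau>"
  using HJ unfolding solves_HJ_def ratio_def by blast

lemma defect_factor:
  "defect y \<delta> \<theta> \<tau> = (y - ratio \<delta> \<theta> \<tau>) * (stiffness d \<tau> / 2 * (y + ratio \<delta> \<theta> \<tau>) - \<delta> * strain d \<tau> * \<theta>)
     + \<delta> ^ n * R \<delta> \<theta> \<tau>"
proof -
  define A b w q e' z where "A = stiffness d \<tau>" and "b = strain d \<tau>" and "w = ratio \<delta> \<theta> \<tau>"
    and "q = D_slow \<sigma> \<delta> \<theta> \<tau>" and "e' = e \<delta> \<theta> \<tau>" and "z = \<delta> ^ n * R \<delta> \<theta> \<tau>"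
  have "A / 2 * w^2 - \<delta> * b * \<theta> * w + \<delta> * q = A / 2 + e' + z"
    using HJ_eq by (simp add: A_def b_def w_def q_def e'_def z_def)
  then have z: "z = A / 2 * w^2 - \<delta> * b * \<theta> * w + \<delta> * q - A / 2 - e'" by linarith
  have "A / 2 * y^2 - \<delta> * b * \<theta> * y + \<delta> * q - A / 2 - e' = (y - w) * (A / 2 * (y + w) - \<delta> * b * \<theta>) + z"
    unfolding z by (simp add: power2_eq_square field_simps)
  then show ?thesis unfolding defect_def A_def b_def w_def q_def e'_def z_def .
qed

lemma ratio_slow: "(ratio \<delta> \<theta> has_real_derivative D_ang (D_slow \<sigma>) \<delta> \<theta> \<tau>) (at \<tau>)"
  unfolding ratio_def[abs_def] using D_slow[OF D_ang_in[OF \<sigma>], of \<delta> \<theta> \<tau>]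
  by (auto intro!: derivative_eq_intros simp: D_slow_ang[OF \<sigma>])

lemma ratio_eps: "((\<lambda>x. ratio x \<theta> \<tau>) has_real_derivative D_ang (D_eps \<sigma>) \<delta> \<theta> \<tau>) (at \<delta>)"
  unfolding ratio_def[abs_def] using D_eps[OF D_ang_in[OF \<sigma>], of \<theta> \<tau> \<delta>]
  by (auto intro!: derivative_eq_intros simp: D_eps_ang[OF \<sigma>])

lemma HJ_slow:
  "deriv (stiffness d) \<tau> / 2 * (ratio \<delta> \<theta> \<tau>)^2 + stiffness d \<tau> * ratio \<delta> \<theta> \<tau> * D_ang (D_slow \<sigma>) \<delta> \<theta> \<tau>
    - \<delta> * deriv (strain d) \<tau> * \<theta> * ratio \<delta> \<theta> \<tau> - \<delta> * strain d \<tau> * \<theta> * D_ang (D_slow \<sigma>) \<delta> \<theta> \<tau>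
    + \<delta> * D_slow (D_slow \<sigma>) \<delta> \<theta> \<tau>
   = deriv (stiffness d) \<tau> / 2 + D_slow e \<delta> \<theta> \<tau> + \<delta> ^ n * D_slow R \<delta> \<theta> \<tau>"
proof (rule DERIV_unique)
  note A = coeff_deriv_in(2)[OF stiffness_coeff] and b = coeff_deriv_in(2)[OF strain_coeff]
  show "((\<lambda>\<tau>. stiffness d \<tau> / 2 * (ratio \<delta> \<theta> \<tau>)^2 - \<delta> * strain d \<tau> * \<theta> * ratio \<delta> \<theta> \<tau>
    + \<delta> * D_slow \<sigma> \<delta> \<theta> \<tau>) has_real_derivative
    deriv (stiffness d) \<tau> / 2 * (ratio \<delta> \<theta> \<tau>)^2 + stiffness d \<tau> * ratio \<delta> \<theta> \<tau> * D_ang (D_slow \<sigma>) \<delta> \<theta> \<tau>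
    - \<delta> * deriv (strain d) \<tau> * \<theta> * ratio \<delta> \<theta> \<tau> - \<delta> * strain d \<tau> * \<theta> * D_ang (D_slow \<sigma>) \<delta> \<theta> \<tau>
    + \<delta> * D_slow (D_slow \<sigma>) \<delta> \<theta> \<tau>) (at \<tau>)"
    by (auto intro!: derivative_eq_intros A b ratio_slow D_slow[OF D_slow_in[OF \<sigma>]]
        simp: power2_eq_square algebra_simps)
  show "((\<lambda>\<tau>. stiffness d \<tau> / 2 * (ratio \<delta> \<theta> \<tau>)^2 - \<delta> * strain d \<tau> * \<theta> * ratio \<delta> \<theta> \<tau>
    + \<delta> * D_slow \<sigma> \<delta> \<theta> \<tau>) has_real_derivative
    deriv (stiffness d) \<tau> / 2 + D_slow e \<delta> \<theta> \<tau> + \<delta> ^ n * D_slow R \<delta> \<theta> \<tau>) (at \<tau>)"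
    unfolding HJ_eq by (auto intro!: derivative_eq_intros A D_slow[OF e] D_slow[OF R])
qed

text \<open>
  The Hamilton-Jacobi equation, differentiated in the slow time, shows that the rate vanishes at
  \<open>y = ratio\<close> up to the remainder: the defect is driven by itself.
\<close>
lemma defect_rate_factor:
  "defect_rate y \<delta> \<theta> \<tau> = (y - ratio \<delta> \<theta> \<tau>) * (deriv (stiffness d) \<tau> / 2 * (y + ratio \<delta> \<theta> \<tau>)
      - \<delta> * deriv (strain d) \<tau> * \<theta> + stiffness d \<tau> * D_ang (D_slow \<sigma>) \<delta> \<theta> \<tau>)
     + \<delta> ^ n * D_slow R \<delta> \<theta> \<tau>"
proof -
  define A b w q e' z q' A' b' p where "A = stiffness d \<tau>" and "b = strain d \<tau>" and "w = ratio \<delta> \<theta> \<tau>"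
    and "q = D_slow \<sigma> \<delta> \<theta> \<tau>" and "e' = D_slow e \<delta> \<theta> \<tau>" and "z = \<delta> ^ n * D_slow R \<delta> \<theta> \<tau>"
    and "q' = D_slow (D_slow \<sigma>) \<delta> \<theta> \<tau>" and "A' = deriv (stiffness d) \<tau>" and "b' = deriv (strain d) \<tau>"
    and "p = D_ang (D_slow \<sigma>) \<delta> \<theta> \<tau>"
  have "A' / 2 * w^2 + A * w * p - \<delta> * b' * \<theta> * w - \<delta> * b * \<theta> * p + \<delta> * q' = A' / 2 + e' + z"
    using HJ_slow unfolding A_def b_def w_def q_def e'_def z_def q'_def A'_def b'_def p_def .
  then have z: "z = A' / 2 * w^2 + A * w * p - \<delta> * b' * \<theta> * w - \<delta> * b * \<theta> * p + \<delta> * q' - A' / 2 - e'"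
    by linarith
  have "A' / 2 * (y^2 - 1) - \<delta> * b' * \<theta> * y + \<delta> * q' - e' + p * (A * y - \<delta> * b * \<theta>)
    = (y - w) * (A' / 2 * (y + w) - \<delta> * b' * \<theta> + A * p) + z"
    unfolding z by (simp add: power2_eq_square field_simps)
  then show ?thesis
    unfolding defect_rate_def A_def b_def w_def q_def e'_def z_def q'_def A'_def b'_def p_def .
qed

text \<open>
  Twice the Hamilton-Jacobi equation minus \<open>\<delta>\<close> times its derivative in \<open>\<delta>\<close>. This combination is the
  derivative in \<open>J\<close> of the equation before the division by \<open>J\<^sup>2\<close>, which governs the rate of the new
  phase.
\<close>
lemma HJ_eps:
  "(stiffness d \<tau> * ratio \<delta> \<theta> \<tau> - \<delta> * strain d \<tau> * \<theta>) * (ratio \<delta> \<theta> \<tau> - \<delta> * D_ang (D_eps \<sigma>) \<delta> \<theta> \<tau>)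
     + \<delta> * (D_slow \<sigma> \<delta> \<theta> \<tau> - \<delta> * D_slow (D_eps \<sigma>) \<delta> \<theta> \<tau>)
   = stiffness d \<tau> + 2 * e \<delta> \<theta> \<tau> - \<delta> * D_eps e \<delta> \<theta> \<tau>
     + \<delta> ^ n * ((2 - real n) * R \<delta> \<theta> \<tau> - \<delta> * D_eps R \<delta> \<theta> \<tau>)"
proof -
  define A b w q e' r ed p qd rd where "A = stiffness d \<tau>" and "b = strain d \<tau>" and "w = ratio \<delta> \<theta> \<tau>"
    and "q = D_slow \<sigma> \<delta> \<theta> \<tau>" and "e' = e \<delta> \<theta> \<tau>" and "r = R \<delta> \<theta> \<tau>" and "ed = D_eps e \<delta> \<theta> \<tau>"
    and "p = D_ang (D_eps \<sigma>) \<delta> \<theta> \<tau>" and "qd = D_slow (D_eps \<sigma>) \<delta> \<theta> \<tau>" and "rd = D_eps R \<delta> \<theta> \<tau>"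
  have 1: "A / 2 * w^2 - \<delta> * b * \<theta> * w + \<delta> * q = A / 2 + e' + \<delta> ^ n * r"
    using HJ_eq by (simp add: A_def b_def w_def q_def e'_def r_def)
  have 2: "A * w * p - b * \<theta> * w - \<delta> * b * \<theta> * p + q + \<delta> * qd = ed + real n * \<delta> ^ (n - 1) * r + \<delta> ^ n * rd"
  proof (rule DERIV_unique)
    show "((\<lambda>\<delta>. stiffness d \<tau> / 2 * (ratio \<delta> \<theta> \<tau>)^2 - \<delta> * strain d \<tau> * \<theta> * ratio \<delta> \<theta> \<tau>
      + \<delta> * D_slow \<sigma> \<delta> \<theta> \<tau>) has_real_derivative
      A * w * p - b * \<theta> * w - \<delta> * b * \<theta> * p + q + \<delta> * qd) (at \<delta>)"
      unfolding A_def b_def w_def q_def p_def qd_def D_eps_slow[OF \<sigma>, symmetric]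
      by (auto intro!: derivative_eq_intros ratio_eps D_eps[OF D_slow_in[OF \<sigma>]]
          simp: power2_eq_square algebra_simps)
    show "((\<lambda>\<delta>. stiffness d \<tau> / 2 * (ratio \<delta> \<theta> \<tau>)^2 - \<delta> * strain d \<tau> * \<theta> * ratio \<delta> \<theta> \<tau>
      + \<delta> * D_slow \<sigma> \<delta> \<theta> \<tau>) has_real_derivative ed + real n * \<delta> ^ (n - 1) * r + \<delta> ^ n * rd) (at \<delta>)"
      unfolding HJ_eq ed_def r_def rd_def
      by (auto intro!: derivative_eq_intros D_eps[OF e] D_eps[OF R])
  qed
  have nn: "\<delta> * (real n * \<delta> ^ (n - 1)) = real n * \<delta> ^ n" by (cases n) auto
  have "(A * w - \<delta> * b * \<theta>) * (w - \<delta> * p) + \<delta> * (q - \<delta> * qd)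
    = 2 * (A / 2 * w^2 - \<delta> * b * \<theta> * w + \<delta> * q) - \<delta> * (A * w * p - b * \<theta> * w - \<delta> * b * \<theta> * p + q + \<delta> * qd)"
    by (simp add: power2_eq_square algebra_simps)
  also have "\<dots> = 2 * (A / 2 + e' + \<delta> ^ n * r) - (\<delta> * ed + \<delta> * (real n * \<delta> ^ (n - 1)) * r + \<delta> * \<delta> ^ n * rd)"
    unfolding 1 2 by (simp add: algebra_simps)
  also have "\<dots> = A + 2 * e' - \<delta> * ed + \<delta> ^ n * ((2 - real n) * r - \<delta> * rd)"
    unfolding nn by (simp add: algebra_simps)
  finally show ?thesis unfolding A_def b_def w_def q_def p_def qd_def e'_def r_def ed_def rd_def .
qed

lemma D_ang_zero_eps: "D_ang \<sigma> 0 \<theta> \<tau> = 0"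
  using D_ang[OF \<sigma>, of 0 \<tau> \<theta>] by (simp add: \<sigma>0 D_ang_def)

text \<open>
  The second factor of the defect in \<open>defect_factor\<close> is bounded away from zero, so that the defect and
  the error \<open>y - ratio\<close> control each other. The bound on the rate is needed for small defects only,
  which keep \<open>y\<close> in a bounded set.
\<close>
lemma defect_estimates:
  obtains K \<delta>\<^sub>0 where "K \<ge> 1" "0 < \<delta>\<^sub>0" "\<delta>\<^sub>0 \<le> 1"
    "\<And>\<delta> \<theta> \<tau>. 0 < \<delta> \<Longrightarrow> \<delta> \<le> \<delta>\<^sub>0 \<Longrightarrow> \<bar>\<theta>\<bar> \<le> pi \<Longrightarrow> \<tau> \<in> M \<Longrightarrow> \<bar>ratio \<delta> \<theta> \<tau> - 1\<bar> \<le> 1 / 2"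
    "\<And>y \<delta> \<theta> \<tau>. 0 < \<delta> \<Longrightarrow> \<delta> \<le> \<delta>\<^sub>0 \<Longrightarrow> \<bar>\<theta>\<bar> \<le> pi \<Longrightarrow> \<tau> \<in> M \<Longrightarrow> 0 \<le> y \<Longrightarrow>
       \<bar>y - ratio \<delta> \<theta> \<tau>\<bar> \<le> K * (\<bar>defect y \<delta> \<theta> \<tau>\<bar> + \<delta> ^ n)"
    "\<And>y \<delta> \<theta> \<tau>. 0 < \<delta> \<Longrightarrow> \<delta> \<le> \<delta>\<^sub>0 \<Longrightarrow> \<bar>\<theta>\<bar> \<le> pi \<Longrightarrow> \<tau> \<in> M \<Longrightarrow> 0 \<le> y \<Longrightarrow> \<bar>defect y \<delta> \<theta> \<tau>\<bar> \<le> 1 \<Longrightarrow>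
       \<bar>defect_rate y \<delta> \<theta> \<tau>\<bar> \<le> K * (\<bar>defect y \<delta> \<theta> \<tau>\<bar> + \<delta> ^ n)"
    "\<And>y \<delta> \<theta> \<tau>. 0 < \<delta> \<Longrightarrow> \<delta> \<le> \<delta>\<^sub>0 \<Longrightarrow> \<bar>\<theta>\<bar> \<le> pi \<Longrightarrow> \<tau> \<in> M \<Longrightarrow> 0 \<le> y \<Longrightarrow> \<bar>y - ratio \<delta> \<theta> \<tau>\<bar> \<le> 1 \<Longrightarrow>
       \<bar>defect y \<delta> \<theta> \<tau>\<bar> \<le> K * (\<bar>y - ratio \<delta> \<theta> \<tau>\<bar> + \<delta> ^ n)"
proof -
  obtain P where P: "P \<in> phase_poly d" "\<And>\<delta> \<theta> \<tau>. D_ang \<sigma> \<delta> \<theta> \<tau> = \<delta> * P \<delta> \<theta> \<tau>"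
    using phase_poly_split[OF D_ang_in[OF \<sigma>]] D_ang_zero_eps by auto
  note b'_in = phase_poly_coeff[OF coeff_deriv_in(1)[OF strain_coeff]]
  obtain CP where CP: "CP > 0"
    "\<And>\<delta> \<theta> \<tau>. 0 \<le> \<delta> \<Longrightarrow> \<delta> \<le> 1 \<Longrightarrow> \<bar>\<theta>\<bar> \<le> pi \<Longrightarrow> \<tau> \<in> M \<Longrightarrow> \<bar>P \<delta> \<theta> \<tau>\<bar> \<le> CP"
    using that by (rule phase_poly_bounded[OF P(1)])
  obtain CR where CR: "CR > 0"
    "\<And>\<delta> \<theta> \<tau>. 0 \<le> \<delta> \<Longrightarrow> \<delta> \<le> 1 \<Longrightarrow> \<bar>\<theta>\<bar> \<le> pi \<Longrightarrow> \<tau> \<in> M \<Longrightarrow> \<bar>R \<delta> \<theta> \<tau>\<bar> \<le> CR"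
    using that by (rule phase_poly_bounded[OF R])
  obtain CR' where CR': "CR' > 0"
    "\<And>\<delta> \<theta> \<tau>. 0 \<le> \<delta> \<Longrightarrow> \<delta> \<le> 1 \<Longrightarrow> \<bar>\<theta>\<bar> \<le> pi \<Longrightarrow> \<tau> \<in> M \<Longrightarrow> \<bar>D_slow R \<delta> \<theta> \<tau>\<bar> \<le> CR'"
    using that by (rule phase_poly_bounded[OF D_slow_in[OF R]])
  obtain CA where CA: "CA > 0" "\<And>\<tau>. \<tau> \<in> M \<Longrightarrow> \<bar>stiffness d \<tau>\<bar> \<le> CA"
    using that by (rule coeff_alg_bound[OF stiffness_coeff])
  obtain CA' where CA': "CA' > 0" "\<And>\<tau>. \<tau> \<in> M \<Longrightarrow> \<bar>deriv (stiffness d) \<tau>\<bar> \<le> CA'"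
    using that by (rule coeff_alg_bound[OF coeff_deriv_in(1)[OF stiffness_coeff]])
  obtain Cb where Cb: "Cb > 0" "\<And>\<theta> \<tau>. \<bar>\<theta>\<bar> \<le> pi \<Longrightarrow> \<tau> \<in> M \<Longrightarrow> \<bar>strain d \<tau> * \<theta>\<bar> \<le> Cb"
    using that by (rule phase_poly_bounded_indep[OF phase_poly_mult[OF strain_in phase_poly_ang]])
  obtain Cb' where Cb': "Cb' > 0" "\<And>\<theta> \<tau>. \<bar>\<theta>\<bar> \<le> pi \<Longrightarrow> \<tau> \<in> M \<Longrightarrow> \<bar>deriv (strain d) \<tau> * \<theta>\<bar> \<le> Cb'"
    using that by (rule phase_poly_bounded_indep[OF phase_poly_mult[OF b'_in phase_poly_ang]])
  obtain C\<sigma> where C\<sigma>: "C\<sigma> > 0"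
    "\<And>\<delta> \<theta> \<tau>. 0 \<le> \<delta> \<Longrightarrow> \<delta> \<le> 1 \<Longrightarrow> \<bar>\<theta>\<bar> \<le> pi \<Longrightarrow> \<tau> \<in> M \<Longrightarrow> \<bar>stiffness d \<tau> * D_ang (D_slow \<sigma>) \<delta> \<theta> \<tau>\<bar> \<le> C\<sigma>"
    using that by (rule phase_poly_bounded[OF phase_poly_mult[OF stiffness_in D_ang_in[OF D_slow_in[OF \<sigma>]]]])
  obtain A\<^sub>0 where A\<^sub>0: "A\<^sub>0 > 0" "\<And>\<tau>. \<tau> \<in> M \<Longrightarrow> A\<^sub>0 \<le> stiffness d \<tau>" using stiffness_lower by blast
  define \<delta>\<^sub>0 where "\<delta>\<^sub>0 = min 1 (min (1 / (2 * CP)) (A\<^sub>0 / (8 * Cb)))"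
  have \<delta>\<^sub>0: "0 < \<delta>\<^sub>0" "\<delta>\<^sub>0 \<le> 1" using CP Cb A\<^sub>0 by (auto simp: \<delta>\<^sub>0_def)
  have \<delta>P: "\<delta> * CP \<le> 1 / 2" and \<delta>b: "\<delta> * Cb \<le> A\<^sub>0 / 8" if "\<delta> \<le> \<delta>\<^sub>0" for \<delta>
  proof -
    have "\<delta> \<le> 1 / (2 * CP)" "\<delta> \<le> A\<^sub>0 / (8 * Cb)" using that by (auto simp: \<delta>\<^sub>0_def)
    then show "\<delta> * CP \<le> 1 / 2" "\<delta> * Cb \<le> A\<^sub>0 / 8" using CP Cb by (simp_all add: field_simps)
  qed
  define K\<^sub>1 where "K\<^sub>1 = 8 / A\<^sub>0 * (1 + CR)"
  define F\<^sub>1 where "F\<^sub>1 = CA' / 2 * (3 + 2 * K\<^sub>1) + Cb' + C\<sigma>"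
  define F\<^sub>2 where "F\<^sub>2 = CA / 2 * 4 + Cb"
  define K where "K = 1 + K\<^sub>1 + (K\<^sub>1 * F\<^sub>1 + CR') + (F\<^sub>2 + CR)"
  have pos: "K\<^sub>1 > 0" "F\<^sub>1 > 0" "F\<^sub>2 > 0"
    using A\<^sub>0 CR CA' Cb' C\<sigma> CA Cb by (auto simp: K\<^sub>1_def F\<^sub>1_def F\<^sub>2_def intro!: add_pos_pos mult_pos_pos)
  have K: "1 \<le> K" "K\<^sub>1 \<le> K" "K\<^sub>1 * F\<^sub>1 + CR' \<le> K" "F\<^sub>2 + CR \<le> K"
    using pos CR CR' mult_pos_pos[OF pos(1,2)] by (auto simp: K_def)
  have ratio: "\<bar>ratio \<delta> \<theta> \<tau> - 1\<bar> \<le> 1 / 2"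
    if "0 < \<delta>" "\<delta> \<le> \<delta>\<^sub>0" "\<bar>\<theta>\<bar> \<le> pi" "\<tau> \<in> M" for \<delta> \<theta> \<tau>
  proof -
    have "\<bar>ratio \<delta> \<theta> \<tau> - 1\<bar> = \<delta> * \<bar>P \<delta> \<theta> \<tau>\<bar>" using that by (simp add: ratio_def P(2) abs_mult)
    also have "\<dots> \<le> \<delta> * CP" using CP(2)[of \<delta> \<theta> \<tau>] that \<delta>\<^sub>0 by (intro mult_left_mono) auto
    finally show ?thesis using \<delta>P[OF that(2)] by linarith
  qed
  have y1: "\<bar>y - ratio \<delta> \<theta> \<tau>\<bar> \<le> K\<^sub>1 * (\<bar>defect y \<delta> \<theta> \<tau>\<bar> + \<delta> ^ n)"
    if a: "0 < \<delta>" "\<delta> \<le> \<delta>\<^sub>0" "\<bar>\<theta>\<bar> \<le> pi" "\<tau> \<in> M" "0 \<le> y" for y \<delta> \<theta> \<tau>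
  proof -
    define w where "w = ratio \<delta> \<theta> \<tau>"
    define F where "F = stiffness d \<tau> / 2 * (y + w) - \<delta> * strain d \<tau> * \<theta>"
    have \<delta>1: "0 \<le> \<delta>" "\<delta> \<le> 1" using a \<delta>\<^sub>0 by auto
    have w: "1 / 2 \<le> y + w" using ratio[OF a(1-4)] a(5) unfolding w_def by linarith
    have "A\<^sub>0 / 2 * (1 / 2) \<le> stiffness d \<tau> / 2 * (y + w)"
      using w A\<^sub>0 A\<^sub>0(2)[OF a(4)] by (intro mult_mono) auto
    moreover have "\<bar>\<delta> * strain d \<tau> * \<theta>\<bar> \<le> A\<^sub>0 / 8"
    proof -
      have "\<bar>\<delta> * strain d \<tau> * \<theta>\<bar> = \<delta> * \<bar>strain d \<tau> * \<theta>\<bar>" using a by (simp add: abs_mult)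
      also have "\<dots> \<le> \<delta> * Cb" using Cb(2)[OF a(3,4)] \<delta>1 by (intro mult_left_mono)
      finally show ?thesis using \<delta>b[OF a(2)] by linarith
    qed
    ultimately have F: "A\<^sub>0 / 8 \<le> F" unfolding F_def by linarith
    have "(y - w) * F = defect y \<delta> \<theta> \<tau> - \<delta> ^ n * R \<delta> \<theta> \<tau>"
      using defect_factor[of y \<delta> \<theta> \<tau>] by (simp add: F_def w_def)
    then have "\<bar>y - w\<bar> * \<bar>F\<bar> \<le> \<bar>defect y \<delta> \<theta> \<tau>\<bar> + \<bar>\<delta> ^ n * R \<delta> \<theta> \<tau>\<bar>"
      unfolding abs_mult[symmetric] by linarith
    moreover have "\<bar>\<delta> ^ n * R \<delta> \<theta> \<tau>\<bar> \<le> \<delta> ^ n * CR"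
      using CR(2)[OF \<delta>1 a(3,4)] a by (simp add: abs_mult mult_left_mono)
    moreover have "\<bar>y - w\<bar> * (A\<^sub>0 / 8) \<le> \<bar>y - w\<bar> * \<bar>F\<bar>" using F by (intro mult_left_mono) auto
    ultimately have "\<bar>y - w\<bar> * (A\<^sub>0 / 8) \<le> \<bar>defect y \<delta> \<theta> \<tau>\<bar> + \<delta> ^ n * CR" by linarith
    also have "\<dots> \<le> (1 + CR) * (\<bar>defect y \<delta> \<theta> \<tau>\<bar> + \<delta> ^ n)"
      using CR a by (simp add: algebra_simps)
    finally show ?thesis using A\<^sub>0 by (simp add: K\<^sub>1_def w_def field_simps)
  qed
  show ?thesis
  proof (rule that[OF K(1) \<delta>\<^sub>0 ratio])
    fix y \<delta> \<theta> \<tau> :: real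
    assume a: "0 < \<delta>" "\<delta> \<le> \<delta>\<^sub>0" "\<bar>\<theta>\<bar> \<le> pi" "\<tau> \<in> M" "0 \<le> y"
    then have \<delta>1: "0 \<le> \<delta>" "\<delta> \<le> 1" "0 \<le> \<delta> ^ n" "\<delta> ^ n \<le> 1" using \<delta>\<^sub>0 by (auto intro: power_le_one)
    define w where "w = ratio \<delta> \<theta> \<tau>"
    have w: "1 / 2 \<le> w" "w \<le> 3 / 2" using ratio[OF a(1-4)] unfolding w_def by linarith+
    show "\<bar>y - ratio \<delta> \<theta> \<tau>\<bar> \<le> K * (\<bar>defect y \<delta> \<theta> \<tau>\<bar> + \<delta> ^ n)"
      using y1[OF a] mult_right_mono[OF K(2), of "\<bar>defect y \<delta> \<theta> \<tau>\<bar> + \<delta> ^ n"] \<delta>1 by linarith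
    show "\<bar>defect_rate y \<delta> \<theta> \<tau>\<bar> \<le> K * (\<bar>defect y \<delta> \<theta> \<tau>\<bar> + \<delta> ^ n)" if small: "\<bar>defect y \<delta> \<theta> \<tau>\<bar> \<le> 1"
    proof -
      define s where "s = \<bar>defect y \<delta> \<theta> \<tau>\<bar> + \<delta> ^ n"
      have s: "0 \<le> s" "s \<le> 2" "\<delta> ^ n \<le> s" using small \<delta>1 by (auto simp: s_def)
      have yw: "\<bar>y - w\<bar> \<le> K\<^sub>1 * s" using y1[OF a] by (simp add: w_def s_def)
      have "K\<^sub>1 * s \<le> K\<^sub>1 * 2" using s pos by (intro mult_left_mono) auto
      then have yw': "y + w \<le> 3 + 2 * K\<^sub>1" using yw w by linarith
      define F where "F = deriv (stiffness d) \<tau> / 2 * (y + w) - \<delta> * deriv (strain d) \<tau> * \<theta>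
        + stiffness d \<tau> * D_ang (D_slow \<sigma>) \<delta> \<theta> \<tau>"
      have 1: "\<bar>deriv (stiffness d) \<tau> / 2 * (y + w)\<bar> \<le> CA' / 2 * (3 + 2 * K\<^sub>1)"
        unfolding abs_mult using CA'(2)[OF a(4)] yw' w a(5) by (intro mult_mono') auto
      have "\<bar>\<delta> * (deriv (strain d) \<tau> * \<theta>)\<bar> \<le> 1 * Cb'"
        unfolding abs_mult[of \<delta>] using Cb'(2)[OF a(3,4)] \<delta>1 by (intro mult_mono') auto
      then have "\<bar>F\<bar> \<le> F\<^sub>1"
        using 1 C\<sigma>(2)[OF \<delta>1(1,2) a(3,4)] unfolding F_def F\<^sub>1_def mult.assoc[symmetric] by linarith
      then have "\<bar>(y - w) * F\<bar> \<le> (K\<^sub>1 * s) * F\<^sub>1" unfolding abs_mult using yw by (intro mult_mono') auto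
      moreover have "\<bar>\<delta> ^ n * D_slow R \<delta> \<theta> \<tau>\<bar> \<le> s * CR'"
        unfolding abs_mult using CR'(2)[OF \<delta>1(1,2) a(3,4)] s \<delta>1 by (intro mult_mono') auto
      ultimately have "\<bar>defect_rate y \<delta> \<theta> \<tau>\<bar> \<le> (K\<^sub>1 * s) * F\<^sub>1 + s * CR'"
        unfolding defect_rate_factor w_def[symmetric] F_def by linarith
      also have "\<dots> = (K\<^sub>1 * F\<^sub>1 + CR') * s" by (simp add: algebra_simps)
      also have "\<dots> \<le> K * s" using K s by (intro mult_right_mono) auto
      finally show ?thesis by (simp add: s_def)
    qed
    show "\<bar>defect y \<delta> \<theta> \<tau>\<bar> \<le> K * (\<bar>y - ratio \<delta> \<theta> \<tau>\<bar> + \<delta> ^ n)" if "\<bar>y - ratio \<delta> \<theta> \<tau>\<bar> \<le> 1"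
    proof -
      define F where "F = stiffness d \<tau> / 2 * (y + w) - \<delta> * strain d \<tau> * \<theta>"
      have "y + w \<le> 4" using that w unfolding w_def[symmetric] by linarith
      then have 1: "\<bar>stiffness d \<tau> / 2 * (y + w)\<bar> \<le> CA / 2 * 4"
        unfolding abs_mult using CA(2)[OF a(4)] w a(5) by (intro mult_mono') auto
      have "\<bar>\<delta> * (strain d \<tau> * \<theta>)\<bar> \<le> 1 * Cb"
        unfolding abs_mult[of \<delta>] using Cb(2)[OF a(3,4)] \<delta>1 by (intro mult_mono') auto
      then have "\<bar>F\<bar> \<le> F\<^sub>2" using 1 unfolding F_def F\<^sub>2_def mult.assoc[symmetric] by linarith
      then have "\<bar>(y - w) * F\<bar> \<le> \<bar>y - w\<bar> * F\<^sub>2" unfolding abs_mult by (intro mult_left_mono) auto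
      moreover have "\<bar>\<delta> ^ n * R \<delta> \<theta> \<tau>\<bar> \<le> \<delta> ^ n * CR"
        using CR(2)[OF \<delta>1(1,2) a(3,4)] a by (simp add: abs_mult mult_left_mono)
      ultimately have "\<bar>defect y \<delta> \<theta> \<tau>\<bar> \<le> \<bar>y - w\<bar> * F\<^sub>2 + \<delta> ^ n * CR"
        unfolding defect_factor w_def[symmetric] F_def by linarith
      also have "\<dots> \<le> (F\<^sub>2 + CR) * (\<bar>y - w\<bar> + \<delta> ^ n)"
        using pos CR \<delta>1 by (simp add: algebra_simps)
      also have "\<dots> \<le> K * (\<bar>y - w\<bar> + \<delta> ^ n)" using K \<delta>1 by (intro mult_right_mono) auto
      finally show ?thesis by (simp add: w_def)
    qed
  qed
qed

end

section \<open>Continuity through impacts\<close>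

lemma exceptional_mvt_bound:
  fixes f :: "real \<Rightarrow> real"
  assumes "a \<le> b" "continuous_on {a..b} f" "finite X" "0 \<le> B"
    and "\<And>t. t \<in> {a<..<b} - X \<Longrightarrow> \<exists>f'. (f has_real_derivative f') (at t) \<and> \<bar>f'\<bar> \<le> B"
  shows "\<bar>f b - f a\<bar> \<le> B * (b - a)"
proof -
  define g where "g = (\<lambda>t. if t \<in> {a<..<b} - X then deriv f t else 0)"
  have g: "(f has_real_derivative g t) (at t)" "\<bar>g t\<bar> \<le> B" if "t \<in> {a<..<b} - X" for t
    using assms(5)[OF that] that DERIV_imp_deriv by (force simp: g_def)+
  have "(g has_integral (f b - f a)) {a..b}"
    by (rule fundamental_theorem_of_calculus_interior_strong[OF assms(3,1) _ assms(2)])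
      (use g(1) in \<open>simp flip: has_real_derivative_iff_has_vector_derivative\<close>)
  moreover have "norm (g t) \<le> B" if "t \<in> {a..b}" for t
    using g(2)[of t] assms(4) by (cases "t \<in> {a<..<b} - X") (auto simp: g_def)
  ultimately have "norm (f b - f a) \<le> B * measure lborel {a..b}"
    by (intro has_integral_bound_real[OF assms(4) finite.emptyI]) auto
  then show ?thesis using assms(1) by simp
qed

text \<open>
  A substitute for Gronwall's inequality on a short interval. The bound on the derivative is available
  only while \<open>f\<close> is small; at the first time when \<open>f\<close> would reach twice its initial bound the mean value
  theorem gives a contradiction.
\<close>
lemma small_over_short_window:
  fixes f :: "real \<Rightarrow> real"
  assumes cont: "continuous_on {a..b} f" and X: "finite X"
    and deriv: "\<And>t. t \<in> {a<..<b} - X \<Longrightarrow> \<bar>f t\<bar> \<le> 1 \<Longrightarrow>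
      \<exists>f'. (f has_real_derivative f') (at t) \<and> \<bar>f'\<bar> \<le> \<kappa> * (\<bar>f t\<bar> + \<eta>)"
    and fa: "\<bar>f a\<bar> \<le> \<eta>" and \<eta>: "0 < \<eta>" "\<eta> \<le> 1 / 2" and \<kappa>: "0 \<le> \<kappa>" "\<kappa> * (b - a) \<le> 1 / 4"
    and t: "t \<in> {a..b}"
  shows "\<bar>f t\<bar> \<le> 2 * \<eta>"
proof (rule ccontr)
  assume contra: "\<not> \<bar>f t\<bar> \<le> 2 * \<eta>"
  define S where "S = {s \<in> {a..b}. 2 * \<eta> \<le> \<bar>f s\<bar>}"
  have "compact S" unfolding S_def compact_eq_bounded_closed
  proof
    show "bounded {s \<in> {a..b}. 2 * \<eta> \<le> \<bar>f s\<bar>}" by (rule bounded_subset[OF bounded_closed_interval]) auto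
    have "closed ({a..b} \<inter> (\<lambda>s. \<bar>f s\<bar>) -` {2 * \<eta>..})"
      by (rule continuous_closed_preimage) (auto intro!: continuous_intros cont)
    also have "{a..b} \<inter> (\<lambda>s. \<bar>f s\<bar>) -` {2 * \<eta>..} = {s \<in> {a..b}. 2 * \<eta> \<le> \<bar>f s\<bar>}" by auto
    finally show "closed {s \<in> {a..b}. 2 * \<eta> \<le> \<bar>f s\<bar>}" .
  qed
  moreover have "S \<noteq> {}" using t contra by (auto simp: S_def)
  ultimately have "\<exists>s\<in>S. \<forall>t\<in>S. s \<le> t" by (rule compact_attains_inf)
  then obtain c where c: "c \<in> S" "\<And>s. s \<in> S \<Longrightarrow> c \<le> s" by blast
  have cb: "a \<le> c" "c \<le> b" "2 * \<eta> \<le> \<bar>f c\<bar>" using c by (auto simp: S_def)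
  have below: "\<bar>f s\<bar> < 2 * \<eta>" if "a \<le> s" "s < c" for s
    using c(2)[of s] that cb by (force simp: S_def)
  have "\<bar>f c - f a\<bar> \<le> (\<kappa> * (3 * \<eta>)) * (c - a)"
  proof (rule exceptional_mvt_bound[OF cb(1) continuous_on_subset[OF cont] X])
    fix s assume s: "s \<in> {a<..<c} - X"
    then have fs: "\<bar>f s\<bar> < 2 * \<eta>" using below[of s] by auto
    then obtain f' where f': "(f has_real_derivative f') (at s)" "\<bar>f'\<bar> \<le> \<kappa> * (\<bar>f s\<bar> + \<eta>)"
      using deriv[of s] s cb \<eta> by force
    have "\<kappa> * (\<bar>f s\<bar> + \<eta>) \<le> \<kappa> * (3 * \<eta>)" using fs \<kappa> by (intro mult_left_mono) auto
    then show "\<exists>f'. (f has_real_derivative f') (at s) \<and> \<bar>f'\<bar> \<le> \<kappa> * (3 * \<eta>)" using f' by force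
  qed (use cb \<kappa> \<eta> in auto)
  also have "\<dots> \<le> (\<kappa> * (3 * \<eta>)) * (b - a)" using cb \<kappa> \<eta> by (intro mult_left_mono) auto
  also have "\<dots> = (\<kappa> * (b - a)) * (3 * \<eta>)" by simp
  also have "\<dots> \<le> 1 / 4 * (3 * \<eta>)" using \<kappa> \<eta> by (intro mult_right_mono) auto
  finally have "\<bar>f c - f a\<bar> \<le> 3 / 4 * \<eta>" by simp
  then show False using fa cb(3) \<eta> by argo
qed

text \<open>
  The angle modulo \<open>2\<pi>\<close>, taken in \<open>[-\<pi>, \<pi>]\<close>. At the fixed wall both signs of the velocity give zero; at
  the moving wall they give the two end points. A particle at rest counts as moving to the left, as in
  \<open>angle_of\<close>.
\<close>
definition signed_angle :: "(real \<Rightarrow> real) \<Rightarrow> real \<Rightarrow> real \<Rightarrow> real \<Rightarrow> real \<Rightarrow> real" where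
  "signed_angle d \<epsilon> w x t = (if w > 0 then pi * x / d (\<epsilon> * t) else - (pi * x / d (\<epsilon> * t)))"

definition reflected :: "(real \<Rightarrow> real) \<Rightarrow> real \<Rightarrow> real \<Rightarrow> real \<Rightarrow> real \<Rightarrow> real" where
  "reflected d \<epsilon> x t u = (if x = 0 then - u else 2 * (\<epsilon> * deriv d (\<epsilon> * t)) - u)"

locale fermi_ulam = moving_wall +
  fixes \<epsilon> T :: real and x v :: "real \<Rightarrow> real"
  assumes \<epsilon>_pos: "\<epsilon> > 0" and motion: "fermi_ulam_motion d \<epsilon> T x v"
begin

abbreviation impacts :: "real set" where "impacts \<equiv> impact_times d \<epsilon> T x"

lemma x_cont: "continuous_on {0..T} x"
  and x_bounds: "t \<in> {0..T} \<Longrightarrow> 0 \<le> x t \<and> x t \<le> d (\<epsilon> * t)"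
  and finite_impacts: "finite impacts"
  and free: "t \<in> {0..T} - impacts \<Longrightarrow> (x has_real_derivative v t) (at t within {0..T}) \<and>
        (v has_real_derivative 0) (at t within {0..T})"
  and right_cont: "t \<in> impacts \<Longrightarrow> t < T \<Longrightarrow> (v \<longlongrightarrow> v t) (at_right t)"
  and law: "t \<in> impacts \<Longrightarrow> 0 < t \<Longrightarrow> \<exists>u. (v \<longlongrightarrow> u) (at_left t) \<and> v t = reflected d \<epsilon> (x t) t u"
  using motion unfolding fermi_ulam_motion_def reflected_def by blast+

lemma impacts_isolated: obtains r where "r > 0" "\<And>s. s \<in> impacts \<Longrightarrow> s \<noteq> t \<Longrightarrow> r \<le> \<bar>s - t\<bar>"
proof -
  have "finite (impacts - {t})" using finite_impacts by simp
  then obtain r where "r > 0" "\<forall>s\<in>impacts - {t}. s \<noteq> t \<longrightarrow> r \<le> dist t s"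
    using finite_set_avoid by blast
  then show ?thesis by (intro that[of r]) (auto simp: dist_real_def abs_minus_commute)
qed

lemma free_interior:
  assumes "0 < t" "t < T" "t \<notin> impacts"
  shows "(x has_real_derivative v t) (at t)" "(v has_real_derivative 0) (at t)"
proof -
  have "at t within {0..T} = at t" by (rule at_within_interior) (use assms in auto)
  then show "(x has_real_derivative v t) (at t)" "(v has_real_derivative 0) (at t)"
    using free[of t] assms by auto
qed

lemma const_between:
  assumes "0 \<le> a" "b \<le> T" "{a<..<b} \<inter> impacts = {}"
  obtains c where "\<And>s. s \<in> {a<..<b} \<Longrightarrow> v s = c"
proof -
  have "\<exists>c. \<forall>s\<in>{a<..<b}. v s = c"
  proof (rule has_field_derivative_zero_constant)
    fix s assume s: "s \<in> {a<..<b}"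
    then have "s \<notin> impacts" using assms(3) by blast
    then show "(v has_real_derivative 0) (at s within {a<..<b})"
      using free_interior(2)[of s] s assms by (auto intro: has_field_derivative_at_within)
  qed simp
  then show ?thesis using that by blast
qed

lemma v_right:
  assumes t: "0 \<le> t" "t < T"
  obtains r where "r > 0" "t + r \<le> T" "\<And>s. t \<le> s \<Longrightarrow> s < t + r \<Longrightarrow> v s = v t"
    "\<And>s. t < s \<Longrightarrow> s < t + r \<Longrightarrow> s \<notin> impacts"
proof -
  obtain r\<^sub>0 where r\<^sub>0: "r\<^sub>0 > 0" "\<And>s. s \<in> impacts \<Longrightarrow> s \<noteq> t \<Longrightarrow> r\<^sub>0 \<le> \<bar>s - t\<bar>"
    using that by (rule impacts_isolated)
  define r where "r = min r\<^sub>0 (T - t)"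
  have r: "r > 0" "t + r \<le> T" using r\<^sub>0 t by (auto simp: r_def)
  have no: "s \<notin> impacts" if "t < s" "s < t + r" for s
    using r\<^sub>0(2)[of s] that by (auto simp: r_def)
  then have disj: "{t<..<t + r} \<inter> impacts = {}" by auto
  obtain c where c: "\<And>s. s \<in> {t<..<t + r} \<Longrightarrow> v s = c"
    using that by (rule const_between[OF t(1) r(2) disj])
  have "(v \<longlongrightarrow> v t) (at_right t)"
  proof (cases "t \<in> impacts")
    case True
    then show ?thesis using right_cont t by blast
  next
    case False
    then have "(v \<longlongrightarrow> v t) (at t within {0..T})"
      using free[of t] t DERIV_continuous by (auto simp: continuous_within)
    then have "(v \<longlongrightarrow> v t) (at t within {t..T})"
      by (rule tendsto_within_subset) (use t in auto)
    then show ?thesis by (simp add: at_within_Icc_at_right t)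
  qed
  moreover have "(v \<longlongrightarrow> c) (at_right t)"
  proof (rule Lim_transform_eventually[OF tendsto_const])
    show "\<forall>\<^sub>F s in at_right t. c = v s"
      using eventually_at_right_real[of t "t + r"] r by (auto elim!: eventually_mono simp: c)
  qed
  ultimately have "v t = c" using tendsto_unique trivial_limit_at_right_real by blast
  then have "v s = v t" if "t \<le> s" "s < t + r" for s using c[of s] that by (cases "s = t") auto
  then show ?thesis using that r no by blast
qed

lemma v_left:
  assumes t: "0 < t" "t \<le> T"
  obtains r u where "r > 0" "r \<le> t" "\<And>s. t - r < s \<Longrightarrow> s < t \<Longrightarrow> v s = u"
    "\<And>s. t - r < s \<Longrightarrow> s < t \<Longrightarrow> s \<notin> impacts"
    "t \<in> impacts \<Longrightarrow> v t = reflected d \<epsilon> (x t) t u" "t \<notin> impacts \<Longrightarrow> v t = u"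
proof -
  obtain r\<^sub>0 where r\<^sub>0: "r\<^sub>0 > 0" "\<And>s. s \<in> impacts \<Longrightarrow> s \<noteq> t \<Longrightarrow> r\<^sub>0 \<le> \<bar>s - t\<bar>"
    using that by (rule impacts_isolated)
  define r where "r = min r\<^sub>0 t"
  have r: "r > 0" "r \<le> t" using r\<^sub>0 t by (auto simp: r_def)
  have no: "s \<notin> impacts" if "t - r < s" "s < t" for s
    using r\<^sub>0(2)[of s] that by (auto simp: r_def)
  then have disj: "{t - r<..<t} \<inter> impacts = {}" by auto
  have tr: "0 \<le> t - r" using r by simp
  obtain c where c: "\<And>s. s \<in> {t - r<..<t} \<Longrightarrow> v s = c"
    using that by (rule const_between[OF tr t(2) disj])
  have lim: "(v \<longlongrightarrow> c) (at_left t)"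
  proof (rule Lim_transform_eventually[OF tendsto_const])
    show "\<forall>\<^sub>F s in at_left t. c = v s"
      using eventually_at_left_real[of "t - r" t] r by (auto elim!: eventually_mono simp: c)
  qed
  have 1: "v t = reflected d \<epsilon> (x t) t c" if imp: "t \<in> impacts"
  proof -
    obtain u where u: "(v \<longlongrightarrow> u) (at_left t)" "v t = reflected d \<epsilon> (x t) t u"
      using law[OF imp] t by blast
    then have "u = c" using lim tendsto_unique trivial_limit_at_left_real by blast
    then show ?thesis using u by simp
  qed
  have 2: "v t = c" if "t \<notin> impacts"
  proof -
    have "(v \<longlongrightarrow> v t) (at t within {0..T})"
      using free[of t] t that DERIV_continuous by (auto simp: continuous_within)
    then have "(v \<longlongrightarrow> v t) (at t within {0..t})"
      by (rule tendsto_within_subset) (use t in auto)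
    then have "(v \<longlongrightarrow> v t) (at_left t)" by (simp add: at_within_Icc_at_left t)
    then show ?thesis using lim tendsto_unique trivial_limit_at_left_real by blast
  qed
  show ?thesis by (rule that[OF r _ no 1 2]) (auto intro: c)
qed

text \<open>
  Between impacts the velocity is constant and the assumption on \<open>Z\<close> for constant velocity applies from
  either side; at an impact the values on the two sides agree by the second assumption.
\<close>
lemma continuous_through_impacts:
  fixes Z :: "real \<Rightarrow> real \<Rightarrow> real"
  assumes Z: "\<And>w. continuous_on {0..T} (Z w)"
    and glue: "\<And>t u. t \<in> impacts \<Longrightarrow> 0 < t \<Longrightarrow> Z (reflected d \<epsilon> (x t) t u) t = Z u t"
  shows "continuous_on {0..T} (\<lambda>t. Z (v t) t)"
  unfolding continuous_on_def
proof
  fix t assume t: "t \<in> {0..T}"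
  have lim: "(Z w \<longlongrightarrow> Z w t) (at t within X)" if "X \<subseteq> {0..T}" for w X
    using Z[of w] t that tendsto_within_subset unfolding continuous_on_def by blast
  have L: "((\<lambda>t. Z (v t) t) \<longlongrightarrow> Z (v t) t) (at t within {0..t})"
  proof (cases "t = 0")
    case False
    then have t': "0 < t" "t \<le> T" using t by auto
    obtain r u where r: "r > 0" "r \<le> t" "\<And>s. t - r < s \<Longrightarrow> s < t \<Longrightarrow> v s = u"
    "\<And>s. t - r < s \<Longrightarrow> s < t \<Longrightarrow> s \<notin> impacts"
    "t \<in> impacts \<Longrightarrow> v t = reflected d \<epsilon> (x t) t u" "t \<notin> impacts \<Longrightarrow> v t = u"
      using that by (rule v_left[OF t'])
    have eq: "Z (v t) t = Z u t" using r(5,6) glue[of t u] t False by (cases "t \<in> impacts") auto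
    have "((\<lambda>s. Z (v s) s) \<longlongrightarrow> Z u t) (at t within {0..t})"
    proof (rule Lim_transform_within[OF lim r(1)])
      show "{0..t} \<subseteq> {0..T}" using t by auto
      show "Z u s = Z (v s) s" if "s \<in> {0..t}" "0 < dist s t" "dist s t < r" for s
        using r(3)[of s] that by (auto simp: dist_real_def)
    qed
    then show ?thesis by (simp add: eq)
  next
    case True
    then show ?thesis by (simp add: at_within_eq_bot_iff[THEN iffD2])
  qed
  have R: "((\<lambda>t. Z (v t) t) \<longlongrightarrow> Z (v t) t) (at t within {t..T})"
  proof (cases "t = T")
    case False
    then have t': "0 \<le> t" "t < T" using t by auto
    obtain r where r: "r > 0" "t + r \<le> T" "\<And>s. t \<le> s \<Longrightarrow> s < t + r \<Longrightarrow> v s = v t"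
    "\<And>s. t < s \<Longrightarrow> s < t + r \<Longrightarrow> s \<notin> impacts"
      using that by (rule v_right[OF t'])
    show ?thesis
    proof (rule Lim_transform_within[OF lim r(1)])
      show "{t..T} \<subseteq> {0..T}" using t by auto
      show "Z (v t) s = Z (v s) s" if "s \<in> {t..T}" "0 < dist s t" "dist s t < r" for s
        using r(3)[of s] that by (auto simp: dist_real_def)
    qed
  next
    case True
    then show ?thesis by (simp add: at_within_eq_bot_iff[THEN iffD2])
  qed
  have "{0..T} = {0..t} \<union> {t..T}" using t by auto
  then show "((\<lambda>t. Z (v t) t) \<longlongrightarrow> Z (v t) t) (at t within {0..T})"
    using Lim_Un[OF L R] by simp
qed

lemma x_affine_left:
  assumes "0 < t" "t \<le> T" "r > 0" "r \<le> t" "\<And>s. t - r < s \<Longrightarrow> s < t \<Longrightarrow> v s = u"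
    "\<And>s. t - r < s \<Longrightarrow> s < t \<Longrightarrow> s \<notin> impacts" "t - r < s" "s < t"
  shows "x t - x s = u * (t - s)"
proof -
  have "continuous_on {s..t} x" by (rule continuous_on_subset[OF x_cont]) (use assms in auto)
  moreover have "(x has_real_derivative u) (at z)" if "s < z" "z < t" for z
    using free_interior(1)[of z] assms(5,6)[of z] that assms by auto
  ultimately obtain l z where "s < z" "z < t" "(x has_real_derivative l) (at z)" "x t - x s = (t - s) * l"
    using MVT[OF assms(8), of x] real_differentiable_def by blast
  moreover from this have "l = u" using DERIV_unique \<open>\<And>z. s < z \<Longrightarrow> z < t \<Longrightarrow> (x has_real_derivative u) (at z)\<close> by blast
  ultimately show ?thesis by simp
qed

lemma x_affine_right:
  assumes "0 \<le> t" "r > 0" "t + r \<le> T" "\<And>s. t \<le> s \<Longrightarrow> s < t + r \<Longrightarrow> v s = v t"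
    "\<And>s. t < s \<Longrightarrow> s < t + r \<Longrightarrow> s \<notin> impacts" "t < s" "s < t + r"
  shows "x s - x t = v t * (s - t)"
proof -
  have "continuous_on {t..s} x" by (rule continuous_on_subset[OF x_cont]) (use assms in auto)
  moreover have "(x has_real_derivative v t) (at z)" if "t < z" "z < s" for z
  proof -
    have "v z = v t" by (rule assms(4)) (use that assms(7) in auto)
    moreover have "z \<notin> impacts" by (rule assms(5)) (use that assms(7) in auto)
    moreover have "0 < z" "z < T" using that assms(1,3,7) by auto
    ultimately show ?thesis using free_interior(1)[of z] by simp
  qed
  ultimately obtain l z where "t < z" "z < s" "(x has_real_derivative l) (at z)" "x s - x t = (s - t) * l"
    using MVT[OF assms(6), of x] real_differentiable_def by blast
  moreover from this have "l = v t"
    using DERIV_unique \<open>\<And>z. t < z \<Longrightarrow> z < s \<Longrightarrow> (x has_real_derivative v t) (at z)\<close> by blast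
  ultimately show ?thesis by simp
qed

definition ang :: "real \<Rightarrow> real" where "ang t = signed_angle d \<epsilon> (v t) (x t) t"

lemma ang_bounds: "t \<in> {0..T} \<Longrightarrow> \<bar>ang t\<bar> \<le> pi"
  using x_bounds[of t] d_pos[of "\<epsilon> * t"] unfolding ang_def signed_angle_def
  by (auto simp: field_simps)

lemma v_locally_const:
  assumes "0 < t" "t < T" "t \<notin> impacts"
  shows "\<forall>\<^sub>F s in nhds t. v s = v t"
proof -
  have t: "0 < t" "t \<le> T" "0 \<le> t" using assms by auto
  obtain r where r: "r > 0" "t + r \<le> T" "\<And>s. t \<le> s \<Longrightarrow> s < t + r \<Longrightarrow> v s = v t"
    "\<And>s. t < s \<Longrightarrow> s < t + r \<Longrightarrow> s \<notin> impacts"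
    using that by (rule v_right[OF t(3) assms(2)])
  obtain r' u where r': "r' > 0" "r' \<le> t" "\<And>s. t - r' < s \<Longrightarrow> s < t \<Longrightarrow> v s = u"
    "\<And>s. t - r' < s \<Longrightarrow> s < t \<Longrightarrow> s \<notin> impacts"
    "t \<in> impacts \<Longrightarrow> v t = reflected d \<epsilon> (x t) t u" "t \<notin> impacts \<Longrightarrow> v t = u"
    using that by (rule v_left[OF t(1,2)])
  have "\<forall>\<^sub>F s in nhds t. s \<in> {t - r'<..<t + r}"
    using r(1) r'(1) by (intro eventually_nhds_in_open) auto
  then show ?thesis
  proof eventually_elim
    case (elim s)
    show ?case
    proof (cases "s < t")
      case True
      then have "v s = u" using elim by (intro r'(3)) auto
      then show ?thesis using r'(6)[OF assms(3)] by simp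
    next
      case False
      then show ?thesis using elim by (intro r(3)) auto
    qed
  qed
qed

lemma slow_time_deriv: "((\<lambda>t. d (\<epsilon> * t)) has_real_derivative \<epsilon> * deriv d (\<epsilon> * t)) (at t)"
proof -
  have "((\<lambda>t. \<epsilon> * t) has_real_derivative \<epsilon>) (at t)" by (rule DERIV_cmult_Id)
  from DERIV_chain2[OF d_deriv0 this] show ?thesis unfolding mult.commute[of \<epsilon> "deriv d (\<epsilon> * t)"] .
qed

lemma ang_deriv:
  assumes "0 < t" "t < T" "t \<notin> impacts"
  shows "(ang has_real_derivative \<bar>v t\<bar> * pi / d (\<epsilon> * t) - \<epsilon> * strain d (\<epsilon> * t) * ang t) (at t)"
proof -
  define c :: real where "c = (if v t > 0 then 1 else - 1)"
  have cv: "c * v t = \<bar>v t\<bar>" by (simp add: c_def)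
  have ang: "ang t = c * (pi * x t / d (\<epsilon> * t))" by (simp add: ang_def signed_angle_def c_def)
  have nz: "d (\<epsilon> * t) \<noteq> 0" using d_pos[of "\<epsilon> * t"] by simp
  have "((\<lambda>s. c * (pi * x s / d (\<epsilon> * s))) has_real_derivative
      c * ((pi * v t * d (\<epsilon> * t) - pi * x t * (\<epsilon> * deriv d (\<epsilon> * t))) / (d (\<epsilon> * t) * d (\<epsilon> * t)))) (at t)"
    by (intro DERIV_cmult DERIV_divide slow_time_deriv free_interior(1) assms nz)
  also have "c * ((pi * v t * d (\<epsilon> * t) - pi * x t * (\<epsilon> * deriv d (\<epsilon> * t))) / (d (\<epsilon> * t) * d (\<epsilon> * t)))
     = (c * v t) * pi / d (\<epsilon> * t) - \<epsilon> * strain d (\<epsilon> * t) * ang t"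
    unfolding ang strain_def using nz by (simp add: field_simps)
  finally have D: "((\<lambda>s. c * (pi * x s / d (\<epsilon> * s))) has_real_derivative
      \<bar>v t\<bar> * pi / d (\<epsilon> * t) - \<epsilon> * strain d (\<epsilon> * t) * ang t) (at t)" unfolding cv .
  have "\<forall>\<^sub>F s in nhds t. c * (pi * x s / d (\<epsilon> * s)) = ang s"
    using v_locally_const[OF assms] by eventually_elim (simp add: ang_def signed_angle_def c_def)
  from DERIV_cong_ev[OF refl this refl] D show ?thesis by simp
qed

end

section \<open>The defect along a motion\<close>

lemma (in moving_wall) coeff_alg_continuous:
  assumes "a \<in> coeff_alg d"
  shows "continuous_on X a"
proof -
  obtain a' where "\<And>\<tau>. (a has_real_derivative a' \<tau>) (at \<tau>)"
    using coeff_alg_deriv[OF assms] by blast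
  then show ?thesis by (intro continuous_at_imp_continuous_on ballI) (rule DERIV_isCont)
qed

lemma (in moving_wall) phase_poly_continuous:
  assumes "f \<in> phase_poly d" "continuous_on X \<theta>" "continuous_on X s"
  shows "continuous_on X (\<lambda>t. f \<delta> (\<theta> t) (s t))"
  using assms(1)
proof induction
  case (monom a n m)
  have "continuous_on X (\<lambda>t. a (s t))"
    by (rule continuous_on_compose2[OF coeff_alg_continuous[OF monom, of UNIV] assms(3)]) simp
  then show ?case by (intro continuous_intros assms)
qed (auto intro: continuous_on_add)

locale averaged_motion = normal_form d c\<^sub>0 M \<sigma> e R n + fermi_ulam d c\<^sub>0 \<epsilon> T x v
  for d c\<^sub>0 M \<sigma> e R n \<epsilon> T x v +
  assumes slow: "\<And>t. t \<in> {0..T} \<Longrightarrow> \<epsilon> * t \<in> M"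
begin

definition scaled_action :: "real \<Rightarrow> real \<Rightarrow> real" where
  "scaled_action j t = \<bar>v t\<bar> * d (\<epsilon> * t) / (pi * j)"

definition residual :: "real \<Rightarrow> real \<Rightarrow> real" where
  "residual j t = defect (scaled_action j t) (\<epsilon> / j) (ang t) (\<epsilon> * t)"

lemma d_cont: "continuous_on X (\<lambda>t. d (\<epsilon> * t))"
  by (intro continuous_at_imp_continuous_on ballI DERIV_isCont[OF slow_time_deriv])

lemma slow_cont: "continuous_on X (\<lambda>t. \<epsilon> * t)"
  by (intro continuous_intros)

lemma signed_angle_cont: "continuous_on {0..T} (\<lambda>t. signed_angle d \<epsilon> w (x t) t)"
  unfolding signed_angle_def
  by (cases "w > 0") (auto intro!: continuous_intros x_cont d_cont simp: d_pos[THEN less_imp_neq, THEN not_sym])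

lemma signed_angle_reflected:
  assumes t: "t \<in> impacts" and f: "f \<in> phase_poly d" and per: "\<And>\<delta> \<tau>. f \<delta> pi \<tau> = f \<delta> (- pi) \<tau>"
  shows "f \<delta> (signed_angle d \<epsilon> w (x t) t) \<tau> = f \<delta> (signed_angle d \<epsilon> w' (x t) t) \<tau>"
proof -
  have nz: "d (\<epsilon> * t) \<noteq> 0" using d_pos[of "\<epsilon> * t"] by simp
  have "x t = 0 \<or> x t = d (\<epsilon> * t)" using t by (auto simp: impact_times_def)
  then show ?thesis using nz per by (auto simp: signed_angle_def)
qed

text \<open>
  In terms of the position \<open>X\<close> and the velocity \<open>w\<close> the Hamiltonian is \<open>w\<^sup>2 / 2\<close> minus \<open>w\<close> times the velocity of
  the uniformly stretching medium at \<open>X\<close>.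
\<close>
lemma kinetic_energy:
  assumes "j > 0"
  shows "stiffness d (\<epsilon> * t) / 2 * (\<bar>w\<bar> * d (\<epsilon> * t) / (pi * j))^2
      - \<epsilon> / j * strain d (\<epsilon> * t) * signed_angle d \<epsilon> w X t * (\<bar>w\<bar> * d (\<epsilon> * t) / (pi * j))
    = (w^2 / 2 - \<epsilon> * strain d (\<epsilon> * t) * X * w) / j^2"
proof -
  have nz: "d (\<epsilon> * t) \<noteq> 0" using d_pos[of "\<epsilon> * t"] by simp
  have 1: "stiffness d (\<epsilon> * t) / 2 * (\<bar>w\<bar> * d (\<epsilon> * t) / (pi * j))^2 = w^2 / 2 / j^2"
    using nz assms by (simp add: stiffness_def power_divide power_mult_distrib field_simps)
  have 2: "signed_angle d \<epsilon> w X t * \<bar>w\<bar> = pi * X * w / d (\<epsilon> * t)"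
    by (simp add: signed_angle_def)
  have "\<epsilon> / j * strain d (\<epsilon> * t) * signed_angle d \<epsilon> w X t * (\<bar>w\<bar> * d (\<epsilon> * t) / (pi * j))
    = \<epsilon> / j * strain d (\<epsilon> * t) * (signed_angle d \<epsilon> w X t * \<bar>w\<bar>) * (d (\<epsilon> * t) / (pi * j))" by simp
  also have "\<dots> = \<epsilon> * strain d (\<epsilon> * t) * X * w / j^2"
    unfolding 2 using nz assms by (simp add: power2_eq_square)
  finally show ?thesis unfolding 1 by (simp add: diff_divide_distrib)
qed

text \<open>
  At the moving wall the Hamiltonian is \<open>((w - c)\<^sup>2 - c\<^sup>2) / 2\<close> with the wall velocity \<open>c\<close>, and the impact maps
  \<open>w - c\<close> to its negative; at the fixed wall it is \<open>w\<^sup>2 / 2\<close>. The other terms are continuous and periodic in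
  the phase.
\<close>
lemma residual_continuous:
  assumes j: "j > 0"
  shows "continuous_on {0..T} (residual j)"
proof -
  define Z where "Z = (\<lambda>w t. defect (\<bar>w\<bar> * d (\<epsilon> * t) / (pi * j)) (\<epsilon> / j) (signed_angle d \<epsilon> w (x t) t) (\<epsilon> * t))"
  have "continuous_on {0..T} (\<lambda>t. Z (v t) t)"
  proof (rule continuous_through_impacts)
    fix w
    have c: "continuous_on {0..T} (\<lambda>t. a (\<epsilon> * t))" if "a \<in> coeff_alg d" for a
      by (rule continuous_on_compose2[OF coeff_alg_continuous[OF that, of UNIV] slow_cont]) simp
    note cs = signed_angle_cont[of w]
    have cy: "continuous_on {0..T} (\<lambda>t. \<bar>w\<bar> * d (\<epsilon> * t) / (pi * j))"
      using j by (intro continuous_on_divide continuous_on_mult continuous_on_const d_cont) auto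
    have cA: "continuous_on {0..T} (\<lambda>t. stiffness d (\<epsilon> * t) / 2)"
      by (intro continuous_on_divide c stiffness_coeff continuous_on_const) auto
    show "continuous_on {0..T} (Z w)"
      unfolding Z_def defect_def
      by (intro continuous_on_add continuous_on_diff continuous_on_mult continuous_on_power continuous_on_const
          cA cy cs c[OF strain_coeff] phase_poly_continuous[OF D_slow_in[OF \<sigma>] cs slow_cont]
          phase_poly_continuous[OF e cs slow_cont])
  next
    fix t u assume t: "t \<in> impacts" and "0 < t"
    define u' where "u' = reflected d \<epsilon> (x t) t u"
    have nz: "d (\<epsilon> * t) \<noteq> 0" using d_pos[of "\<epsilon> * t"] by simp
    have "x t = 0 \<or> x t = d (\<epsilon> * t)" using t by (auto simp: impact_times_def)
    then have kin: "u'^2 / 2 - \<epsilon> * strain d (\<epsilon> * t) * x t * u' = u^2 / 2 - \<epsilon> * strain d (\<epsilon> * t) * x t * u"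
      using nz by (auto simp: u'_def reflected_def strain_def power2_eq_square field_simps)
    have "D_slow \<sigma> \<delta> pi \<tau> = D_slow \<sigma> \<delta> (- pi) \<tau>" for \<delta> \<tau>
    proof -
      have "\<sigma> \<delta> pi = \<sigma> \<delta> (- pi)" by (rule ext) (rule \<sigma>per)
      then show ?thesis by (simp add: D_slow_def)
    qed
    note per = signed_angle_reflected[OF t D_slow_in[OF \<sigma>] this, of "\<epsilon> / j" u' "\<epsilon> * t" u]
    have Zeq: "Z w t = (w^2 / 2 - \<epsilon> * strain d (\<epsilon> * t) * x t * w) / j^2
        + \<epsilon> / j * D_slow \<sigma> (\<epsilon> / j) (signed_angle d \<epsilon> w (x t) t) (\<epsilon> * t)
        - stiffness d (\<epsilon> * t) / 2 - e (\<epsilon> / j) 0 (\<epsilon> * t)" for w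
      unfolding Z_def defect_def kinetic_energy[OF j] using e_ang[of "\<epsilon> / j" "signed_angle d \<epsilon> w (x t) t"] by simp
    show "Z (reflected d \<epsilon> (x t) t u) t = Z u t"
      unfolding u'_def[symmetric] Zeq per kin ..
  qed
  then show ?thesis by (simp add: Z_def residual_def[abs_def] scaled_action_def ang_def)
qed

lemma scaled_action_deriv:
  assumes "0 < t" "t < T" "t \<notin> impacts"
  shows "(scaled_action j has_real_derivative \<epsilon> * strain d (\<epsilon> * t) * scaled_action j t) (at t)"
proof -
  have nz: "d (\<epsilon> * t) \<noteq> 0" using d_pos[of "\<epsilon> * t"] by simp
  have "((\<lambda>s. \<bar>v t\<bar> * d (\<epsilon> * s) / (pi * j)) has_real_derivative \<bar>v t\<bar> * (\<epsilon> * deriv d (\<epsilon> * t)) / (pi * j)) (at t)"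
    by (intro DERIV_cdivide DERIV_cmult slow_time_deriv)
  also have "\<bar>v t\<bar> * (\<epsilon> * deriv d (\<epsilon> * t)) / (pi * j) = \<epsilon> * strain d (\<epsilon> * t) * scaled_action j t"
    using nz by (simp add: scaled_action_def strain_def)
  finally have D: "((\<lambda>s. \<bar>v t\<bar> * d (\<epsilon> * s) / (pi * j)) has_real_derivative \<epsilon> * strain d (\<epsilon> * t) * scaled_action j t) (at t)" .
  have "\<forall>\<^sub>F s in nhds t. \<bar>v t\<bar> * d (\<epsilon> * s) / (pi * j) = scaled_action j s"
    using v_locally_const[OF assms] by eventually_elim (simp add: scaled_action_def)
  from DERIV_cong_ev[OF refl this refl] D show ?thesis by simp
qed

lemma ang_deriv':
  assumes "0 < t" "t < T" "t \<notin> impacts" and j: "j > 0"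
  shows "(ang has_real_derivative j * (stiffness d (\<epsilon> * t) * scaled_action j t - \<epsilon> / j * strain d (\<epsilon> * t) * ang t)) (at t)"
proof -
  have nz: "d (\<epsilon> * t) \<noteq> 0" using d_pos[of "\<epsilon> * t"] by simp
  have "j * (stiffness d (\<epsilon> * t) * scaled_action j t) = \<bar>v t\<bar> * pi / d (\<epsilon> * t)"
    using nz j by (simp add: scaled_action_def stiffness_def power2_eq_square)
  then have "j * (stiffness d (\<epsilon> * t) * scaled_action j t - \<epsilon> / j * strain d (\<epsilon> * t) * ang t)
      = \<bar>v t\<bar> * pi / d (\<epsilon> * t) - \<epsilon> * strain d (\<epsilon> * t) * ang t"
    using j by (simp add: right_diff_distrib)
  then show ?thesis using ang_deriv[OF assms(1-3)] by simp
qed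

lemma slow_coeff_deriv:
  "a \<in> coeff_alg d \<Longrightarrow> ((\<lambda>t. a (\<epsilon> * t)) has_real_derivative \<epsilon> * deriv a (\<epsilon> * t)) (at t)"
  using DERIV_chain2[OF coeff_deriv_in(2) DERIV_cmult_Id[of \<epsilon>], of a t] by (simp add: mult.commute)

lemma residual_deriv:
  assumes t: "0 < t" "t < T" "t \<notin> impacts" and j: "j > 0"
  shows "(residual j has_real_derivative \<epsilon> * defect_rate (scaled_action j t) (\<epsilon> / j) (ang t) (\<epsilon> * t)) (at t)"
proof -
  define A b y \<theta> A' b' where "A = stiffness d (\<epsilon> * t)" and "b = strain d (\<epsilon> * t)" and "y = scaled_action j t"
    and "\<theta> = ang t" and "A' = deriv (stiffness d) (\<epsilon> * t)" and "b' = deriv (strain d) (\<epsilon> * t)"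
  define \<delta> where "\<delta> = \<epsilon> / j"
  have \<epsilon>: "\<epsilon> = j * \<delta>" using j by (simp add: \<delta>_def)
  define \<theta>' where "\<theta>' = j * (A * y - \<delta> * b * \<theta>)"
  have D\<theta>: "(ang has_real_derivative \<theta>') (at t)"
    using ang_deriv'[OF assms] by (simp add: \<theta>'_def A_def b_def y_def \<theta>_def \<delta>_def)
  have Ds: "((\<lambda>t. \<epsilon> * t) has_real_derivative \<epsilon>) (at t)" by (rule DERIV_cmult_Id)
  note chain = phase_poly_chain[OF _ D\<theta> Ds, of _ \<delta>]
  have e0: "D_ang e \<delta> \<theta> \<tau> = 0" for \<theta> \<tau>
  proof -
    have "(\<lambda>x. e \<delta> x \<tau>) = (\<lambda>x. e \<delta> 0 \<tau>)" by (rule ext) (rule e_ang)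
    then show ?thesis unfolding D_ang_def by simp
  qed
  note dA = DERIV_cdivide[OF slow_coeff_deriv[OF stiffness_coeff], of 2 t]
    and db = DERIV_cmult[OF slow_coeff_deriv[OF strain_coeff], of \<delta> t]
    and dy = scaled_action_deriv[OF t, of j]
  note D = DERIV_diff[OF DERIV_diff[OF DERIV_add[OF DERIV_diff[OF DERIV_mult[OF dA DERIV_mult[OF dy dy]]
    DERIV_mult[OF DERIV_mult[OF db D\<theta>] dy]] DERIV_cmult[OF chain[OF D_slow_in[OF \<sigma>]], of \<delta>]] dA] chain[OF e]]
  have "residual j = (\<lambda>t. stiffness d (\<epsilon> * t) / 2 * (scaled_action j t * scaled_action j t) - \<delta> * strain d (\<epsilon> * t) * ang t * scaled_action j t
      + \<delta> * D_slow \<sigma> \<delta> (ang t) (\<epsilon> * t) - stiffness d (\<epsilon> * t) / 2 - e \<delta> (ang t) (\<epsilon> * t))"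
    by (simp add: residual_def[abs_def] defect_def \<delta>_def power2_eq_square)
  moreover have "defect_rate (scaled_action j t) (\<epsilon> / j) (ang t) (\<epsilon> * t) = A' / 2 * (y^2 - 1) - \<delta> * b' * \<theta> * y
      + \<delta> * D_slow (D_slow \<sigma>) \<delta> \<theta> (\<epsilon> * t) - D_slow e \<delta> \<theta> (\<epsilon> * t)
      + D_ang (D_slow \<sigma>) \<delta> \<theta> (\<epsilon> * t) * (A * y - \<delta> * b * \<theta>)"
    by (simp add: defect_rate_def A_def b_def y_def \<theta>_def A'_def b'_def \<delta>_def)
  moreover have "((\<lambda>t. stiffness d (\<epsilon> * t) / 2 * (scaled_action j t * scaled_action j t) - \<delta> * strain d (\<epsilon> * t) * ang t * scaled_action j t
      + \<delta> * D_slow \<sigma> \<delta> (ang t) (\<epsilon> * t) - stiffness d (\<epsilon> * t) / 2 - e \<delta> (ang t) (\<epsilon> * t))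
    has_real_derivative \<epsilon> * (A' / 2 * (y^2 - 1) - \<delta> * b' * \<theta> * y
      + \<delta> * D_slow (D_slow \<sigma>) \<delta> \<theta> (\<epsilon> * t) - D_slow e \<delta> \<theta> (\<epsilon> * t)
      + D_ang (D_slow \<sigma>) \<delta> \<theta> (\<epsilon> * t) * (A * y - \<delta> * b * \<theta>))) (at t)"
  proof (rule DERIV_cong[OF D[folded A_def b_def y_def \<theta>_def A'_def b'_def]])
    define q q' r where "q = D_ang (D_slow \<sigma>) \<delta> \<theta> (\<epsilon> * t)" and "q' = D_slow (D_slow \<sigma>) \<delta> \<theta> (\<epsilon> * t)"
      and "r = D_slow e \<delta> \<theta> (\<epsilon> * t)"
    show "\<epsilon> * A' / 2 * (y * y) + (\<epsilon> * b * y * y + \<epsilon> * b * y * y) * (A / 2) -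
      ((\<delta> * (\<epsilon> * b') * \<theta> + \<theta>' * (\<delta> * b)) * y + \<epsilon> * b * y * (\<delta> * b * \<theta>)) +
      \<delta> * (D_ang (D_slow \<sigma>) \<delta> \<theta> (\<epsilon> * t) * \<theta>' + D_slow (D_slow \<sigma>) \<delta> \<theta> (\<epsilon> * t) * \<epsilon>) -
      \<epsilon> * A' / 2 - (D_ang e \<delta> \<theta> (\<epsilon> * t) * \<theta>' + D_slow e \<delta> \<theta> (\<epsilon> * t) * \<epsilon>) =
      \<epsilon> * (A' / 2 * (y^2 - 1) - \<delta> * b' * \<theta> * y
      + \<delta> * D_slow (D_slow \<sigma>) \<delta> \<theta> (\<epsilon> * t) - D_slow e \<delta> \<theta> (\<epsilon> * t)
      + D_ang (D_slow \<sigma>) \<delta> \<theta> (\<epsilon> * t) * (A * y - \<delta> * b * \<theta>))"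
      unfolding e0 \<theta>'_def q_def[symmetric] q'_def[symmetric] r_def[symmetric]
      unfolding \<epsilon> by (simp add: power2_eq_square field_simps)
  qed
  ultimately show ?thesis by simp
qed

lemma scaled_action_nonneg: "t \<in> {0..T} \<Longrightarrow> j > 0 \<Longrightarrow> 0 \<le> scaled_action j t"
  using d_pos[of "\<epsilon> * t"] by (simp add: scaled_action_def)

text \<open>
  The window has length of order \<open>1 / \<epsilon>\<close> since the rate of the residual contains the factor \<open>\<epsilon>\<close>.
\<close>
lemma residual_window:
  assumes j: "j > 0" and K: "0 \<le> K"
    and rate: "\<And>y \<theta> \<tau>. \<bar>\<theta>\<bar> \<le> pi \<Longrightarrow> \<tau> \<in> M \<Longrightarrow> 0 \<le> y \<Longrightarrow> \<bar>defect y (\<epsilon> / j) \<theta> \<tau>\<bar> \<le> 1 \<Longrightarrow>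
       \<bar>defect_rate y (\<epsilon> / j) \<theta> \<tau>\<bar> \<le> K * (\<bar>defect y (\<epsilon> / j) \<theta> \<tau>\<bar> + (\<epsilon> / j) ^ n)"
    and ab: "0 \<le> a" "b \<le> T" "\<epsilon> * K * (b - a) \<le> 1 / 4"
    and \<eta>: "(\<epsilon> / j) ^ n \<le> \<eta>" "\<eta> \<le> 1 / 2" and start: "\<bar>residual j a\<bar> \<le> \<eta>"
    and t: "t \<in> {a..b}"
  shows "\<bar>residual j t\<bar> \<le> 2 * \<eta>"
proof (rule small_over_short_window[OF continuous_on_subset[OF residual_continuous[OF j]] finite_impacts _ start _ \<eta>(2) _ ab(3) t])
  show "{a..b} \<subseteq> {0..T}" using ab by auto
  have "0 < (\<epsilon> / j) ^ n" using \<epsilon>_pos j by simp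
  then show "0 < \<eta>" using \<eta>(1) by linarith
  show "0 \<le> \<epsilon> * K" using \<epsilon>_pos K by simp
  fix s assume s: "s \<in> {a<..<b} - impacts" and small: "\<bar>residual j s\<bar> \<le> 1"
  then have s': "0 < s" "s < T" "s \<notin> impacts" "s \<in> {0..T}" using ab by auto
  have "\<bar>defect_rate (scaled_action j s) (\<epsilon> / j) (ang s) (\<epsilon> * s)\<bar> \<le> K * (\<bar>residual j s\<bar> + (\<epsilon> / j) ^ n)"
    unfolding residual_def by (rule rate[OF ang_bounds[OF s'(4)] slow[OF s'(4)] scaled_action_nonneg[OF s'(4) j]])
      (use small in \<open>simp add: residual_def\<close>)
  also have "\<dots> \<le> K * (\<bar>residual j s\<bar> + \<eta>)" using \<eta> K by (intro mult_left_mono) auto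
  finally have "\<epsilon> * \<bar>defect_rate (scaled_action j s) (\<epsilon> / j) (ang s) (\<epsilon> * s)\<bar> \<le> \<epsilon> * (K * (\<bar>residual j s\<bar> + \<eta>))"
    using \<epsilon>_pos by (intro mult_left_mono) auto
  then show "\<exists>f'. (residual j has_real_derivative f') (at s) \<and> \<bar>f'\<bar> \<le> \<epsilon> * K * (\<bar>residual j s\<bar> + \<eta>)"
    using residual_deriv[OF s'(1-3) j] \<epsilon>_pos by (intro exI conjI) (auto simp: abs_mult)
qed

end

section \<open>Drift of the action and of the phase\<close>

lemma abs_le_of_half_slope:
  fixes a b D :: real
  assumes "\<bar>a - b\<bar> \<le> \<bar>b\<bar> / 2" "\<bar>a\<bar> \<le> D / 2"
  shows "\<bar>b\<bar> \<le> D"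
  using assms by argo

context normal_form
begin

text \<open>
  The new phase minus the old one, \<open>\<epsilon> \<partial>S/\<partial>J\<close>, in terms of \<open>\<epsilon> S = J \<sigma>(\<epsilon> / J, \<phi>, \<tau>)\<close>.
\<close>
definition phase_shift :: "real \<Rightarrow> real \<Rightarrow> real \<Rightarrow> real" where
  "phase_shift \<delta> \<theta> \<tau> = \<sigma> \<delta> \<theta> \<tau> - \<delta> * D_eps \<sigma> \<delta> \<theta> \<tau>"

lemma phase_shift_in: "phase_shift \<in> phase_poly d"
  unfolding phase_shift_def[abs_def] by (intro phase_poly_intros D_eps_in \<sigma>)

end

context averaged_motion
begin

lemma lift_ang:
  assumes lift: "lifted_angle d \<epsilon> T x v \<phi>" and t: "t \<in> {0..T}"
  obtains m :: int where "\<phi> t = ang t + 2 * pi * of_int m"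
proof -
  obtain m :: int where m: "\<phi> t = angle_of (d (\<epsilon> * t)) (x t) (v t) + 2 * pi * of_int m"
    using lift t unfolding lifted_angle_def by blast
  have nz: "d (\<epsilon> * t) \<noteq> 0" using d_pos[of "\<epsilon> * t"] by simp
  have "\<phi> t = ang t + 2 * pi * of_int (if v t > 0 then m else m + 1)"
    unfolding m by (simp add: ang_def signed_angle_def angle_of_def field_simps)
  then show ?thesis by (rule that)
qed

text \<open>
  A lift of the angle differs from \<open>ang\<close> by a multiple of \<open>2\<pi>\<close> that is locally constant where both are
  continuous.
\<close>
lemma lift_deriv:
  assumes lift: "lifted_angle d \<epsilon> T x v \<phi>" and t: "0 < t" "t < T" "t \<notin> impacts"
    and D: "(ang has_real_derivative a) (at t)"
  shows "(\<phi> has_real_derivative a) (at t)"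
proof -
  define c where "c = \<phi> t - ang t"
  have "isCont \<phi> t"
    using lift t unfolding lifted_angle_def by (intro continuous_on_interior[of "{0..T}"]) auto
  then have "isCont (\<lambda>s. \<phi> s - ang s) t" using DERIV_isCont[OF D] by (rule isCont_diff)
  then have "\<forall>\<^sub>F s in nhds t. dist (\<phi> s - ang s) c < 2 * pi"
    unfolding isCont_def c_def[symmetric] tendsto_iff eventually_at_filter
    using pi_gt_zero by (auto elim!: allE[of _ "2 * pi"] eventually_mono simp: c_def)
  moreover have "\<forall>\<^sub>F s in nhds t. s \<in> {0<..<T}" using t by (intro eventually_nhds_in_open) auto
  ultimately have ev: "\<forall>\<^sub>F s in nhds t. ang s + c = \<phi> s"
  proof eventually_elim
    case (elim s)
    obtain m :: int where m: "\<phi> s = ang s + 2 * pi * of_int m" using lift_ang[OF lift, of s] elim by auto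
    obtain m' :: int where m': "\<phi> t = ang t + 2 * pi * of_int m'" using lift_ang[OF lift, of t] t by auto
    have "\<bar>2 * pi * of_int (m - m')\<bar> < 2 * pi"
      using elim(1) unfolding c_def dist_real_def m m' by (simp add: algebra_simps)
    then have "\<bar>of_int (m - m') :: real\<bar> < 1" by (simp add: abs_mult)
    then have "m = m'" by linarith
    then show ?case unfolding c_def m m' by simp
  qed
  have "((\<lambda>s. ang s + c) has_real_derivative a) (at t)"
    using DERIV_add[OF D DERIV_const[of c]] by simp
  with DERIV_cong_ev[OF refl ev refl] show ?thesis by simp
qed

text \<open>
  The action is frozen at \<open>j\<close> here, so that no derivative of the actual new action occurs. The first
  summand is the price for that; the second is the frequency of the truncated Hamiltonian.
\<close>
lemma averaged_phase_deriv:
  assumes lift: "lifted_angle d \<epsilon> T x v \<phi>" and t: "0 < t" "t < T" "t \<notin> impacts" and j: "j > 0"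
  defines "\<delta> \<equiv> \<epsilon> / j"
  shows "((\<lambda>t. \<phi> t + phase_shift \<delta> (ang t) (\<epsilon> * t)) has_real_derivative
    j * (stiffness d (\<epsilon> * t) * (scaled_action j t - ratio \<delta> (ang t) (\<epsilon> * t)) * (ratio \<delta> (ang t) (\<epsilon> * t) - \<delta> * D_ang (D_eps \<sigma>) \<delta> (ang t) (\<epsilon> * t))
      + (stiffness d (\<epsilon> * t) + 2 * e \<delta> (ang t) (\<epsilon> * t) - \<delta> * D_eps e \<delta> (ang t) (\<epsilon> * t))
      + \<delta> ^ n * ((2 - real n) * R \<delta> (ang t) (\<epsilon> * t) - \<delta> * D_eps R \<delta> (ang t) (\<epsilon> * t)))) (at t)"
proof -
  define A b y \<theta> w where "A = stiffness d (\<epsilon> * t)" and "b = strain d (\<epsilon> * t)" and "y = scaled_action j t"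
    and "\<theta> = ang t" and "w = ratio \<delta> (ang t) (\<epsilon> * t)"
  have \<epsilon>: "\<epsilon> = j * \<delta>" using j by (simp add: \<delta>_def)
  define \<theta>' where "\<theta>' = j * (A * y - \<delta> * b * \<theta>)"
  have D\<theta>: "(ang has_real_derivative \<theta>') (at t)"
    using ang_deriv'[OF t j] by (simp add: \<theta>'_def A_def b_def y_def \<theta>_def \<delta>_def)
  have Ds: "((\<lambda>t. \<epsilon> * t) has_real_derivative \<epsilon>) (at t)" by (rule DERIV_cmult_Id)
  note chain = phase_poly_chain[OF _ D\<theta> Ds, of _ \<delta>]
  note D = DERIV_add[OF lift_deriv[OF lift t D\<theta>]
      DERIV_diff[OF chain[OF \<sigma>] DERIV_cmult[OF chain[OF D_eps_in[OF \<sigma>]], of \<delta>]], folded \<theta>_def]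
  define p q pd qd where "p = D_ang \<sigma> \<delta> \<theta> (\<epsilon> * t)" and "q = D_slow \<sigma> \<delta> \<theta> (\<epsilon> * t)"
    and "pd = D_ang (D_eps \<sigma>) \<delta> \<theta> (\<epsilon> * t)" and "qd = D_slow (D_eps \<sigma>) \<delta> \<theta> (\<epsilon> * t)"
  have w: "w = 1 + p" by (simp add: w_def ratio_def p_def \<theta>_def)
  have "\<theta>' + (p * \<theta>' + q * \<epsilon> - \<delta> * (pd * \<theta>' + qd * \<epsilon>))
      = j * (A * (y - w) * (w - \<delta> * pd) + ((A * w - \<delta> * b * \<theta>) * (w - \<delta> * pd) + \<delta> * (q - \<delta> * qd)))"
    unfolding \<theta>'_def w \<epsilon> by (simp add: algebra_simps)
  also have "(A * w - \<delta> * b * \<theta>) * (w - \<delta> * pd) + \<delta> * (q - \<delta> * qd)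
    = (stiffness d (\<epsilon> * t) + 2 * e \<delta> \<theta> (\<epsilon> * t) - \<delta> * D_eps e \<delta> \<theta> (\<epsilon> * t))
      + \<delta> ^ n * ((2 - real n) * R \<delta> \<theta> (\<epsilon> * t) - \<delta> * D_eps R \<delta> \<theta> (\<epsilon> * t))"
    unfolding A_def b_def w_def pd_def q_def qd_def \<theta>_def by (rule HJ_eps)
  finally show ?thesis
    unfolding phase_shift_def
    using D unfolding p_def q_def pd_def qd_def A_def y_def w_def \<theta>_def
    by (simp add: add.assoc)
qed

lemma averaged_phase_continuous:
  assumes lift: "lifted_angle d \<epsilon> T x v \<phi>"
  shows "continuous_on {0..T} (\<lambda>t. \<phi> t + phase_shift \<delta> (ang t) (\<epsilon> * t))"
proof (rule continuous_on_add)
  show "continuous_on {0..T} \<phi>" using lift unfolding lifted_angle_def by blast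
  have per: "phase_shift \<delta> pi \<tau> = phase_shift \<delta> (- pi) \<tau>" for \<delta> \<tau>
    unfolding phase_shift_def D_eps_def by (simp add: \<sigma>per)
  have "continuous_on {0..T} (\<lambda>t. (\<lambda>w t. phase_shift \<delta> (signed_angle d \<epsilon> w (x t) t) (\<epsilon> * t)) (v t) t)"
  proof (rule continuous_through_impacts)
    show "continuous_on {0..T} (\<lambda>t. phase_shift \<delta> (signed_angle d \<epsilon> w (x t) t) (\<epsilon> * t))" for w
      by (rule phase_poly_continuous[OF phase_shift_in signed_angle_cont slow_cont])
    show "phase_shift \<delta> (signed_angle d \<epsilon> (reflected d \<epsilon> (x t) t u) (x t) t) (\<epsilon> * t) =
        phase_shift \<delta> (signed_angle d \<epsilon> u (x t) t) (\<epsilon> * t)" if "t \<in> impacts" for t u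
      by (rule signed_angle_reflected[OF that phase_shift_in per])
  qed
  then show "continuous_on {0..T} (\<lambda>t. phase_shift \<delta> (ang t) (\<epsilon> * t))" by (simp add: ang_def)
qed

end

context normal_form
begin

text \<open>
  At the beginning of each window \<open>j\<close> is chosen as the actual new action, for which the residual is as small as
  the remainder. As there are \<open>O(\<epsilon>\<^sup>1\<^sup>-\<^sup>k)\<close> windows, each contributing \<open>O(\<epsilon>\<^sup>n)\<close>, the values of \<open>j\<close> stay close
  to the initial one; this also keeps the action of the motion in a compact set of positive numbers,
  on which all the estimates are uniform.
\<close>
lemma action_drift:
  assumes I\<^sub>0: "I\<^sub>0 > 0" and L: "L > 0" and r: "1 \<le> r" and n: "n = r + k"
  obtains C \<epsilon>\<^sub>0 where "C > 0" "\<epsilon>\<^sub>0 > 0"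
    "\<And>\<epsilon> T x v. \<epsilon> < \<epsilon>\<^sub>0 \<Longrightarrow> 0 \<le> T \<Longrightarrow> T \<le> L / \<epsilon> ^ k \<Longrightarrow> averaged_motion d c\<^sub>0 M \<sigma> e R n \<epsilon> T x v \<Longrightarrow>
       action d \<epsilon> v 0 = I\<^sub>0 \<Longrightarrow>
       \<exists>j\<^sub>0. \<forall>t\<in>{0..T}. \<exists>j. \<bar>j - j\<^sub>0\<bar> \<le> C * \<epsilon> ^ r \<and> I\<^sub>0 / 4 \<le> j \<and> j \<le> 2 * I\<^sub>0 \<and>
         \<bar>action d \<epsilon> v t - j * ratio (\<epsilon> / j) (signed_angle d \<epsilon> (v t) (x t) t) (\<epsilon> * t)\<bar> \<le> C * \<epsilon> ^ r \<and>
         I\<^sub>0 / 16 \<le> action d \<epsilon> v t \<and> action d \<epsilon> v t \<le> 4 * I\<^sub>0"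
proof -
  obtain K \<delta>\<^sub>0 where K: "K \<ge> 1" and \<delta>\<^sub>0: "0 < \<delta>\<^sub>0" "\<delta>\<^sub>0 \<le> 1"
    and E1: "\<And>\<delta> \<theta> \<tau>. 0 < \<delta> \<Longrightarrow> \<delta> \<le> \<delta>\<^sub>0 \<Longrightarrow> \<bar>\<theta>\<bar> \<le> pi \<Longrightarrow> \<tau> \<in> M \<Longrightarrow> \<bar>ratio \<delta> \<theta> \<tau> - 1\<bar> \<le> 1 / 2"
    and E2: "\<And>y \<delta> \<theta> \<tau>. 0 < \<delta> \<Longrightarrow> \<delta> \<le> \<delta>\<^sub>0 \<Longrightarrow> \<bar>\<theta>\<bar> \<le> pi \<Longrightarrow> \<tau> \<in> M \<Longrightarrow> 0 \<le> y \<Longrightarrow>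
       \<bar>y - ratio \<delta> \<theta> \<tau>\<bar> \<le> K * (\<bar>defect y \<delta> \<theta> \<tau>\<bar> + \<delta> ^ n)"
    and E3: "\<And>y \<delta> \<theta> \<tau>. 0 < \<delta> \<Longrightarrow> \<delta> \<le> \<delta>\<^sub>0 \<Longrightarrow> \<bar>\<theta>\<bar> \<le> pi \<Longrightarrow> \<tau> \<in> M \<Longrightarrow> 0 \<le> y \<Longrightarrow> \<bar>defect y \<delta> \<theta> \<tau>\<bar> \<le> 1 \<Longrightarrow>
       \<bar>defect_rate y \<delta> \<theta> \<tau>\<bar> \<le> K * (\<bar>defect y \<delta> \<theta> \<tau>\<bar> + \<delta> ^ n)"
    and E4: "\<And>y \<delta> \<theta> \<tau>. 0 < \<delta> \<Longrightarrow> \<delta> \<le> \<delta>\<^sub>0 \<Longrightarrow> \<bar>\<theta>\<bar> \<le> pi \<Longrightarrow> \<tau> \<in> M \<Longrightarrow> 0 \<le> y \<Longrightarrow> \<bar>y - ratio \<delta> \<theta> \<tau>\<bar> \<le> 1 \<Longrightarrow>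
       \<bar>defect y \<delta> \<theta> \<tau>\<bar> \<le> K * (\<bar>y - ratio \<delta> \<theta> \<tau>\<bar> + \<delta> ^ n)"
    using that by (rule defect_estimates)
  note p = D_ang_in[OF \<sigma>] D_ang_zero_eps
  obtain \<delta>\<^sub>1 K' where \<delta>\<^sub>1: "0 < \<delta>\<^sub>1" "\<delta>\<^sub>1 \<le> 1" "K' > 0"
    and slope: "\<And>\<epsilon> a j j' \<theta> \<tau>. 0 < a \<Longrightarrow> 0 < \<epsilon> \<Longrightarrow> \<epsilon> \<le> \<delta>\<^sub>1 * a \<Longrightarrow> a \<le> j \<Longrightarrow> a \<le> j' \<Longrightarrow> \<bar>\<theta>\<bar> \<le> pi \<Longrightarrow> \<tau> \<in> M \<Longrightarrow>
       \<bar>j * (1 + D_ang \<sigma> (\<epsilon> / j) \<theta> \<tau>) - j' * (1 + D_ang \<sigma> (\<epsilon> / j') \<theta> \<tau>) - (j - j')\<bar> \<le> \<bar>j - j'\<bar> / 2"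
    "\<And>\<epsilon> a j \<theta> \<tau>. 0 < a \<Longrightarrow> 0 < \<epsilon> \<Longrightarrow> \<epsilon> \<le> \<delta>\<^sub>1 * a \<Longrightarrow> a \<le> j \<Longrightarrow> \<bar>\<theta>\<bar> \<le> pi \<Longrightarrow> \<tau> \<in> M \<Longrightarrow>
       \<bar>j * (1 + D_ang \<sigma> (\<epsilon> / j) \<theta> \<tau>) - j\<bar> \<le> K' * \<epsilon>"
    using that by (rule near_identity[OF p])
  obtain \<kappa> where \<kappa>: "0 < \<kappa>"
    and inv: "\<And>\<epsilon> a I \<theta> \<tau>. 0 < a \<Longrightarrow> 0 < \<epsilon> \<Longrightarrow> \<epsilon> \<le> \<kappa> * a \<Longrightarrow> a \<le> I \<Longrightarrow> \<bar>\<theta>\<bar> \<le> pi \<Longrightarrow> \<tau> \<in> M \<Longrightarrow>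
       \<exists>!J. \<bar>J - I\<bar> \<le> I / 2 \<and> I = J * (1 + D_ang \<sigma> (\<epsilon> / J) \<theta> \<tau>)"
    using that by (rule near_identity_inverse[OF p])
  define B where "B = 12 * K\<^sup>2 * I\<^sub>0 * (4 / I\<^sub>0) ^ n"
  define C\<^sub>1 where "C\<^sub>1 = (4 * K * L + 1) * B"
  have B: "B > 0" using K I\<^sub>0 by (simp add: B_def)
  have C\<^sub>1: "C\<^sub>1 > 0" using B K L by (auto simp: C\<^sub>1_def intro!: mult_pos_pos add_pos_pos)
  define \<epsilon>\<^sub>0 where "\<epsilon>\<^sub>0 = Min {1, \<delta>\<^sub>0 * I\<^sub>0 / 4, \<delta>\<^sub>1 * (I\<^sub>0 / 32), \<kappa> * (I\<^sub>0 / 16), I\<^sub>0 / (48 * K\<^sup>2), I\<^sub>0 / (4 * C\<^sub>1)}"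
  have \<epsilon>\<^sub>0: "\<epsilon>\<^sub>0 > 0" using \<delta>\<^sub>0 \<delta>\<^sub>1 \<kappa> I\<^sub>0 K C\<^sub>1 by (simp add: \<epsilon>\<^sub>0_def)
  show ?thesis
  proof (rule that[OF _ \<epsilon>\<^sub>0])
    show "C\<^sub>1 + B > 0" using C\<^sub>1 B by simp
    fix \<epsilon> T x v
    assume small: "\<epsilon> < \<epsilon>\<^sub>0" and T: "0 \<le> T" "T \<le> L / \<epsilon> ^ k"
      and am: "averaged_motion d c\<^sub>0 M \<sigma> e R n \<epsilon> T x v" and I0: "action d \<epsilon> v 0 = I\<^sub>0"
    interpret averaged_motion d c\<^sub>0 M \<sigma> e R n \<epsilon> T x v by (rule am)
    have \<epsilon>: "0 < \<epsilon>" "\<epsilon> \<le> 1" "\<epsilon> \<le> \<delta>\<^sub>0 * I\<^sub>0 / 4" "\<epsilon> \<le> \<delta>\<^sub>1 * (I\<^sub>0 / 32)" "\<epsilon> \<le> \<kappa> * (I\<^sub>0 / 16)" "\<epsilon> \<le> I\<^sub>0 / (48 * K\<^sup>2)" "\<epsilon> \<le> I\<^sub>0 / (4 * C\<^sub>1)"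
      using small \<epsilon>_pos by (auto simp: \<epsilon>\<^sub>0_def)
    (* \<open>q\<close> bounds \<open>\<epsilon> / j\<close>, \<open>\<eta>\<close> the residual at the beginning of a window, and \<open>D\<close> the change of \<open>j\<close> at its end. *)
    define q where "q = 4 * \<epsilon> / I\<^sub>0"
    define \<eta> where "\<eta> = K * q ^ n"
    define D where "D = 12 * K * \<eta> * I\<^sub>0"
    have q: "0 < q" "q \<le> \<delta>\<^sub>0" "q \<le> 1 / (12 * K\<^sup>2)"
      using \<epsilon> I\<^sub>0 K by (simp_all add: q_def field_simps)
    have q1: "q \<le> 1" using q \<delta>\<^sub>0 by linarith
    have qn: "0 < q ^ n" "q ^ n \<le> q" using q q1 n r power_decreasing[of 1 n q] by auto
    have "K * \<eta> = K\<^sup>2 * q ^ n" by (simp add: \<eta>_def power2_eq_square)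
    also have "\<dots> \<le> K\<^sup>2 * (1 / (12 * K\<^sup>2))" using qn q by (intro mult_left_mono) auto
    finally have K\<eta>: "K * \<eta> \<le> 1 / 12" using K by simp
    have \<eta>: "0 < \<eta>" "q ^ n \<le> \<eta>" using qn K by (auto simp: \<eta>_def)
    have "1 * \<eta> \<le> K * \<eta>" using K \<eta> by (intro mult_right_mono) auto
    then have \<eta>2: "\<eta> \<le> 1 / 12" using K\<eta> by linarith
    have D: "0 < D" "D = B * \<epsilon> ^ n"
    proof -
      show "0 < D" using K \<eta> I\<^sub>0 by (simp add: D_def)
      show "D = B * \<epsilon> ^ n"
        by (simp add: D_def \<eta>_def q_def B_def power_divide power_mult_distrib power2_eq_square)
    qed
    have \<epsilon>n: "\<epsilon> ^ n \<le> \<epsilon> ^ r" using \<epsilon> n by (intro power_decreasing) auto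
    have D': "D \<le> B * \<epsilon> ^ r" unfolding D(2) using B \<epsilon>n by (intro mult_left_mono) auto
    have C\<^sub>1\<epsilon>: "C\<^sub>1 * \<epsilon> ^ r \<le> I\<^sub>0 / 4"
    proof -
      have "\<epsilon> ^ r \<le> \<epsilon>" using \<epsilon> r power_decreasing[of 1 r \<epsilon>] by auto
      then have "C\<^sub>1 * \<epsilon> ^ r \<le> C\<^sub>1 * (I\<^sub>0 / (4 * C\<^sub>1))" using \<epsilon>(7) C\<^sub>1 by (intro mult_left_mono) auto
      then show ?thesis using C\<^sub>1 by simp
    qed
    have \<delta>: "0 < \<epsilon> / j" "\<epsilon> / j \<le> q" "\<epsilon> / j \<le> \<delta>\<^sub>0" "(\<epsilon> / j) ^ n \<le> q ^ n" if "I\<^sub>0 / 4 \<le> j" for j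
    proof -
      have j: "j > 0" using that I\<^sub>0 by simp
      show 1: "0 < \<epsilon> / j" using \<epsilon> j by simp
      show 2: "\<epsilon> / j \<le> q" using that \<epsilon> j I\<^sub>0 by (simp add: q_def field_simps)
      show "\<epsilon> / j \<le> \<delta>\<^sub>0" using 2 q by linarith
      show "(\<epsilon> / j) ^ n \<le> q ^ n" using 1 2 by (intro power_mono) auto
    qed
    have act: "action d \<epsilon> v t = j * scaled_action j t" if "j > 0" for j t
      using that by (simp add: action_def scaled_action_def)
    have close: "\<bar>action d \<epsilon> v t - j * ratio (\<epsilon> / j) (ang t) (\<epsilon> * t)\<bar> \<le> D / 2 \<and>
        I\<^sub>0 / 16 \<le> action d \<epsilon> v t \<and> action d \<epsilon> v t \<le> 4 * I\<^sub>0"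
      if t: "t \<in> {0..T}" and j: "I\<^sub>0 / 4 \<le> j" "j \<le> 2 * I\<^sub>0" and res: "\<bar>residual j t\<bar> \<le> 2 * \<eta>" for j t
    proof -
      have j0: "j > 0" using j I\<^sub>0 by simp
      define w where "w = ratio (\<epsilon> / j) (ang t) (\<epsilon> * t)"
      have w: "\<bar>w - 1\<bar> \<le> 1 / 2" unfolding w_def by (rule E1[OF \<delta>(1,3)[OF j(1)] ang_bounds[OF t] slow[OF t]])
      have "\<bar>scaled_action j t - w\<bar> \<le> K * (\<bar>residual j t\<bar> + (\<epsilon> / j) ^ n)"
        unfolding w_def residual_def by (rule E2[OF \<delta>(1,3)[OF j(1)] ang_bounds[OF t] slow[OF t] scaled_action_nonneg[OF t j0]])
      also have "\<dots> \<le> K * (3 * \<eta>)" using res \<delta>(4)[OF j(1)] \<eta> K by (intro mult_left_mono) auto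
      finally have aw: "\<bar>scaled_action j t - w\<bar> \<le> 3 * (K * \<eta>)" by simp
      then have aw': "\<bar>scaled_action j t - w\<bar> \<le> 1 / 4" using K\<eta> by linarith
      have "\<bar>action d \<epsilon> v t - j * w\<bar> = j * \<bar>scaled_action j t - w\<bar>"
        using j0 by (simp add: act[OF j0] abs_mult right_diff_distrib[symmetric])
      also have "\<dots> \<le> (2 * I\<^sub>0) * (3 * (K * \<eta>))" using aw j j0 by (intro mult_mono) auto
      also have "\<dots> = D / 2" by (simp add: D_def)
      finally have 1: "\<bar>action d \<epsilon> v t - j * w\<bar> \<le> D / 2" .
      have ab: "1 / 4 \<le> scaled_action j t" "scaled_action j t \<le> 2" using aw' w by argo+
      have "I\<^sub>0 / 4 * (1 / 4) \<le> j * scaled_action j t" by (rule mult_mono) (use j j0 I\<^sub>0 ab in auto)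
      moreover have "j * scaled_action j t \<le> (2 * I\<^sub>0) * 2" by (rule mult_mono) (use j j0 I\<^sub>0 ab in auto)
      ultimately show ?thesis using 1 unfolding act[OF j0] w_def by simp
    qed
    have rebase: "\<exists>j'. \<bar>j' - j\<bar> \<le> D \<and> action d \<epsilon> v t = j' * ratio (\<epsilon> / j') (ang t) (\<epsilon> * t)"
      if t: "t \<in> {0..T}" and j: "I\<^sub>0 / 4 \<le> j" "j \<le> 2 * I\<^sub>0" and res: "\<bar>residual j t\<bar> \<le> 2 * \<eta>" for j t
    proof -
      define I where "I = action d \<epsilon> v t"
      have I: "I\<^sub>0 / 16 \<le> I" "\<bar>I - j * ratio (\<epsilon> / j) (ang t) (\<epsilon> * t)\<bar> \<le> D / 2"
        using close[OF t j res] by (auto simp: I_def)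
      have pos: "0 < I\<^sub>0 / 16" "0 < I\<^sub>0 / 32" using I\<^sub>0 by auto
      obtain j' where j': "\<bar>j' - I\<bar> \<le> I / 2" "I = j' * ratio (\<epsilon> / j') (ang t) (\<epsilon> * t)"
        using inv[OF pos(1) \<epsilon>(1,5) I(1) ang_bounds[OF t] slow[OF t]] unfolding ratio_def by blast
      have a: "I\<^sub>0 / 32 \<le> j'" "I\<^sub>0 / 32 \<le> j" using j' I j I\<^sub>0 by argo+
      have "\<bar>(I - j * ratio (\<epsilon> / j) (ang t) (\<epsilon> * t)) - (j' - j)\<bar> \<le> \<bar>j' - j\<bar> / 2"
        unfolding j'(2)[unfolded ratio_def] ratio_def
        by (rule slope(1)[OF pos(2) \<epsilon>(1,4) a ang_bounds[OF t] slow[OF t]])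
      then have "\<bar>j' - j\<bar> \<le> D" using I(2) by (rule abs_le_of_half_slope)
      from conjI[OF this j'(2)[unfolded I_def]] show ?thesis by (rule exI)
    qed
    have exact: "\<bar>residual j t\<bar> \<le> \<eta>"
      if t: "t \<in> {0..T}" and j: "I\<^sub>0 / 4 \<le> j" and eq: "action d \<epsilon> v t = j * ratio (\<epsilon> / j) (ang t) (\<epsilon> * t)" for j t
    proof -
      have j0: "j > 0" using j I\<^sub>0 by simp
      have "scaled_action j t = ratio (\<epsilon> / j) (ang t) (\<epsilon> * t)" using eq j0 unfolding act[OF j0] by simp
      then have "\<bar>residual j t\<bar> \<le> K * (0 + (\<epsilon> / j) ^ n)"
        unfolding residual_def using E4[OF \<delta>(1,3)[OF j] ang_bounds[OF t] slow[OF t] scaled_action_nonneg[OF t j0]] by simp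
      also have "\<dots> \<le> \<eta>" unfolding \<eta>_def using \<delta>(4)[OF j] K by simp
      finally show ?thesis .
    qed
    have t0: "0 \<in> {0..T}" using T by simp
    have pos: "0 < I\<^sub>0 / 16" using I\<^sub>0 by auto
    have le: "I\<^sub>0 / 16 \<le> I\<^sub>0" using I\<^sub>0 by simp
    obtain j\<^sub>0 where j\<^sub>0: "\<bar>j\<^sub>0 - I\<^sub>0\<bar> \<le> I\<^sub>0 / 2" "I\<^sub>0 = j\<^sub>0 * ratio (\<epsilon> / j\<^sub>0) (ang 0) (\<epsilon> * 0)"
      using inv[OF pos \<epsilon>(1,5) le ang_bounds[OF t0] slow[OF t0]] unfolding ratio_def by blast
    have j0_range: "I\<^sub>0 / 4 \<le> j \<and> j \<le> 2 * I\<^sub>0" if "\<bar>j - j\<^sub>0\<bar> \<le> I\<^sub>0 / 4" for j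
      using j\<^sub>0(1) that by argo
    define len where "len = 1 / (4 * K * \<epsilon>)"
    have len: "len > 0" "\<epsilon> * K * len \<le> 1 / 4" using K \<epsilon> by (simp_all add: len_def)
    (* Induction on the number \<open>m\<close> of windows of length \<open>len\<close>. *)
    have main: "\<forall>t\<in>{0..T}. t \<le> real m * len \<longrightarrow> (\<exists>j. \<bar>j - j\<^sub>0\<bar> \<le> real m * D \<and> \<bar>residual j t\<bar> \<le> 2 * \<eta>)"
      if "real m * D \<le> I\<^sub>0 / 4" for m
      using that
    proof (induction m)
      case 0
      have "\<bar>residual j\<^sub>0 0\<bar> \<le> \<eta>" by (rule exact[OF t0]) (use j\<^sub>0 I0 j0_range[of j\<^sub>0] I\<^sub>0 in auto)
      then have "\<bar>residual j\<^sub>0 0\<bar> \<le> 2 * \<eta>" using \<eta> by linarith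
      then show ?case by (auto intro!: exI[of _ j\<^sub>0])
    next
      case (Suc m)
      have SD: "real (Suc m) * D = real m * D + D" by (simp add: algebra_simps)
      then have mD: "real m * D \<le> I\<^sub>0 / 4" using Suc.prems D by linarith
      note IH = Suc.IH[OF mD]
      show ?case
      proof (intro ballI impI)
        fix t assume t: "t \<in> {0..T}" "t \<le> real (Suc m) * len"
        show "\<exists>j. \<bar>j - j\<^sub>0\<bar> \<le> real (Suc m) * D \<and> \<bar>residual j t\<bar> \<le> 2 * \<eta>"
        proof (cases "t \<le> real m * len")
          case True
          then obtain j where "\<bar>j - j\<^sub>0\<bar> \<le> real m * D" "\<bar>residual j t\<bar> \<le> 2 * \<eta>" using IH t by blast
          then show ?thesis using D unfolding SD by (intro exI[of _ j]) auto
        next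
          case False
          define a where "a = real m * len"
          have a: "a \<in> {0..T}" "0 \<le> a" using False t len by (auto simp: a_def)
          obtain j where j: "\<bar>j - j\<^sub>0\<bar> \<le> real m * D" "\<bar>residual j a\<bar> \<le> 2 * \<eta>"
            using IH a(1) by (auto simp: a_def)
          have jr: "I\<^sub>0 / 4 \<le> j" "j \<le> 2 * I\<^sub>0" using j0_range[of j] j mD by auto
          obtain j' where j': "\<bar>j' - j\<bar> \<le> D" "action d \<epsilon> v a = j' * ratio (\<epsilon> / j') (ang a) (\<epsilon> * a)"
            using rebase[OF a(1) jr j(2)] by blast
          have dj: "\<bar>j' - j\<^sub>0\<bar> \<le> real (Suc m) * D" unfolding SD using j(1) j'(1) by linarith
          then have jr': "I\<^sub>0 / 4 \<le> j'" using j0_range[of j'] Suc.prems by linarith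
          have j'0: "0 < j'" using jr' I\<^sub>0 by simp
          have "\<bar>residual j' t\<bar> \<le> 2 * \<eta>"
          proof (rule residual_window[OF j'0 _ E3[OF \<delta>(1,3)[OF jr']]])
            show "0 \<le> K" using K by simp
            show "0 \<le> a" by fact
            show "t \<le> T" using t by simp
            have "t - a \<le> len" using t(2) by (simp add: a_def algebra_simps)
            then have "\<epsilon> * K * (t - a) \<le> \<epsilon> * K * len" using \<epsilon> K by (intro mult_left_mono) auto
            then show "\<epsilon> * K * (t - a) \<le> 1 / 4" using len by linarith
            show "(\<epsilon> / j') ^ n \<le> \<eta>" using \<delta>(4)[OF jr'] \<eta> by linarith
            show "\<eta> \<le> 1 / 2" using \<eta>2 by simp
            show "\<bar>residual j' a\<bar> \<le> \<eta>" by (rule exact[OF a(1) jr' j'(2)])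
            show "t \<in> {a..t}" using False by (simp add: a_def)
          qed auto
          then show ?thesis using dj by blast
        qed
      qed
    qed
    define m where "m = nat \<lceil>T / len\<rceil>"
    have m: "T / len \<le> real m" "real m \<le> T / len + 1"
  proof -
    have "0 \<le> T / len" using T len by simp
    then show "T / len \<le> real m" "real m \<le> T / len + 1" unfolding m_def by linarith+
  qed
    have "real m * D \<le> (T / len + 1) * D" using m D by (intro mult_right_mono) auto
    also have "\<dots> = (4 * K * \<epsilon> * T + 1) * D" by (simp add: len_def)
    also have "\<dots> \<le> (4 * K * 1 * (L / \<epsilon> ^ k) + 1 / \<epsilon> ^ k) * D"
    proof (intro mult_right_mono add_mono mult_mono)
      show "1 \<le> 1 / \<epsilon> ^ k" using \<epsilon> by (simp add: power_le_one)
    qed (use K \<epsilon> T D L in auto)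
    also have "\<dots> = C\<^sub>1 * \<epsilon> ^ r"
      using \<epsilon>(1) unfolding D(2) C\<^sub>1_def n by (simp add: power_add field_simps)
    finally have mD: "real m * D \<le> C\<^sub>1 * \<epsilon> ^ r" .
    have final: "\<exists>j. \<bar>j - j\<^sub>0\<bar> \<le> (C\<^sub>1 + B) * \<epsilon> ^ r \<and> I\<^sub>0 / 4 \<le> j \<and> j \<le> 2 * I\<^sub>0 \<and>
         \<bar>action d \<epsilon> v t - j * ratio (\<epsilon> / j) (ang t) (\<epsilon> * t)\<bar> \<le> (C\<^sub>1 + B) * \<epsilon> ^ r \<and>
         I\<^sub>0 / 16 \<le> action d \<epsilon> v t \<and> action d \<epsilon> v t \<le> 4 * I\<^sub>0" if t: "t \<in> {0..T}" for t
    proof -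
      have "t \<le> real m * len" using t m(1) len by (simp add: field_simps)
      then obtain j where j: "\<bar>j - j\<^sub>0\<bar> \<le> real m * D" "\<bar>residual j t\<bar> \<le> 2 * \<eta>"
        using main[of m] mD C\<^sub>1\<epsilon> t by force
      have jr: "I\<^sub>0 / 4 \<le> j" "j \<le> 2 * I\<^sub>0" using j0_range[of j] j mD C\<^sub>1\<epsilon> by auto
      have split: "(C\<^sub>1 + B) * \<epsilon> ^ r = C\<^sub>1 * \<epsilon> ^ r + B * \<epsilon> ^ r" by (simp add: distrib_right)
      have nn: "0 \<le> C\<^sub>1 * \<epsilon> ^ r" "0 \<le> B * \<epsilon> ^ r" using C\<^sub>1 B \<epsilon> by auto
      have "D / 2 \<le> (C\<^sub>1 + B) * \<epsilon> ^ r" "real m * D \<le> (C\<^sub>1 + B) * \<epsilon> ^ r"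
        using D D' mD nn unfolding split by linarith+
      then show ?thesis using j(1) jr close[OF t jr j(2)] by (intro exI[of _ j]) auto
    qed
    then show "\<exists>j\<^sub>0. \<forall>t\<in>{0..T}. \<exists>j. \<bar>j - j\<^sub>0\<bar> \<le> (C\<^sub>1 + B) * \<epsilon> ^ r \<and> I\<^sub>0 / 4 \<le> j \<and> j \<le> 2 * I\<^sub>0 \<and>
         \<bar>action d \<epsilon> v t - j * ratio (\<epsilon> / j) (signed_angle d \<epsilon> (v t) (x t) t) (\<epsilon> * t)\<bar> \<le> (C\<^sub>1 + B) * \<epsilon> ^ r \<and>
         I\<^sub>0 / 16 \<le> action d \<epsilon> v t \<and> action d \<epsilon> v t \<le> 4 * I\<^sub>0"
      unfolding ang_def by blast
  qed
qed

end

section \<open>From the generating function to the new variables\<close>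

context averaged_motion
begin

text \<open>
  A particle that sits on the moving wall and is faster than the wall would have to be outside of the
  interval shortly afterwards. For positive times the impact law excludes a positive velocity at the
  wall, because the velocity before the impact pointed towards the wall. Hence the signed angle is
  never \<open>\<pi>\<close> and agrees with \<open>wrap\<close> of the lifted angle, also at the impacts. On an interval of length
  zero the velocity at the wall is not constrained, which is why \<open>T\<close> has to be positive. The factor
  \<open>1 / 3\<close> makes the particle faster than twice the speed of the wall, as the impact law requires.
\<close>
lemma leaves_wall:
  assumes T: "0 < T" and t: "t \<in> {0..T}"
    and fast: "\<And>s. s \<in> {0..T} \<Longrightarrow> vm \<le> \<bar>v s\<bar>" and vm: "0 < vm"
    and wall: "\<And>s. s \<in> {0..T} \<Longrightarrow> \<bar>\<epsilon> * deriv d (\<epsilon> * s)\<bar> \<le> vm / 3"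
  shows "\<not> (v t > 0 \<and> x t = d (\<epsilon> * t))"
proof
  assume vx: "v t > 0 \<and> x t = d (\<epsilon> * t)"
  have wall_move: "d (\<epsilon> * s) \<le> d (\<epsilon> * t) + vm / 3 * \<bar>s - t\<bar>" if "s \<in> {0..T}" for s
  proof -
    have "norm (d (\<epsilon> * s) - d (\<epsilon> * t)) \<le> vm / 3 * norm (s - t)"
      by (rule field_differentiable_bound[of "{0..T}" "\<lambda>t. d (\<epsilon> * t)" "\<lambda>s. \<epsilon> * deriv d (\<epsilon> * s)"])
        (use wall that t in \<open>auto intro: has_field_derivative_at_within[OF slow_time_deriv]\<close>)
    then have "\<bar>d (\<epsilon> * s) - d (\<epsilon> * t)\<bar> \<le> vm / 3 * \<bar>s - t\<bar>" by simp
    then show ?thesis using abs_ge_self[of "d (\<epsilon> * s) - d (\<epsilon> * t)"] by linarith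
  qed
  show False
  proof (cases "t = 0")
    case True
    then have t': "0 \<le> t" "t < T" using T by auto
    obtain r where r: "r > 0" "t + r \<le> T" "\<And>s. t \<le> s \<Longrightarrow> s < t + r \<Longrightarrow> v s = v t"
      "\<And>s. t < s \<Longrightarrow> s < t + r \<Longrightarrow> s \<notin> impacts"
      using that by (rule v_right[OF t'])
    define s where "s = t + r / 2"
    have s: "t < s" "s < t + r" "s \<in> {0..T}" using r(1,2) t' by (auto simp: s_def)
    have "x s - x t = v t * (s - t)" by (rule x_affine_right[OF t'(1) r s(1,2)])
    moreover have "vm * (s - t) \<le> v t * (s - t)"
      using fast[OF t] vx s by (intro mult_right_mono) auto
    moreover have "0 < vm * (s - t)" using vm s by simp
    moreover have "d (\<epsilon> * s) \<le> d (\<epsilon> * t) + vm * (s - t) / 3" using wall_move[OF s(3)] s by simp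
    ultimately show False using x_bounds[OF s(3)] vx by linarith
  next
    case False
    then have t': "0 < t" "t \<le> T" using t by auto
    obtain r u where r: "r > 0" "r \<le> t" "\<And>s. t - r < s \<Longrightarrow> s < t \<Longrightarrow> v s = u"
      "\<And>s. t - r < s \<Longrightarrow> s < t \<Longrightarrow> s \<notin> impacts"
      and u: "t \<in> impacts \<Longrightarrow> v t = reflected d \<epsilon> (x t) t u" "t \<notin> impacts \<Longrightarrow> v t = u"
      using that by (rule v_left[OF t'])
    define s where "s = t - r / 2"
    have s: "t - r < s" "s < t" "s \<in> {0..T}" using r(1,2) t' by (auto simp: s_def)
    have "t \<in> impacts" using vx t by (simp add: impact_times_def)
    then have "v t = 2 * (\<epsilon> * deriv d (\<epsilon> * t)) - u"
      using u(1) vx d_pos[of "\<epsilon> * t"] by (simp add: reflected_def)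
    then have "u < 2 * (vm / 3)" using vx wall[OF t] by linarith
    moreover have "vm \<le> \<bar>u\<bar>" using fast[OF s(3)] r(3)[OF s(1,2)] by simp
    ultimately have "u \<le> - vm" using vm by linarith
    then have "u * (t - s) \<le> - vm * (t - s)" using s by (intro mult_right_mono) auto
    moreover have "x t - x s = u * (t - s)" by (rule x_affine_left[OF t' r s(1,2)])
    moreover have "0 < vm * (t - s)" using vm s by simp
    moreover have "d (\<epsilon> * s) \<le> d (\<epsilon> * t) + vm * (t - s) / 3" using wall_move[OF s(3)] s by simp
    ultimately show False using x_bounds[OF s(3)] vx by linarith
  qed
qed

lemma wrap_lift:
  assumes lift: "lifted_angle d \<epsilon> T x v \<phi>" and t: "t \<in> {0..T}"
    and "\<not> (v t > 0 \<and> x t = d (\<epsilon> * t))"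
  shows "wrap (\<phi> t) = ang t"
proof -
  obtain m :: int where m: "\<phi> t = ang t + 2 * pi * of_int m" using lift_ang[OF lift t] by blast
  have "- pi \<le> ang t" using ang_bounds[OF t] by linarith
  moreover have "ang t < pi"
  proof (cases "v t > 0")
    case True
    then have "x t < d (\<epsilon> * t)" using assms(3) x_bounds[OF t] by linarith
    then show ?thesis using True d_pos[of "\<epsilon> * t"] by (simp add: ang_def signed_angle_def field_simps)
  next
    case False
    then have "ang t \<le> 0" using x_bounds[OF t] d_pos[of "\<epsilon> * t"] by (simp add: ang_def signed_angle_def)
    then show ?thesis using pi_gt_zero by linarith
  qed
  ultimately show ?thesis using m by (rule wrap_unique)
qed

end

context moving_wall
begin

lemma Ssum_generating:
  assumes "\<And>i. 1 \<le> i \<Longrightarrow> i < r \<Longrightarrow> S i J \<phi> \<tau> = J * s i (wrap \<phi>) \<tau> / J ^ i"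
    and "\<epsilon> > 0"
  shows "Ssum r S J \<phi> \<tau> \<epsilon> = J / \<epsilon> * generating s r (\<epsilon> / J) (wrap \<phi>) \<tau>"
proof -
  have "\<epsilon> ^ (i - 1) * S i J \<phi> \<tau> = J / \<epsilon> * ((\<epsilon> / J) ^ i * s i (wrap \<phi>) \<tau>)" if "i \<in> {1..<r}" for i
  proof -
    have "\<epsilon> ^ i = \<epsilon> * \<epsilon> ^ (i - 1)" using that by (cases i) auto
    then show ?thesis using assms that by (simp add: power_divide)
  qed
  then show ?thesis unfolding Ssum_def generating_def sum_distrib_left by (rule sum.cong[OF refl])
qed

lemma new_action_map:
  assumes S: "\<And>i \<phi>. 1 \<le> i \<Longrightarrow> i < r \<Longrightarrow> S i J \<phi> \<tau> = J * s i (wrap \<phi>) \<tau> / J ^ i"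
    and \<epsilon>: "\<epsilon> > 0" and J: "J > 0" and g: "generating s r \<in> phase_poly d"
  shows "J + \<epsilon> * dS_phi r S J \<phi> \<tau> \<epsilon> = J * (1 + D_ang (generating s r) (\<epsilon> / J) (wrap \<phi>) \<tau>)"
proof -
  have "(\<lambda>\<psi>. Ssum r S J \<psi> \<tau> \<epsilon>) = (\<lambda>\<psi>. J / \<epsilon> * generating s r (\<epsilon> / J) (wrap \<psi>) \<tau>)"
    by (rule ext) (rule Ssum_generating[of r S J _ \<tau> s, OF S \<epsilon>])
  moreover have "((\<lambda>\<psi>. J / \<epsilon> * generating s r (\<epsilon> / J) (wrap \<psi>) \<tau>) has_real_derivative
      J / \<epsilon> * (D_ang (generating s r) (\<epsilon> / J) (wrap \<phi>) \<tau> * 1)) (at \<phi> within {\<phi><..})"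
    by (intro DERIV_cmult DERIV_chain2[OF D_ang[OF g] wrap_has_derivative_right])
  ultimately have "((\<lambda>\<psi>. Ssum r S J \<psi> \<tau> \<epsilon>) has_vector_derivative
      J / \<epsilon> * D_ang (generating s r) (\<epsilon> / J) (wrap \<phi>) \<tau>) (at_right \<phi>)"
    by (simp flip: has_real_derivative_iff_has_vector_derivative)
  then have "dS_phi r S J \<phi> \<tau> \<epsilon> = J / \<epsilon> * D_ang (generating s r) (\<epsilon> / J) (wrap \<phi>) \<tau>"
    unfolding dS_phi_def by (rule vector_derivative_within[rotated]) simp
  then show ?thesis using \<epsilon> by (simp add: distrib_left)
qed

lemma scaled_deriv:
  assumes f: "f \<in> phase_poly d" and J: "J > 0"
  shows "((\<lambda>K. f (\<epsilon> / K) \<theta> \<tau>) has_real_derivative D_eps f (\<epsilon> / J) \<theta> \<tau> * (- \<epsilon> / J\<^sup>2)) (at J)"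
proof (rule DERIV_chain2[OF D_eps[OF f]])
  show "((\<lambda>K. \<epsilon> / K) has_real_derivative - \<epsilon> / J\<^sup>2) (at J)"
    using J by (auto intro!: derivative_eq_intros simp: power2_eq_square)
qed

lemma new_angle_shift:
  assumes S: "\<And>i J. 1 \<le> i \<Longrightarrow> i < r \<Longrightarrow> J > 0 \<Longrightarrow> S i J \<phi> \<tau> = J * s i (wrap \<phi>) \<tau> / J ^ i"
    and \<epsilon>: "\<epsilon> > 0" and J: "J > 0" and g: "generating s r \<in> phase_poly d"
  shows "\<epsilon> * dS_action r S J \<phi> \<tau> \<epsilon> = generating s r (\<epsilon> / J) (wrap \<phi>) \<tau>
      - \<epsilon> / J * D_eps (generating s r) (\<epsilon> / J) (wrap \<phi>) \<tau>"
proof -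
  let ?g = "\<lambda>\<delta>. generating s r \<delta> (wrap \<phi>) \<tau>" and ?g' = "\<lambda>\<delta>. D_eps (generating s r) \<delta> (wrap \<phi>) \<tau>"
  have "((\<lambda>K. K * ?g (\<epsilon> / K)) has_real_derivative 1 * ?g (\<epsilon> / J) + ?g' (\<epsilon> / J) * (- \<epsilon> / J\<^sup>2) * J) (at J)"
    by (rule DERIV_mult[OF DERIV_ident scaled_deriv[OF g J]])
  from DERIV_cdivide[OF this, of \<epsilon>]
  have "((\<lambda>K. K * ?g (\<epsilon> / K) / \<epsilon>) has_real_derivative (?g (\<epsilon> / J) - \<epsilon> / J * ?g' (\<epsilon> / J)) / \<epsilon>) (at J)"
    by (rule DERIV_cong) (use J in \<open>simp add: power2_eq_square\<close>)
  then have "((\<lambda>K. Ssum r S K \<phi> \<tau> \<epsilon>) has_real_derivative (?g (\<epsilon> / J) - \<epsilon> / J * ?g' (\<epsilon> / J)) / \<epsilon>) (at J)"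
  proof (rule has_field_derivative_transform_within_open[of _ _ _ "{0<..}"])
    show "K * ?g (\<epsilon> / K) / \<epsilon> = Ssum r S K \<phi> \<tau> \<epsilon>" if "K \<in> {0<..}" for K
      using Ssum_generating[of r S K \<phi> \<tau> s \<epsilon>] S \<epsilon> that by simp
  qed (use J in auto)
  then show ?thesis unfolding dS_action_def using \<epsilon> by (simp add: DERIV_imp_deriv)
qed

lemma truncated_frequency:
  assumes h: "\<And>i J. 1 \<le> i \<Longrightarrow> i < r \<Longrightarrow> J > 0 \<Longrightarrow> h i J \<tau> = J\<^sup>2 * \<eta> i \<tau> / J ^ i"
    and \<epsilon>: "\<epsilon> > 0" and J: "J > 0" and e: "energy_terms \<eta> r \<in> phase_poly d"
  shows "deriv (\<lambda>J. Ham_Sigma d r h J \<tau> \<epsilon>) J = J * (stiffness d \<tau> + 2 * energy_terms \<eta> r (\<epsilon> / J) \<theta> \<tau>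
     - \<epsilon> / J * D_eps (energy_terms \<eta> r) (\<epsilon> / J) \<theta> \<tau>)"
proof -
  let ?e = "\<lambda>\<delta>. energy_terms \<eta> r \<delta> \<theta> \<tau>" and ?e' = "\<lambda>\<delta>. D_eps (energy_terms \<eta> r) \<delta> \<theta> \<tau>"
  have eq: "K\<^sup>2 * (stiffness d \<tau> / 2 + ?e (\<epsilon> / K)) = Ham_Sigma d r h K \<tau> \<epsilon>" if "K \<in> {0<..}" for K
  proof -
    have "K\<^sup>2 * ?e (\<epsilon> / K) = (\<Sum>i\<in>{1..<r}. \<epsilon> ^ i * h i K \<tau>)"
      unfolding energy_terms_def sum_distrib_left using h that by (intro sum.cong) (auto simp: power_divide)
    then show ?thesis by (simp add: Ham_Sigma_def stiffness_def distrib_left mult_ac)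
  qed
  have sq: "((\<lambda>K. K\<^sup>2) has_real_derivative 2 * J) (at J)" by (auto intro!: derivative_eq_intros)
  have "((\<lambda>K. stiffness d \<tau> / 2 + ?e (\<epsilon> / K)) has_real_derivative 0 + ?e' (\<epsilon> / J) * (- \<epsilon> / J\<^sup>2)) (at J)"
    by (intro DERIV_add DERIV_const scaled_deriv[OF e J])
  from DERIV_mult[OF sq this]
  have "((\<lambda>K. K\<^sup>2 * (stiffness d \<tau> / 2 + ?e (\<epsilon> / K))) has_real_derivative
      J * (stiffness d \<tau> + 2 * ?e (\<epsilon> / J) - \<epsilon> / J * ?e' (\<epsilon> / J))) (at J)"
    by (rule DERIV_cong) (use J in \<open>simp add: power2_eq_square field_simps\<close>)
  then have "((\<lambda>K. Ham_Sigma d r h K \<tau> \<epsilon>) has_real_derivative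
      J * (stiffness d \<tau> + 2 * ?e (\<epsilon> / J) - \<epsilon> / J * ?e' (\<epsilon> / J))) (at J)"
    by (rule has_field_derivative_transform_within_open[of _ _ _ "{0<..}"]) (use J eq in auto)
  then show ?thesis by (rule DERIV_imp_deriv)
qed

end

context normal_form
begin

text \<open>
  Integration of \<open>averaged_phase_deriv\<close>. The constant depends neither on the motion nor on \<open>\<epsilon>\<close>; \<open>B\<close> is the
  accuracy with which the frozen action is preserved.
\<close>
lemma phase_drift:
  obtains C where "C > 0"
    "\<And>\<epsilon> T x v \<phi> j B \<Phi> t. averaged_motion d c\<^sub>0 M \<sigma> e R n \<epsilon> T x v \<Longrightarrow> lifted_angle d \<epsilon> T x v \<phi> \<Longrightarrow>
      0 < j \<Longrightarrow> \<epsilon> / j \<le> 1 \<Longrightarrow> 0 \<le> B \<Longrightarrow>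
      (\<forall>t\<in>{0..T}. \<bar>action d \<epsilon> v t - j * ratio (\<epsilon> / j) (signed_angle d \<epsilon> (v t) (x t) t) (\<epsilon> * t)\<bar> \<le> B) \<Longrightarrow>
      (\<forall>t\<in>{0..T}. (\<Phi> has_real_derivative j * (stiffness d (\<epsilon> * t) + 2 * e (\<epsilon> / j) 0 (\<epsilon> * t)
           - \<epsilon> / j * D_eps e (\<epsilon> / j) 0 (\<epsilon> * t))) (at t within {0..T})) \<Longrightarrow> t \<in> {0..T} \<Longrightarrow>
      \<bar>(\<phi> t + phase_shift (\<epsilon> / j) (signed_angle d \<epsilon> (v t) (x t) t) (\<epsilon> * t) - \<Phi> t)
       - (\<phi> 0 + phase_shift (\<epsilon> / j) (signed_angle d \<epsilon> (v 0) (x 0) 0) 0 - \<Phi> 0)\<bar> \<le> C * (B + j * (\<epsilon> / j) ^ n) * t"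
proof -
  define F where "F = (\<lambda>\<delta> \<theta> \<tau>. stiffness d \<tau> * (ratio \<delta> \<theta> \<tau> - \<delta> * D_ang (D_eps \<sigma>) \<delta> \<theta> \<tau>))"
  define G where "G = (\<lambda>\<delta> \<theta> \<tau>. (2 - real n) * R \<delta> \<theta> \<tau> - \<delta> * D_eps R \<delta> \<theta> \<tau>)"
  have Fin: "F \<in> phase_poly d" unfolding F_def ratio_def
    by (intro phase_poly_intros stiffness_in D_ang_in D_eps_in \<sigma>)
  have Gin: "G \<in> phase_poly d" unfolding G_def by (intro phase_poly_intros D_eps_in R)
  obtain CF where CF: "CF > 0"
    "\<And>\<delta> \<theta> \<tau>. 0 \<le> \<delta> \<Longrightarrow> \<delta> \<le> 1 \<Longrightarrow> \<bar>\<theta>\<bar> \<le> pi \<Longrightarrow> \<tau> \<in> M \<Longrightarrow> \<bar>F \<delta> \<theta> \<tau>\<bar> \<le> CF"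
    using that by (rule phase_poly_bounded[OF Fin])
  obtain CG where CG: "CG > 0"
    "\<And>\<delta> \<theta> \<tau>. 0 \<le> \<delta> \<Longrightarrow> \<delta> \<le> 1 \<Longrightarrow> \<bar>\<theta>\<bar> \<le> pi \<Longrightarrow> \<tau> \<in> M \<Longrightarrow> \<bar>G \<delta> \<theta> \<tau>\<bar> \<le> CG"
    using that by (rule phase_poly_bounded[OF Gin])
  show ?thesis
  proof (rule that[of "CF + CG"])
    show "CF + CG > 0" using CF CG by simp
    fix \<epsilon> T x v \<phi> j B \<Phi> t
    assume am: "averaged_motion d c\<^sub>0 M \<sigma> e R n \<epsilon> T x v" and lift: "lifted_angle d \<epsilon> T x v \<phi>"
      and j: "0 < j" "\<epsilon> / j \<le> 1" and B: "0 \<le> B"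
      and near: "\<forall>t\<in>{0..T}. \<bar>action d \<epsilon> v t - j * ratio (\<epsilon> / j) (signed_angle d \<epsilon> (v t) (x t) t) (\<epsilon> * t)\<bar> \<le> B"
      and \<Phi>: "\<forall>t\<in>{0..T}. (\<Phi> has_real_derivative j * (stiffness d (\<epsilon> * t) + 2 * e (\<epsilon> / j) 0 (\<epsilon> * t)
           - \<epsilon> / j * D_eps e (\<epsilon> / j) 0 (\<epsilon> * t))) (at t within {0..T})"
      and t: "t \<in> {0..T}"
    interpret averaged_motion d c\<^sub>0 M \<sigma> e R n \<epsilon> T x v by (rule am)
    define \<delta> where "\<delta> = \<epsilon> / j"
    have \<delta>: "0 \<le> \<delta>" "\<delta> \<le> 1" using j \<epsilon>_pos by (simp_all add: \<delta>_def)
    define f where "f = (\<lambda>t. \<phi> t + phase_shift \<delta> (ang t) (\<epsilon> * t) - \<Phi> t)"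
    have e_const: "e \<delta> \<theta> \<tau> = e \<delta> 0 \<tau>" "D_eps e \<delta> \<theta> \<tau> = D_eps e \<delta> 0 \<tau>" for \<theta> \<tau>
    proof -
      have "(\<lambda>x. e x \<theta> \<tau>) = (\<lambda>x. e x 0 \<tau>)" by (rule ext) (rule e_ang)
      then show "D_eps e \<delta> \<theta> \<tau> = D_eps e \<delta> 0 \<tau>" by (simp add: D_eps_def)
    qed (rule e_ang)
    have "\<bar>f t - f 0\<bar> \<le> ((CF + CG) * (B + j * \<delta> ^ n)) * (t - 0)"
    proof (rule exceptional_mvt_bound[OF _ _ finite_impacts])
      show "0 \<le> t" using t by simp
      have "continuous_on {0..T} \<Phi>" by (rule DERIV_continuous_on[OF bspec[OF \<Phi>]])
      then have "continuous_on {0..T} f"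
        unfolding f_def by (intro continuous_on_diff averaged_phase_continuous[OF lift])
      then show "continuous_on {0..t} f" by (rule continuous_on_subset) (use t in auto)
      show "0 \<le> (CF + CG) * (B + j * \<delta> ^ n)" using CF CG B j \<delta> by simp
      fix s assume s: "s \<in> {0<..<t} - impacts"
      then have s': "0 < s" "s < T" "s \<notin> impacts" "s \<in> {0..T}" using t by auto
      have \<Phi>s: "(\<Phi> has_real_derivative j * (stiffness d (\<epsilon> * s) + 2 * e \<delta> 0 (\<epsilon> * s)
           - \<delta> * D_eps e \<delta> 0 (\<epsilon> * s))) (at s)"
        using bspec[OF \<Phi> s'(4)] at_within_interior[of s "{0..T}"] s' by (simp add: \<delta>_def)
      define w where "w = ratio \<delta> (ang s) (\<epsilon> * s)"
      have D: "(f has_real_derivative (j * (scaled_action j s - w)) * F \<delta> (ang s) (\<epsilon> * s) + j * \<delta> ^ n * G \<delta> (ang s) (\<epsilon> * s)) (at s)"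
        unfolding f_def
        by (rule DERIV_cong[OF DERIV_diff[OF averaged_phase_deriv[OF lift s'(1-3) j(1), folded \<delta>_def] \<Phi>s]])
          (simp add: e_const[of "ang s"] F_def G_def w_def algebra_simps)
      have "j * (scaled_action j s - w) = action d \<epsilon> v s - j * w"
        using j by (simp add: scaled_action_def action_def right_diff_distrib)
      then have 1: "\<bar>j * (scaled_action j s - w)\<bar> \<le> B"
        using bspec[OF near s'(4)] by (simp add: w_def \<delta>_def ang_def)
      have "\<bar>(j * (scaled_action j s - w)) * F \<delta> (ang s) (\<epsilon> * s)\<bar> \<le> B * CF"
        unfolding abs_mult[of "j * (scaled_action j s - w)"]
        by (rule mult_mono'[OF 1 CF(2)[OF \<delta> ang_bounds[OF s'(4)] slow[OF s'(4)]]]) auto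
      moreover have "\<bar>j * \<delta> ^ n * G \<delta> (ang s) (\<epsilon> * s)\<bar> \<le> j * \<delta> ^ n * CG"
        unfolding abs_mult[of "j * \<delta> ^ n"]
        using CG(2)[OF \<delta> ang_bounds[OF s'(4)] slow[OF s'(4)]] j \<delta> by (intro mult_mono') auto
      ultimately have "\<bar>(j * (scaled_action j s - w)) * F \<delta> (ang s) (\<epsilon> * s) + j * \<delta> ^ n * G \<delta> (ang s) (\<epsilon> * s)\<bar>
          \<le> B * CF + j * \<delta> ^ n * CG" by linarith
      also have "\<dots> \<le> (CF + CG) * (B + j * \<delta> ^ n)"
        using CF CG B j \<delta> by (simp add: algebra_simps)
      finally show "\<exists>f'. (f has_real_derivative f') (at s) \<and> \<bar>f'\<bar> \<le> (CF + CG) * (B + j * \<delta> ^ n)"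
        using D by blast
    qed
    then show "\<bar>(\<phi> t + phase_shift (\<epsilon> / j) (signed_angle d \<epsilon> (v t) (x t) t) (\<epsilon> * t) - \<Phi> t)
       - (\<phi> 0 + phase_shift (\<epsilon> / j) (signed_angle d \<epsilon> (v 0) (x 0) 0) 0 - \<Phi> 0)\<bar> \<le> (CF + CG) * (B + j * (\<epsilon> / j) ^ n) * t"
      by (simp add: f_def \<delta>_def ang_def)
  qed
qed

end

section \<open>Invariance over long times\<close>

lemma abs_diff_le_trans:
  fixes a b c p q :: real
  assumes "\<bar>a - b\<bar> \<le> p" "\<bar>b - c\<bar> \<le> q"
  shows "\<bar>a - c\<bar> \<le> p + q"
  using assms by linarith

context bounded_wall
begin

text \<open>
  The set \<open>M\<close> contains the slow times that can be reached and the bounds on \<open>d\<close> hold on it. Both normal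
  forms, of order \<open>r\<close> and of order \<open>r + k\<close>, are truncations of the same formal solution; the one of
  order \<open>r\<close> defines the variables of the statement, the other one controls the drift.
\<close>
theorem adiabatic_invariance:
  assumes r: "r \<ge> 1" and nf: "normalizing d r S h" and I\<^sub>0: "I\<^sub>0 > 0" and L: "L > 0"
    and slow: "\<And>\<epsilon> t. 0 < \<epsilon> \<Longrightarrow> \<epsilon> < 1 \<Longrightarrow> 0 \<le> t \<Longrightarrow> t \<le> L / \<epsilon> ^ k \<Longrightarrow> \<epsilon> * t \<in> M"
  obtains C \<epsilon>\<^sub>0 where "C > 0" "\<epsilon>\<^sub>0 > 0"
    "\<And>\<epsilon> T x v \<phi>. \<epsilon> \<in> {0<..<\<epsilon>\<^sub>0} \<Longrightarrow> 0 \<le> T \<Longrightarrow> T \<le> L / \<epsilon> ^ k \<Longrightarrow> fermi_ulam_motion d \<epsilon> T x v \<Longrightarrow>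
      lifted_angle d \<epsilon> T x v \<phi> \<Longrightarrow> action d \<epsilon> v 0 = I\<^sub>0 \<Longrightarrow>
      (let Ihat = (\<lambda>t. new_action r S \<epsilon> (action d \<epsilon> v t) (\<phi> t) (\<epsilon> * t));
           phihat = (\<lambda>t. new_angle r S \<epsilon> (action d \<epsilon> v t) (\<phi> t) (\<epsilon> * t))
       in (\<forall>t\<in>{0..T}. \<exists>!J. is_new_action r S \<epsilon> (action d \<epsilon> v t) (\<phi> t) (\<epsilon> * t) J) \<and>
          (\<forall>t\<in>{0..T}. \<bar>Ihat t - Ihat 0\<bar> \<le> C * \<epsilon> ^ r) \<and>
          (\<exists>\<Phi>. \<Phi> 0 = phihat 0 \<and>
             (\<forall>t\<in>{0..T}. (\<Phi> has_real_derivative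
                deriv (\<lambda>J. Ham_Sigma d r h J (\<epsilon> * t) \<epsilon>) (Ihat 0)) (at t within {0..T})) \<and>
             (\<forall>t\<in>{0..T}. \<bar>phihat t - \<Phi> t\<bar> \<le> C * \<epsilon> powi (int r - int k))))"
proof -
  define N where "N = r + k"
  obtain s \<eta> where s\<eta>: "\<And>n. n \<in> {1..N} \<Longrightarrow> (\<forall>i\<in>{1..<n}. (\<lambda>_. s i) \<in> phase_poly d \<and> (\<lambda>_ _. \<eta> i) \<in> phase_poly d \<and>
       zero_mean_periodic (s i)) \<and>
     (\<exists>R\<in>phase_poly d. solves_HJ d (generating s n) (energy_terms \<eta> n) n R)"
    using formal_solution[of N] by blast
  have nform: "\<exists>R. normal_form d c\<^sub>0 M (generating s n) (energy_terms \<eta> n) R n" if n: "n \<in> {1..N}" for n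
  proof -
    obtain R where R: "R \<in> phase_poly d" "solves_HJ d (generating s n) (energy_terms \<eta> n) n R"
      using s\<eta>[OF n] by blast
    have si: "(\<lambda>_. s i) \<in> phase_poly d" "(\<lambda>_ _. \<eta> i) \<in> phase_poly d" "s i pi \<tau> = s i (- pi) \<tau>"
      if "i \<in> {1..<n}" for i \<tau>
      using s\<eta>[OF n] that unfolding zero_mean_periodic_def by blast+
    have "normal_form d c\<^sub>0 M (generating s n) (energy_terms \<eta> n) R n"
    proof
      show "generating s n \<in> phase_poly d" by (rule generating_in[OF si(1)])
      show "energy_terms \<eta> n \<in> phase_poly d" by (rule energy_terms_in[OF si(2)])
      show "generating s n \<delta> pi \<tau> = generating s n \<delta> (- pi) \<tau>" for \<delta> \<tau>
        unfolding generating_def using si(3) by (intro sum.cong) auto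
    qed (use R in \<open>simp_all add: generating_zero_eps energy_terms_def\<close>)
    then show ?thesis by blast
  qed
  have rN: "r \<in> {1..N}" "N \<in> {1..N}" using r by (auto simp: N_def)
  define \<sigma> where "\<sigma> = generating s r"
  define e where "e = energy_terms \<eta> r"
  define \<sigma>' where "\<sigma>' = generating s N"
  define e' where "e' = energy_terms \<eta> N"
  obtain R where R: "normal_form d c\<^sub>0 M \<sigma> e R r" using nform[OF rN(1)] by (auto simp: \<sigma>_def e_def)
  obtain R' where R': "normal_form d c\<^sub>0 M \<sigma>' e' R' N" using nform[OF rN(2)] by (auto simp: \<sigma>'_def e'_def)
  interpret low: normal_form d c\<^sub>0 M \<sigma> e R r by (rule R)
  interpret high: normal_form d c\<^sub>0 M \<sigma>' e' R' N by (rule R')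
  have si: "(\<lambda>_. s i) \<in> phase_poly d" if "i \<in> {1..<N}" for i using s\<eta>[OF rN(2)] that by blast
  have sr: "(\<lambda>_. s i) \<in> phase_poly d \<and> (\<lambda>_ _. \<eta> i) \<in> phase_poly d \<and> zero_mean_periodic (s i)"
    if "i \<in> {1..<r}" for i using s\<eta>[OF rN(1)] that by blast
  have Seq: "S i J \<phi> \<tau> = J * s i (wrap \<phi>) \<tau> / J ^ i" and heq: "h i J \<tau> = J\<^sup>2 * \<eta> i \<tau> / J ^ i"
    if "1 \<le> i" "i < r" "J > 0" for i J \<phi> \<tau>
    using normal_form_unique[OF nf sr low.R low.HJ[unfolded \<sigma>_def e_def] that] by blast+
  (* The terms of order below \<open>r\<close> cancel in the difference. *)
  obtain Q where Q: "Q \<in> phase_poly d" "\<And>\<delta> \<theta> \<tau>. high.ratio \<delta> \<theta> \<tau> - low.ratio \<delta> \<theta> \<tau> = \<delta> ^ r * Q \<delta> \<theta> \<tau>"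
  proof -
    define Q where "Q = (\<lambda>\<delta> \<theta> \<tau>. \<Sum>i\<in>{r..<N}. \<delta> ^ (i - r) * D_ang (\<lambda>_. s i) \<delta> \<theta> \<tau>)"
    have Qin: "Q \<in> phase_poly d" unfolding Q_def
      by (intro phase_poly_intros D_ang_in si) (use r in auto)
    have "high.ratio \<delta> \<theta> \<tau> - low.ratio \<delta> \<theta> \<tau> = \<delta> ^ r * Q \<delta> \<theta> \<tau>" for \<delta> \<theta> \<tau>
    proof -
      have N: "{1..<N} = {1..<r} \<union> {r..<N}" "{1..<r} \<inter> {r..<N} = {}" using r by (auto simp: N_def)
      have "(\<Sum>i\<in>{1..<N}. \<delta> ^ i * D_ang (\<lambda>_. s i) \<delta> \<theta> \<tau>)
          = (\<Sum>i\<in>{1..<r}. \<delta> ^ i * D_ang (\<lambda>_. s i) \<delta> \<theta> \<tau>) + (\<Sum>i\<in>{r..<N}. \<delta> ^ i * D_ang (\<lambda>_. s i) \<delta> \<theta> \<tau>)"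
        unfolding N(1) by (rule sum.union_disjoint) (use N(2) in auto)
      moreover have "(\<Sum>i\<in>{r..<N}. \<delta> ^ i * D_ang (\<lambda>_. s i) \<delta> \<theta> \<tau>) = \<delta> ^ r * Q \<delta> \<theta> \<tau>"
        unfolding Q_def sum_distrib_left
        by (intro sum.cong) (auto simp: power_add[symmetric] mult.assoc[symmetric])
      ultimately show ?thesis
        unfolding high.ratio_def low.ratio_def
        unfolding \<sigma>_def \<sigma>'_def
        using generating_D_ang[of N s, OF si] generating_D_ang[of r s] sr by simp
    qed
    then show ?thesis using that Qin by blast
  qed
  obtain CQ where CQ: "CQ > 0"
    "\<And>\<delta> \<theta> \<tau>. 0 \<le> \<delta> \<Longrightarrow> \<delta> \<le> 1 \<Longrightarrow> \<bar>\<theta>\<bar> \<le> pi \<Longrightarrow> \<tau> \<in> M \<Longrightarrow> \<bar>Q \<delta> \<theta> \<tau>\<bar> \<le> CQ"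
    using that by (rule phase_poly_bounded[OF Q(1)])
  obtain CW where CW: "CW > 0"
    "\<And>\<delta> \<delta>' \<theta> \<tau>. 0 \<le> \<delta> \<Longrightarrow> \<delta> \<le> 1 \<Longrightarrow> 0 \<le> \<delta>' \<Longrightarrow> \<delta>' \<le> 1 \<Longrightarrow> \<bar>\<theta>\<bar> \<le> pi \<Longrightarrow> \<tau> \<in> M \<Longrightarrow>
       \<bar>low.phase_shift \<delta> \<theta> \<tau> - low.phase_shift \<delta>' \<theta> \<tau>\<bar> \<le> CW * \<bar>\<delta> - \<delta>'\<bar>"
    using that by (rule phase_poly_lipschitz[OF low.phase_shift_in])
  note p = D_ang_in[OF low.\<sigma>] low.D_ang_zero_eps
  obtain \<delta>\<^sub>1 K' where \<delta>\<^sub>1: "0 < \<delta>\<^sub>1" "\<delta>\<^sub>1 \<le> 1" "K' > 0"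
    and slope0: "\<And>\<epsilon> a j j' \<theta> \<tau>. 0 < a \<Longrightarrow> 0 < \<epsilon> \<Longrightarrow> \<epsilon> \<le> \<delta>\<^sub>1 * a \<Longrightarrow> a \<le> j \<Longrightarrow> a \<le> j' \<Longrightarrow> \<bar>\<theta>\<bar> \<le> pi \<Longrightarrow> \<tau> \<in> M \<Longrightarrow>
       \<bar>j * (1 + D_ang \<sigma> (\<epsilon> / j) \<theta> \<tau>) - j' * (1 + D_ang \<sigma> (\<epsilon> / j') \<theta> \<tau>) - (j - j')\<bar> \<le> \<bar>j - j'\<bar> / 2"
    "\<And>\<epsilon> a j \<theta> \<tau>. 0 < a \<Longrightarrow> 0 < \<epsilon> \<Longrightarrow> \<epsilon> \<le> \<delta>\<^sub>1 * a \<Longrightarrow> a \<le> j \<Longrightarrow> \<bar>\<theta>\<bar> \<le> pi \<Longrightarrow> \<tau> \<in> M \<Longrightarrow>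
       \<bar>j * (1 + D_ang \<sigma> (\<epsilon> / j) \<theta> \<tau>) - j\<bar> \<le> K' * \<epsilon>"
    using that by (rule near_identity[OF p])
  obtain \<kappa> where \<kappa>: "0 < \<kappa>"
    and inv: "\<And>\<epsilon> a I \<theta> \<tau>. 0 < a \<Longrightarrow> 0 < \<epsilon> \<Longrightarrow> \<epsilon> \<le> \<kappa> * a \<Longrightarrow> a \<le> I \<Longrightarrow> \<bar>\<theta>\<bar> \<le> pi \<Longrightarrow> \<tau> \<in> M \<Longrightarrow>
       \<exists>!J. \<bar>J - I\<bar> \<le> I / 2 \<and> I = J * (1 + D_ang \<sigma> (\<epsilon> / J) \<theta> \<tau>)"
    using that by (rule near_identity_inverse[OF p])
  obtain C\<^sub>1 \<epsilon>\<^sub>1 where C\<^sub>1: "C\<^sub>1 > 0" and \<epsilon>\<^sub>1: "\<epsilon>\<^sub>1 > 0"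
    and drift: "\<And>\<epsilon> T x v. \<epsilon> < \<epsilon>\<^sub>1 \<Longrightarrow> 0 \<le> T \<Longrightarrow> T \<le> L / \<epsilon> ^ k \<Longrightarrow> averaged_motion d c\<^sub>0 M \<sigma>' e' R' N \<epsilon> T x v \<Longrightarrow>
       action d \<epsilon> v 0 = I\<^sub>0 \<Longrightarrow>
       \<exists>j\<^sub>0. \<forall>t\<in>{0..T}. \<exists>j. \<bar>j - j\<^sub>0\<bar> \<le> C\<^sub>1 * \<epsilon> ^ r \<and> I\<^sub>0 / 4 \<le> j \<and> j \<le> 2 * I\<^sub>0 \<and>
         \<bar>action d \<epsilon> v t - j * high.ratio (\<epsilon> / j) (signed_angle d \<epsilon> (v t) (x t) t) (\<epsilon> * t)\<bar> \<le> C\<^sub>1 * \<epsilon> ^ r \<and>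
         I\<^sub>0 / 16 \<le> action d \<epsilon> v t \<and> action d \<epsilon> v t \<le> 4 * I\<^sub>0"
    using that by (rule high.action_drift[OF I\<^sub>0 L r N_def])
  obtain CP where CP: "CP > 0"
    and phase: "\<And>\<epsilon> T x v \<phi> j B \<Phi> t. averaged_motion d c\<^sub>0 M \<sigma> e R r \<epsilon> T x v \<Longrightarrow> lifted_angle d \<epsilon> T x v \<phi> \<Longrightarrow>
      0 < j \<Longrightarrow> \<epsilon> / j \<le> 1 \<Longrightarrow> 0 \<le> B \<Longrightarrow>
      (\<forall>t\<in>{0..T}. \<bar>action d \<epsilon> v t - j * low.ratio (\<epsilon> / j) (signed_angle d \<epsilon> (v t) (x t) t) (\<epsilon> * t)\<bar> \<le> B) \<Longrightarrow>
      (\<forall>t\<in>{0..T}. (\<Phi> has_real_derivative j * (stiffness d (\<epsilon> * t) + 2 * e (\<epsilon> / j) 0 (\<epsilon> * t)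
           - \<epsilon> / j * D_eps e (\<epsilon> / j) 0 (\<epsilon> * t))) (at t within {0..T})) \<Longrightarrow> t \<in> {0..T} \<Longrightarrow>
      \<bar>(\<phi> t + low.phase_shift (\<epsilon> / j) (signed_angle d \<epsilon> (v t) (x t) t) (\<epsilon> * t) - \<Phi> t)
       - (\<phi> 0 + low.phase_shift (\<epsilon> / j) (signed_angle d \<epsilon> (v 0) (x 0) 0) 0 - \<Phi> 0)\<bar> \<le> CP * (B + j * (\<epsilon> / j) ^ r) * t"
    using that by (rule low.phase_drift)
  obtain Dm where Dm: "Dm > 0" "\<And>\<tau>. \<tau> \<in> M \<Longrightarrow> \<bar>(deriv ^^ 0) d \<tau>\<bar> \<le> Dm"
    using that by (rule coeff_alg_bound[OF coeff_alg.deriv])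
  obtain Dm' where Dm': "Dm' > 0" "\<And>\<tau>. \<tau> \<in> M \<Longrightarrow> \<bar>(deriv ^^ 1) d \<tau>\<bar> \<le> Dm'"
    using that by (rule coeff_alg_bound[OF coeff_alg.deriv])
  (* A lower bound for the speed: the action never falls below \<open>I\<^sub>0 / 16\<close>. *)
  define vm where "vm = pi * (I\<^sub>0 / 16) / Dm"
  have vm: "vm > 0" using I\<^sub>0 Dm by (simp add: vm_def)
  define C\<^sub>2 where "C\<^sub>2 = C\<^sub>1 + 2 * I\<^sub>0 * (CQ * (4 / I\<^sub>0) ^ r)"
  define C\<^sub>3 where "C\<^sub>3 = 2 * C\<^sub>2 + C\<^sub>1"
  define C\<^sub>4 where "C\<^sub>4 = CP * (3 * C\<^sub>3 + 6 * I\<^sub>0 * (32 / I\<^sub>0) ^ r) * L"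
  define C\<^sub>5 where "C\<^sub>5 = CW * (2 * C\<^sub>3 * (32 / I\<^sub>0))"
  have Cpos: "C\<^sub>2 > 0" "C\<^sub>3 > 0" "C\<^sub>4 > 0" "C\<^sub>5 > 0"
  proof -
    show C2: "C\<^sub>2 > 0" using C\<^sub>1 CQ I\<^sub>0 by (simp add: C\<^sub>2_def add_pos_pos)
    show C3: "C\<^sub>3 > 0" using C2 C\<^sub>1 by (simp add: C\<^sub>3_def)
    show "C\<^sub>4 > 0" using C3 CP I\<^sub>0 L unfolding C\<^sub>4_def by (intro mult_pos_pos add_pos_pos) auto
    show "C\<^sub>5 > 0" using C3 CW I\<^sub>0 unfolding C\<^sub>5_def by (intro mult_pos_pos) auto
  qed
  define \<epsilon>\<^sub>0 where "\<epsilon>\<^sub>0 = Min {1, \<epsilon>\<^sub>1, \<delta>\<^sub>1 * (I\<^sub>0 / 32), \<kappa> * (I\<^sub>0 / 16), I\<^sub>0 / 32, vm / (3 * Dm')}"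
  have \<epsilon>\<^sub>0: "\<epsilon>\<^sub>0 > 0" using \<epsilon>\<^sub>1 \<delta>\<^sub>1 \<kappa> I\<^sub>0 vm Dm' by (simp add: \<epsilon>\<^sub>0_def)
  define C where "C = 2 * C\<^sub>3 + C\<^sub>4 + C\<^sub>5"
  have C: "C > 0" using Cpos by (simp add: C_def)
  show ?thesis
  proof (rule that[OF C \<epsilon>\<^sub>0])
    fix \<epsilon> T x v \<phi>
    assume small: "\<epsilon> \<in> {0<..<\<epsilon>\<^sub>0}" and T: "0 \<le> T" "T \<le> L / \<epsilon> ^ k" and mot: "fermi_ulam_motion d \<epsilon> T x v"
      and lift: "lifted_angle d \<epsilon> T x v \<phi>" and I0: "action d \<epsilon> v 0 = I\<^sub>0"
    have \<epsilon>: "0 < \<epsilon>" "\<epsilon> < 1" "\<epsilon> < \<epsilon>\<^sub>1" "\<epsilon> \<le> \<delta>\<^sub>1 * (I\<^sub>0 / 32)" "\<epsilon> \<le> \<kappa> * (I\<^sub>0 / 16)" "\<epsilon> \<le> I\<^sub>0 / 32" "\<epsilon> \<le> vm / (3 * Dm')"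
      using small by (auto simp: \<epsilon>\<^sub>0_def)
    have sl: "\<epsilon> * t \<in> M" if "t \<in> {0..T}" for t using slow[of \<epsilon> t] \<epsilon> T that by auto
    interpret am: averaged_motion d c\<^sub>0 M \<sigma> e R r \<epsilon> T x v
      by unfold_locales (use \<epsilon> mot sl in auto)
    have am': "averaged_motion d c\<^sub>0 M \<sigma>' e' R' N \<epsilon> T x v"
      by unfold_locales (use sl in auto)
    obtain j\<^sub>0 where drift': "\<And>t. t \<in> {0..T} \<Longrightarrow> \<exists>j. \<bar>j - j\<^sub>0\<bar> \<le> C\<^sub>1 * \<epsilon> ^ r \<and> I\<^sub>0 / 4 \<le> j \<and> j \<le> 2 * I\<^sub>0 \<and>
         \<bar>action d \<epsilon> v t - j * high.ratio (\<epsilon> / j) (am.ang t) (\<epsilon> * t)\<bar> \<le> C\<^sub>1 * \<epsilon> ^ r \<and>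
         I\<^sub>0 / 16 \<le> action d \<epsilon> v t \<and> action d \<epsilon> v t \<le> 4 * I\<^sub>0"
      using drift[OF \<epsilon>(3) T am' I0] unfolding am.ang_def by blast
    define I where "I = action d \<epsilon> v"
    have I: "I\<^sub>0 / 16 \<le> I t" "I t \<le> 4 * I\<^sub>0" if "t \<in> {0..T}" for t
      using drift'[OF that] unfolding I_def by blast+
    define J where "J = (\<lambda>t. new_action r S \<epsilon> (I t) (\<phi> t) (\<epsilon> * t))"
    have a: "0 < I\<^sub>0 / 32" "0 < I\<^sub>0 / 16" using I\<^sub>0 by auto
    have wr: "\<bar>wrap \<psi>\<bar> \<le> pi" for \<psi> using wrap_ge[of \<psi>] wrap_less[of \<psi>] by linarith
    have is_new: "is_new_action r S \<epsilon> (I t) (\<phi> t) (\<epsilon> * t) j \<longleftrightarrow>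
        \<bar>j - I t\<bar> \<le> I t / 2 \<and> I t = j * (1 + D_ang \<sigma> (\<epsilon> / j) (wrap (\<phi> t)) (\<epsilon> * t))" if "t \<in> {0..T}" for t j
    proof (cases "\<bar>j - I t\<bar> \<le> I t / 2")
      case True
      then have "j > 0" using I(1)[OF that] I\<^sub>0 by argo
      then show ?thesis
        using new_action_map[of r S j "\<epsilon> * t" s \<epsilon> "\<phi> t", OF Seq \<epsilon>(1)] low.\<sigma>
        unfolding is_new_action_def \<sigma>_def by simp
    qed (simp add: is_new_action_def)
    have ex1: "\<exists>!j. is_new_action r S \<epsilon> (I t) (\<phi> t) (\<epsilon> * t) j" if t: "t \<in> {0..T}" for t
      unfolding is_new[OF t] by (rule inv[OF a(2) \<epsilon>(1,5) I(1)[OF t] wr sl[OF t]])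
    have J0: "\<bar>J t - I t\<bar> \<le> I t / 2 \<and> I t = J t * (1 + D_ang \<sigma> (\<epsilon> / J t) (wrap (\<phi> t)) (\<epsilon> * t))"
      if t: "t \<in> {0..T}" for t
      unfolding is_new[OF t, symmetric] J_def new_action_def by (rule theI'[OF ex1[OF t]])
    have J: "I\<^sub>0 / 32 \<le> J t" "J t \<le> 6 * I\<^sub>0" "0 < J t" if t: "t \<in> {0..T}" for t
    proof -
      have "\<bar>J t - I t\<bar> \<le> I t / 2" using J0[OF t] by blast
      then show "I\<^sub>0 / 32 \<le> J t" "J t \<le> 6 * I\<^sub>0" using I[OF t] by argo+
      then show "0 < J t" using a by linarith
    qed
    have small_ratio: "0 \<le> \<epsilon> / j" "\<epsilon> / j \<le> 1" "\<epsilon> / j \<le> 32 / I\<^sub>0 * \<epsilon>" if "I\<^sub>0 / 32 \<le> j" for j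
    proof -
      have j: "j > 0" using that a by linarith
      show "0 \<le> \<epsilon> / j" "\<epsilon> / j \<le> 1" using j \<epsilon> that by auto
      show "\<epsilon> / j \<le> 32 / I\<^sub>0 * \<epsilon>" using j \<epsilon> that I\<^sub>0 by (simp add: field_simps)
    qed
    define shift where "shift = (\<lambda>t. low.phase_shift (\<epsilon> / J t) (wrap (\<phi> t)) (\<epsilon> * t))"
    have new_angle: "new_angle r S \<epsilon> (I t) (\<phi> t) (\<epsilon> * t) = \<phi> t + shift t" if t: "t \<in> {0..T}" for t
    proof -
      have Jt: "new_action r S \<epsilon> (I t) (\<phi> t) (\<epsilon> * t) = J t" by (simp add: J_def)
      have "\<epsilon> * dS_action r S (J t) (\<phi> t) (\<epsilon> * t) \<epsilon> = shift t"
        unfolding shift_def low.phase_shift_def unfolding \<sigma>_def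
        by (rule new_angle_shift[of r S "\<phi> t" "\<epsilon> * t" s \<epsilon> "J t", OF Seq \<epsilon>(1) J(3)[OF t] low.\<sigma>[unfolded \<sigma>_def]])
      then show ?thesis unfolding new_angle_def Jt by simp
    qed
    define \<Phi> where "\<Phi> = (\<lambda>t. \<phi> 0 + shift 0 + integral {0..t} (\<lambda>t. deriv (\<lambda>J. Ham_Sigma d r h J (\<epsilon> * t) \<epsilon>) (J 0)))"
    have t0: "0 \<in> {0..T}" using T by simp
    have freq: "deriv (\<lambda>J. Ham_Sigma d r h J (\<epsilon> * t) \<epsilon>) (J 0) = J 0 * (stiffness d (\<epsilon> * t) + 2 * e (\<epsilon> / J 0) 0 (\<epsilon> * t)
           - \<epsilon> / J 0 * D_eps e (\<epsilon> / J 0) 0 (\<epsilon> * t))" for t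
      using low.e unfolding e_def by (intro truncated_frequency heq \<epsilon>(1) J(3)[OF t0])
    have \<Phi>: "(\<Phi> has_real_derivative deriv (\<lambda>J. Ham_Sigma d r h J (\<epsilon> * t) \<epsilon>) (J 0)) (at t within {0..T})"
      if t: "t \<in> {0..T}" for t
    proof -
      have c: "continuous_on {0..T} (\<lambda>t. f \<delta> 0 (\<epsilon> * t))" if "f \<in> phase_poly d" for f \<delta>
        by (rule phase_poly_continuous[OF that continuous_on_const am.slow_cont])
      have cA: "continuous_on {0..T} (\<lambda>t. stiffness d (\<epsilon> * t))" using c[OF stiffness_in] .
      have "continuous_on {0..T} (\<lambda>t. deriv (\<lambda>J. Ham_Sigma d r h J (\<epsilon> * t) \<epsilon>) (J 0))"
        unfolding freq
        by (intro continuous_on_mult continuous_on_add continuous_on_diff continuous_on_const cA c low.e D_eps_in)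
      from DERIV_add[OF DERIV_const[of "\<phi> 0 + shift 0"] integral_has_real_derivative[OF this t]]
      show ?thesis unfolding \<Phi>_def by simp
    qed
    have \<Phi>0: "\<Phi> 0 = \<phi> 0 + shift 0" by (simp add: \<Phi>_def)
    have powi: "\<epsilon> powi (int r - int k) = \<epsilon> ^ r / \<epsilon> ^ k" using \<epsilon> by (simp add: power_int_diff)
    have drift_bounds: "\<bar>J t - J 0\<bar> \<le> C * \<epsilon> ^ r \<and> \<bar>\<phi> t + shift t - \<Phi> t\<bar> \<le> C * \<epsilon> powi (int r - int k)" if t: "t \<in> {0..T}" for t
    (* For \<open>T = 0\<close> the wrapped phase may differ from the signed angle, but there is nothing to compare. *)
    proof (cases "T = 0")
      case True
      then show ?thesis using t C \<epsilon> \<Phi>0 by (simp add: powi)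
    next
      case False
      then have T': "0 < T" using T by simp
      have fast: "vm \<le> \<bar>v t\<bar>" if t: "t \<in> {0..T}" for t
      proof -
        have "d (\<epsilon> * t) \<le> Dm" using Dm(2)[OF sl[OF t]] by simp
        then have "I\<^sub>0 / 16 \<le> \<bar>v t\<bar> * Dm / pi"
          using I(1)[OF t] unfolding I_def action_def
          by (meson abs_ge_zero divide_right_mono mult_left_mono order_trans pi_ge_zero)
        then show ?thesis using Dm by (simp add: vm_def field_simps)
      qed
      have wall: "\<bar>\<epsilon> * deriv d (\<epsilon> * t)\<bar> \<le> vm / 3" if t: "t \<in> {0..T}" for t
      proof -
        have "\<epsilon> * \<bar>deriv d (\<epsilon> * t)\<bar> \<le> vm / (3 * Dm') * Dm'"
          using Dm'(2)[OF sl[OF t]] \<epsilon> vm Dm'(1) by (intro mult_mono) auto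
        then show ?thesis using \<epsilon> Dm'(1) by (simp add: abs_mult)
      qed
      have wrap: "wrap (\<phi> t) = am.ang t" if t: "t \<in> {0..T}" for t
        by (rule am.wrap_lift[OF lift t am.leaves_wall[OF T' t fast vm wall]])
      have ang: "\<bar>am.ang t\<bar> \<le> pi" if "t \<in> {0..T}" for t by (rule am.ang_bounds[OF that])
      have IJ: "I t = J t * low.ratio (\<epsilon> / J t) (am.ang t) (\<epsilon> * t)" if t: "t \<in> {0..T}" for t
        using conjunct2[OF J0[OF t]] unfolding low.ratio_def wrap[OF t] .
      have slope: "\<bar>j * low.ratio (\<epsilon> / j) (am.ang t) (\<epsilon> * t) - j' * low.ratio (\<epsilon> / j') (am.ang t) (\<epsilon> * t) - (j - j')\<bar> \<le> \<bar>j - j'\<bar> / 2"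
        if "t \<in> {0..T}" "I\<^sub>0 / 32 \<le> j" "I\<^sub>0 / 32 \<le> j'" for t j j'
        unfolding low.ratio_def by (rule slope0(1)[OF a(1) \<epsilon>(1,4) that(2,3) ang[OF that(1)] sl[OF that(1)]])
      have near: "\<bar>J t - j\<^sub>0\<bar> \<le> C\<^sub>3 * \<epsilon> ^ r" if t: "t \<in> {0..T}" for t
      proof -
        obtain j where j: "\<bar>j - j\<^sub>0\<bar> \<le> C\<^sub>1 * \<epsilon> ^ r" "I\<^sub>0 / 4 \<le> j" "j \<le> 2 * I\<^sub>0"
          "\<bar>I t - j * high.ratio (\<epsilon> / j) (am.ang t) (\<epsilon> * t)\<bar> \<le> C\<^sub>1 * \<epsilon> ^ r"
          using drift'[OF t] unfolding I_def by blast
        have j0: "j > 0" "I\<^sub>0 / 32 \<le> j" using j I\<^sub>0 by auto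
        have "\<epsilon> / j \<le> 4 / I\<^sub>0 * \<epsilon>" using j j0 I\<^sub>0 \<epsilon> by (simp add: field_simps)
        then have pw: "(\<epsilon> / j) ^ r \<le> (4 / I\<^sub>0) ^ r * \<epsilon> ^ r"
          unfolding power_mult_distrib[symmetric] using small_ratio(1)[OF j0(2)] by (rule power_mono)
        have "\<bar>high.ratio (\<epsilon> / j) (am.ang t) (\<epsilon> * t) - low.ratio (\<epsilon> / j) (am.ang t) (\<epsilon> * t)\<bar>
            = (\<epsilon> / j) ^ r * \<bar>Q (\<epsilon> / j) (am.ang t) (\<epsilon> * t)\<bar>"
          unfolding Q(2) abs_mult using small_ratio(1)[OF j0(2)] by (simp only: power_abs abs_of_nonneg)
        also have "\<dots> \<le> ((4 / I\<^sub>0) ^ r * \<epsilon> ^ r) * CQ"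
          by (intro mult_mono pw CQ small_ratio[OF j0(2)] ang sl t) (use I\<^sub>0 \<epsilon> in auto)
        finally have "\<bar>j * high.ratio (\<epsilon> / j) (am.ang t) (\<epsilon> * t) - j * low.ratio (\<epsilon> / j) (am.ang t) (\<epsilon> * t)\<bar>
            \<le> j * (((4 / I\<^sub>0) ^ r * \<epsilon> ^ r) * CQ)"
          unfolding right_diff_distrib[symmetric] abs_mult using j0 by (simp add: mult_left_mono)
        also have "\<dots> \<le> (2 * I\<^sub>0) * (((4 / I\<^sub>0) ^ r * \<epsilon> ^ r) * CQ)"
          using j CQ I\<^sub>0 \<epsilon> by (intro mult_right_mono) auto
        finally have "\<bar>j * high.ratio (\<epsilon> / j) (am.ang t) (\<epsilon> * t) - j * low.ratio (\<epsilon> / j) (am.ang t) (\<epsilon> * t)\<bar>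
            \<le> (2 * I\<^sub>0) * (((4 / I\<^sub>0) ^ r * \<epsilon> ^ r) * CQ)" .
        with j(4) have "\<bar>I t - j * low.ratio (\<epsilon> / j) (am.ang t) (\<epsilon> * t)\<bar> \<le> C\<^sub>1 * \<epsilon> ^ r + (2 * I\<^sub>0) * (((4 / I\<^sub>0) ^ r * \<epsilon> ^ r) * CQ)"
          by (rule abs_diff_le_trans)
        also have "\<dots> = C\<^sub>2 * \<epsilon> ^ r" by (simp add: C\<^sub>2_def algebra_simps)
        finally have close: "\<bar>I t - j * low.ratio (\<epsilon> / j) (am.ang t) (\<epsilon> * t)\<bar> \<le> (2 * (C\<^sub>2 * \<epsilon> ^ r)) / 2" by simp
        have "\<bar>J t - j\<bar> \<le> 2 * (C\<^sub>2 * \<epsilon> ^ r)"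
          using slope[OF t J(1)[OF t] j0(2)] close unfolding IJ[OF t, symmetric] by (rule abs_le_of_half_slope)
        then show ?thesis using j(1) unfolding C\<^sub>3_def distrib_right by linarith
      qed
      have JJ: "\<bar>J t - J 0\<bar> \<le> 2 * C\<^sub>3 * \<epsilon> ^ r" if t: "t \<in> {0..T}" for t
        using near[OF t] near[OF t0] by linarith
      have er: "0 < \<epsilon> ^ r" "0 < \<epsilon> ^ k" "\<epsilon> ^ k \<le> 1" using \<epsilon> by (auto simp: power_le_one)
      have erk: "\<epsilon> ^ r \<le> \<epsilon> ^ r / \<epsilon> ^ k"
        using mult_left_mono[OF er(3), of "\<epsilon> ^ r"] er by (simp add: pos_le_divide_eq)
      have near0: "\<bar>action d \<epsilon> v t - J 0 * low.ratio (\<epsilon> / J 0) (signed_angle d \<epsilon> (v t) (x t) t) (\<epsilon> * t)\<bar> \<le> 3 * C\<^sub>3 * \<epsilon> ^ r"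
        if t: "t \<in> {0..T}" for t
      proof -
        have "\<bar>I t - J 0 * low.ratio (\<epsilon> / J 0) (am.ang t) (\<epsilon> * t) - (J t - J 0)\<bar> \<le> \<bar>J t - J 0\<bar> / 2"
          using slope[OF t J(1)[OF t] J(1)[OF t0]] unfolding IJ[OF t, symmetric] .
        then have "\<bar>I t - J 0 * low.ratio (\<epsilon> / J 0) (am.ang t) (\<epsilon> * t)\<bar> \<le> 3 / 2 * \<bar>J t - J 0\<bar>" by argo
        also have "\<dots> \<le> 3 / 2 * (2 * C\<^sub>3 * \<epsilon> ^ r)" using JJ[OF t] by (rule mult_left_mono) simp
        finally show ?thesis unfolding I_def am.ang_def by simp
      qed
      have main: "\<bar>(\<phi> t + low.phase_shift (\<epsilon> / J 0) (am.ang t) (\<epsilon> * t) - \<Phi> t)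
          - (\<phi> 0 + low.phase_shift (\<epsilon> / J 0) (am.ang 0) 0 - \<Phi> 0)\<bar> \<le> CP * (3 * C\<^sub>3 * \<epsilon> ^ r + J 0 * (\<epsilon> / J 0) ^ r) * t"
        unfolding am.ang_def
      proof (rule phase[OF am.averaged_motion_axioms lift J(3)[OF t0] small_ratio(2)[OF J(1)[OF t0]] _ _ _ t])
        show "\<forall>t\<in>{0..T}. \<bar>action d \<epsilon> v t - J 0 * low.ratio (\<epsilon> / J 0) (signed_angle d \<epsilon> (v t) (x t) t) (\<epsilon> * t)\<bar> \<le> 3 * C\<^sub>3 * \<epsilon> ^ r"
          using near0 by blast
        show "0 \<le> 3 * C\<^sub>3 * \<epsilon> ^ r" using Cpos er by simp
        show "\<forall>t\<in>{0..T}. (\<Phi> has_real_derivative J 0 * (stiffness d (\<epsilon> * t) + 2 * e (\<epsilon> / J 0) 0 (\<epsilon> * t)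
           - \<epsilon> / J 0 * D_eps e (\<epsilon> / J 0) 0 (\<epsilon> * t))) (at t within {0..T})"
          using \<Phi> unfolding freq by blast
      qed
      have "shift 0 = low.phase_shift (\<epsilon> / J 0) (am.ang 0) 0" by (simp add: shift_def wrap[OF t0])
      then have start: "\<phi> 0 + low.phase_shift (\<epsilon> / J 0) (am.ang 0) 0 - \<Phi> 0 = 0" using \<Phi>0 by simp
      have "(\<epsilon> / J 0) ^ r \<le> (32 / I\<^sub>0) ^ r * \<epsilon> ^ r"
        unfolding power_mult_distrib[symmetric] by (rule power_mono[OF small_ratio(3,1)[OF J(1)[OF t0]]])
      then have JJr: "J 0 * (\<epsilon> / J 0) ^ r \<le> (6 * I\<^sub>0) * ((32 / I\<^sub>0) ^ r * \<epsilon> ^ r)"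
        using J[OF t0] I\<^sub>0 \<epsilon> by (intro mult_mono) auto
      have "CP * (3 * C\<^sub>3 * \<epsilon> ^ r + J 0 * (\<epsilon> / J 0) ^ r) * t
          \<le> CP * (3 * C\<^sub>3 * \<epsilon> ^ r + (6 * I\<^sub>0) * ((32 / I\<^sub>0) ^ r * \<epsilon> ^ r)) * (L / \<epsilon> ^ k)"
      proof (rule mult_mono[OF mult_left_mono[OF add_left_mono[OF JJr]]])
        show "0 \<le> CP * (3 * C\<^sub>3 * \<epsilon> ^ r + (6 * I\<^sub>0) * ((32 / I\<^sub>0) ^ r * \<epsilon> ^ r))"
          using CP Cpos er I\<^sub>0 by (intro mult_nonneg_nonneg add_nonneg_nonneg) auto
      qed (use CP t T in auto)
      also have "\<dots> = C\<^sub>4 * (\<epsilon> ^ r / \<epsilon> ^ k)" by (simp add: C\<^sub>4_def field_simps)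
      finally have 1: "\<bar>\<phi> t + low.phase_shift (\<epsilon> / J 0) (am.ang t) (\<epsilon> * t) - \<Phi> t\<bar> \<le> C\<^sub>4 * (\<epsilon> ^ r / \<epsilon> ^ k)"
        using main unfolding start by simp
      have "\<bar>shift t - low.phase_shift (\<epsilon> / J 0) (am.ang t) (\<epsilon> * t)\<bar> \<le> CW * \<bar>\<epsilon> / J t - \<epsilon> / J 0\<bar>"
        unfolding shift_def wrap[OF t]
        by (intro CW small_ratio J ang sl t t0)
      also have "\<bar>\<epsilon> / J t - \<epsilon> / J 0\<bar> = (\<epsilon> / J t) * \<bar>J t - J 0\<bar> * (1 / J 0)"
      proof -
        have "\<epsilon> / J t - \<epsilon> / J 0 = (\<epsilon> / J t) * (J 0 - J t) * (1 / J 0)"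
          using J(3)[OF t] J(3)[OF t0] by (simp add: field_simps)
        then show ?thesis using J(3)[OF t] J(3)[OF t0] \<epsilon> by (simp add: abs_mult abs_minus_commute)
      qed
      also have "CW * \<dots> \<le> CW * (1 * (2 * C\<^sub>3 * \<epsilon> ^ r) * (32 / I\<^sub>0))"
      proof (intro mult_left_mono mult_mono)
        show "\<epsilon> / J t \<le> 1" by (rule small_ratio(2)[OF J(1)[OF t]])
        show "\<bar>J t - J 0\<bar> \<le> 2 * C\<^sub>3 * \<epsilon> ^ r" by (rule JJ[OF t])
        show "1 / J 0 \<le> 32 / I\<^sub>0" using J(1)[OF t0] J(3)[OF t0] I\<^sub>0 by (simp add: field_simps)
      qed (use CW Cpos er J(3)[OF t] J(3)[OF t0] \<epsilon> in auto)
      also have "\<dots> = C\<^sub>5 * \<epsilon> ^ r" by (simp add: C\<^sub>5_def)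
      also have "\<dots> \<le> C\<^sub>5 * (\<epsilon> ^ r / \<epsilon> ^ k)" using erk Cpos by (intro mult_left_mono) auto
      finally have 2: "\<bar>shift t - low.phase_shift (\<epsilon> / J 0) (am.ang t) (\<epsilon> * t)\<bar> \<le> C\<^sub>5 * (\<epsilon> ^ r / \<epsilon> ^ k)" .
      have nn: "0 \<le> 2 * C\<^sub>3 * (\<epsilon> ^ r / \<epsilon> ^ k)" "0 \<le> C\<^sub>4 * \<epsilon> ^ r" "0 \<le> C\<^sub>5 * \<epsilon> ^ r" using Cpos er by auto
      show ?thesis
      proof
        show "\<bar>J t - J 0\<bar> \<le> C * \<epsilon> ^ r"
          using JJ[OF t] nn unfolding C_def distrib_right by linarith
        show "\<bar>\<phi> t + shift t - \<Phi> t\<bar> \<le> C * \<epsilon> powi (int r - int k)"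
          using 1 2 nn unfolding powi C_def distrib_right by linarith
      qed
    qed
    show "let Ihat = (\<lambda>t. new_action r S \<epsilon> (action d \<epsilon> v t) (\<phi> t) (\<epsilon> * t));
           phihat = (\<lambda>t. new_angle r S \<epsilon> (action d \<epsilon> v t) (\<phi> t) (\<epsilon> * t))
       in (\<forall>t\<in>{0..T}. \<exists>!J. is_new_action r S \<epsilon> (action d \<epsilon> v t) (\<phi> t) (\<epsilon> * t) J) \<and>
          (\<forall>t\<in>{0..T}. \<bar>Ihat t - Ihat 0\<bar> \<le> C * \<epsilon> ^ r) \<and>
          (\<exists>\<Phi>. \<Phi> 0 = phihat 0 \<and>
             (\<forall>t\<in>{0..T}. (\<Phi> has_real_derivative
                deriv (\<lambda>J. Ham_Sigma d r h J (\<epsilon> * t) \<epsilon>) (Ihat 0)) (at t within {0..T})) \<and>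
             (\<forall>t\<in>{0..T}. \<bar>phihat t - \<Phi> t\<bar> \<le> C * \<epsilon> powi (int r - int k)))"
      unfolding Let_def I_def[symmetric]
    proof (intro conjI exI[of _ \<Phi>] ballI)
      have Jt: "new_action r S \<epsilon> (I t) (\<phi> t) (\<epsilon> * t) = J t" for t by (simp add: J_def)
      show "\<Phi> 0 = new_angle r S \<epsilon> (I 0) (\<phi> 0) (\<epsilon> * 0)" unfolding \<Phi>0 by (rule new_angle[OF t0, symmetric])
      fix t assume t: "t \<in> {0..T}"
      show "\<exists>!j. is_new_action r S \<epsilon> (I t) (\<phi> t) (\<epsilon> * t) j" by (rule ex1[OF t])
      show "(\<Phi> has_real_derivative deriv (\<lambda>J. Ham_Sigma d r h J (\<epsilon> * t) \<epsilon>)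
          (new_action r S \<epsilon> (I 0) (\<phi> 0) (\<epsilon> * 0))) (at t within {0..T})"
        unfolding Jt by (rule \<Phi>[OF t])
      show "\<bar>new_action r S \<epsilon> (I t) (\<phi> t) (\<epsilon> * t) - new_action r S \<epsilon> (I 0) (\<phi> 0) (\<epsilon> * 0)\<bar> \<le> C * \<epsilon> ^ r"
        unfolding Jt using drift_bounds[OF t] by blast
      show "\<bar>new_angle r S \<epsilon> (I t) (\<phi> t) (\<epsilon> * t) - \<Phi> t\<bar> \<le> C * \<epsilon> powi (int r - int k)"
        unfolding new_angle[OF t] using drift_bounds[OF t] by blast
    qed
  qed
qed

end

theorem corollary1p1:
  fixes d :: "real \<Rightarrow> real"
    and r k :: nat
    and S :: "nat \<Rightarrow> real \<Rightarrow> real \<Rightarrow> real \<Rightarrow> real"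
    and h :: "nat \<Rightarrow> real \<Rightarrow> real \<Rightarrow> real"
    and I\<^sub>0 L :: real
  assumes smooth_d: "\<forall>n \<tau>. (deriv ^^ n) d differentiable (at \<tau>)"
    and d_pos: "\<exists>c>0. \<forall>\<tau>. c \<le> d \<tau>"
    and d_bounded: "k \<ge> 2 \<longrightarrow> (\<forall>n. bounded (range ((deriv ^^ n) d)))"
    and r_pos: "r \<ge> 1"
    and normal_form: "normalizing d r S h"
    and I\<^sub>0_pos: "I\<^sub>0 > 0"
    and L_pos: "L > 0"
  shows "\<exists>C>0. \<exists>\<epsilon>\<^sub>0>0. \<forall>\<epsilon>\<in>{0<..<\<epsilon>\<^sub>0}. \<forall>T x v \<phi>.
    0 \<le> T \<and> T \<le> L / \<epsilon> ^ k \<and>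
    fermi_ulam_motion d \<epsilon> T x v \<and> lifted_angle d \<epsilon> T x v \<phi> \<and> action d \<epsilon> v 0 = I\<^sub>0
    \<longrightarrow>
    (let Ihat = (\<lambda>t. new_action r S \<epsilon> (action d \<epsilon> v t) (\<phi> t) (\<epsilon> * t));
         phihat = (\<lambda>t. new_angle r S \<epsilon> (action d \<epsilon> v t) (\<phi> t) (\<epsilon> * t))
     in (\<forall>t\<in>{0..T}. \<exists>!J. is_new_action r S \<epsilon> (action d \<epsilon> v t) (\<phi> t) (\<epsilon> * t) J) \<and>
        (\<forall>t\<in>{0..T}. \<bar>Ihat t - Ihat 0\<bar> \<le> C * \<epsilon> ^ r) \<and>
        (\<exists>\<Phi>. \<Phi> 0 = phihat 0 \<and>
             (\<forall>t\<in>{0..T}. (\<Phi> has_real_derivative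
                deriv (\<lambda>J. Ham_Sigma d r h J (\<epsilon> * t) \<epsilon>) (Ihat 0)) (at t within {0..T})) \<and>
             (\<forall>t\<in>{0..T}. \<bar>phihat t - \<Phi> t\<bar> \<le> C * \<epsilon> powi (int r - int k))))"
proof -
  obtain c\<^sub>0 where c\<^sub>0: "c\<^sub>0 > 0" "\<forall>\<tau>. c\<^sub>0 \<le> d \<tau>" using d_pos by blast
  (* For \<open>k \<le> 1\<close> the slow time stays in a compact interval, where the derivatives of \<open>d\<close> are bounded anyway. *)
  define M :: "real set" where "M = (if k \<le> 1 then {0..L} else UNIV)"
  interpret bounded_wall d c\<^sub>0 M
  proof
    show "(deriv ^^ n) d differentiable (at \<tau>)" for n \<tau> using smooth_d by blast
    show "0 < c\<^sub>0" "c\<^sub>0 \<le> d \<tau>" for \<tau> using c\<^sub>0 by auto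
    show "bounded ((deriv ^^ n) d ` M)" for n
    proof (cases "k \<le> 1")
      case True
      have "continuous_on {0..L} ((deriv ^^ n) d)"
        using smooth_d by (intro continuous_at_imp_continuous_on ballI differentiable_imp_continuous_within) blast
      then have "compact ((deriv ^^ n) d ` {0..L})" by (rule compact_continuous_image) simp
      then show ?thesis using True by (simp add: M_def compact_imp_bounded)
    next
      case False
      then show ?thesis using d_bounded by (simp add: M_def)
    qed
  qed
  have slow: "\<epsilon> * t \<in> M" if "0 < \<epsilon>" "\<epsilon> < 1" "0 \<le> t" "t \<le> L / \<epsilon> ^ k" for \<epsilon> t
  proof (cases "k \<le> 1")
    case True
    have "\<epsilon> * t \<le> \<epsilon> * (L / \<epsilon> ^ k)" using that by (intro mult_left_mono) auto
    also have "\<dots> \<le> L"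
    proof (cases "k = 0")
      case True
      have "\<epsilon> * L \<le> 1 * L" using that L_pos by (intro mult_right_mono) auto
      then show ?thesis using True by simp
    next
      case False
      then have "k = 1" using \<open>k \<le> 1\<close> by simp
      then show ?thesis using that by simp
    qed
    finally show ?thesis using that True by (simp add: M_def)
  qed (simp add: M_def)
  show ?thesis
  proof (rule adiabatic_invariance[OF r_pos normal_form I\<^sub>0_pos L_pos slow])
    fix C \<epsilon>\<^sub>0 :: real
    assume "C > 0" "\<epsilon>\<^sub>0 > 0"
      and main: "\<And>\<epsilon> T x v \<phi>. \<epsilon> \<in> {0<..<\<epsilon>\<^sub>0} \<Longrightarrow> 0 \<le> T \<Longrightarrow> T \<le> L / \<epsilon> ^ k \<Longrightarrow> fermi_ulam_motion d \<epsilon> T x v \<Longrightarrow>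
      lifted_angle d \<epsilon> T x v \<phi> \<Longrightarrow> action d \<epsilon> v 0 = I\<^sub>0 \<Longrightarrow>
      (let Ihat = (\<lambda>t. new_action r S \<epsilon> (action d \<epsilon> v t) (\<phi> t) (\<epsilon> * t));
           phihat = (\<lambda>t. new_angle r S \<epsilon> (action d \<epsilon> v t) (\<phi> t) (\<epsilon> * t))
       in (\<forall>t\<in>{0..T}. \<exists>!J. is_new_action r S \<epsilon> (action d \<epsilon> v t) (\<phi> t) (\<epsilon> * t) J) \<and>
          (\<forall>t\<in>{0..T}. \<bar>Ihat t - Ihat 0\<bar> \<le> C * \<epsilon> ^ r) \<and>
          (\<exists>\<Phi>. \<Phi> 0 = phihat 0 \<and>
             (\<forall>t\<in>{0..T}. (\<Phi> has_real_derivative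
                deriv (\<lambda>J. Ham_Sigma d r h J (\<epsilon> * t) \<epsilon>) (Ihat 0)) (at t within {0..T})) \<and>
             (\<forall>t\<in>{0..T}. \<bar>phihat t - \<Phi> t\<bar> \<le> C * \<epsilon> powi (int r - int k))))"
    show ?thesis
    proof (rule exI[of _ C], intro conjI exI[of _ \<epsilon>\<^sub>0] ballI allI impI)
      show "C > 0" "\<epsilon>\<^sub>0 > 0" by fact+
    qed (elim conjE, rule main)
  qed
qed

end
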